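(* For every $C^*$-algebra $A$, the Cuntz semigroup $\mathrm{Cu}(A)$ satisfies (O8): for all $x',x,y',y,z,w\in\mathrm{Cu}(A)$ with $2w=w$, $x+y\ll z+w$, $x'\ll x$ and $y'\ll y$, there exist $z_1,z_2\in\mathrm{Cu}(A)$ such that $z_1+z_2\ll z$, $x'\ll z_1+w$, $y'\ll z_2+w$, $z_1\ll x+w$, and $z_2\ll y+w$.
   Context: For $a,b\in (A\otimes\mathcal{K})_+$, $a\precsim b$ (Cuntz subequivalence) if there are $r_n$ with $\|a-r_nbr_n^*\|\to0$; $a\sim b$ if $a\precsim b\precsim a$. $\mathrm{Cu}(A)=(A\otimes\mathcal{K})_+/\!\sim$ with addition induced by orthogonal sums and order $[a]\le[b]$ iff $a\precsim b$. In a partially ordered set, $x\ll y$ (way-below) means: for every increasing sequence $(y_k)$ with $y\le\sup_k y_k$ there is $k$ with $x\le y_k$. *)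

theory Defs
  imports "HOL-Analysis.Analysis"
begin

definition cstar_algebra ::
  "(complex \<Rightarrow> 'a::{real_normed_algebra,banach} \<Rightarrow> 'a) \<Rightarrow> ('a \<Rightarrow> 'a) \<Rightarrow> bool" where
  "cstar_algebra cs st \<longleftrightarrow>
     (\<forall>a b x. cs (a + b) x = cs a x + cs b x) \<and>
     (\<forall>a x y. cs a (x + y) = cs a x + cs a y) \<and>
     (\<forall>a b x. cs (a * b) x = cs a (cs b x)) \<and>
     (\<forall>x. cs 1 x = x) \<and>
     (\<forall>r x. cs (complex_of_real r) x = r *\<^sub>R x) \<and>
     (\<forall>c x. norm (cs c x) = cmod c * norm x) \<and>
     (\<forall>c x y. cs c (x * y) = cs c x * y \<and> cs c (x * y) = x * cs c y) \<and>
     (\<forall>x. st (st x) = x) \<and>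
     (\<forall>x y. st (x + y) = st x + st y) \<and>
     (\<forall>x y. st (x * y) = st y * st x) \<and>
     (\<forall>c x. st (cs c x) = cs (cnj c) (st x)) \<and>
     (\<forall>x. norm (st x * x) = (norm x)\<^sup>2)"

section \<open>The stabilization A \<otimes> K, realised as infinite matrices over A\<close>

type_synonym 'a kmat = "nat \<Rightarrow> nat \<Rightarrow> 'a"

definition mvec :: "nat \<Rightarrow> 'a::real_normed_algebra kmat \<Rightarrow> (nat \<Rightarrow> 'a) \<Rightarrow> nat \<Rightarrow> 'a" where
  "mvec n X \<xi> i = (\<Sum>j<n. X i j * \<xi> j)"

text \<open>C*-norm of M_n(A): operator norm on the Hilbert A-module A^n with
  inner product sum_i xi_i^* eta_i.\<close>
definition mnorm :: "('a \<Rightarrow> 'a) \<Rightarrow> nat \<Rightarrow> 'a::real_normed_algebra kmat \<Rightarrow> real" where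
  "mnorm st n X = Sup {sqrt (norm (\<Sum>i<n. st (mvec n X \<xi> i) * mvec n X \<xi> i)) | \<xi>.
                        norm (\<Sum>i<n. st (\<xi> i) * \<xi> i) \<le> 1}"

definition ktrunc :: "nat \<Rightarrow> 'a::zero kmat \<Rightarrow> 'a kmat" where
  "ktrunc n X = (\<lambda>i j. if i < n \<and> j < n then X i j else 0)"

definition knorm :: "('a \<Rightarrow> 'a) \<Rightarrow> 'a::real_normed_algebra kmat \<Rightarrow> real" where
  "knorm st X = (SUP n. mnorm st n X)"

text \<open>A \<otimes> K: matrices whose finite truncations form a Cauchy sequence in norm.\<close>
definition stab :: "('a \<Rightarrow> 'a) \<Rightarrow> 'a::real_normed_algebra kmat set" where
  "stab st = {X. \<forall>e>0. \<exists>N. \<forall>m\<ge>N. \<forall>n\<ge>N. knorm st (ktrunc m X - ktrunc n X) < e}"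

definition kmult :: "'a::real_normed_algebra kmat \<Rightarrow> 'a kmat \<Rightarrow> 'a kmat" where
  "kmult X Y = (\<lambda>i j. \<Sum>k. X i k * Y k j)"

definition kstar :: "('a \<Rightarrow> 'a) \<Rightarrow> 'a kmat \<Rightarrow> 'a kmat" where
  "kstar st X = (\<lambda>i j. st (X j i))"

text \<open>Orthogonal sum a \<oplus> b, transported back into A \<otimes> K via the interleaving
  identification of M_2(A \<otimes> K) with A \<otimes> K.\<close>
definition dsum :: "'a::zero kmat \<Rightarrow> 'a kmat \<Rightarrow> 'a kmat" where
  "dsum a b = (\<lambda>i j. if even i \<and> even j then a (i div 2) (j div 2)
                      else if odd i \<and> odd j then b (i div 2) (j div 2) else 0)"

definition kpos :: "('a \<Rightarrow> 'a) \<Rightarrow> 'a::real_normed_algebra kmat \<Rightarrow> bool" where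
  "kpos st a \<longleftrightarrow> a \<in> stab st \<and> (\<exists>y\<in>stab st. a = kmult (kstar st y) y)"

definition cuntz_le :: "('a \<Rightarrow> 'a) \<Rightarrow> 'a::real_normed_algebra kmat \<Rightarrow> 'a kmat \<Rightarrow> bool" where
  "cuntz_le st a b \<longleftrightarrow> (\<exists>r. (\<forall>n. r n \<in> stab st) \<and>
      (\<lambda>n. knorm st (a - kmult (kmult (r n) b) (kstar st (r n)))) \<longlonglongrightarrow> 0)"

definition cuntz_eq :: "('a \<Rightarrow> 'a) \<Rightarrow> 'a::real_normed_algebra kmat \<Rightarrow> 'a kmat \<Rightarrow> bool" where
  "cuntz_eq st a b \<longleftrightarrow> cuntz_le st a b \<and> cuntz_le st b a"

definition cu_is_sup :: "('a \<Rightarrow> 'a) \<Rightarrow> (nat \<Rightarrow> 'a::real_normed_algebra kmat) \<Rightarrow> 'a kmat \<Rightarrow> bool" where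
  "cu_is_sup st ys s \<longleftrightarrow> kpos st s \<and> (\<forall>k. cuntz_le st (ys k) s) \<and>
     (\<forall>t. kpos st t \<and> (\<forall>k. cuntz_le st (ys k) t) \<longrightarrow> cuntz_le st s t)"

definition cu_ll :: "('a \<Rightarrow> 'a) \<Rightarrow> 'a::real_normed_algebra kmat \<Rightarrow> 'a kmat \<Rightarrow> bool" where
  "cu_ll st x y \<longleftrightarrow> (\<forall>ys s. (\<forall>k. kpos st (ys k)) \<and> (\<forall>k. cuntz_le st (ys k) (ys (Suc k))) \<and>
       cu_is_sup st ys s \<and> cuntz_le st y s \<longrightarrow> (\<exists>k. cuntz_le st x (ys k)))"

end

(*
  Let I be the ideal generated by w. Since 2[w] = [w], the positive elements of I are exactly those
  below w, so comparison with an additional summand w is comparison modulo I. Cutting a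
  factorization of x + y (orthogonal sum) through z + w into its z-part and its w-part yields
  vectors u, v such that a = u u^* and v v^* lie in the hereditary subalgebra of z and, approximately
  and modulo I, u^* u = x, v^* v = y and u^* v = 0. Let g be continuous with g(0) = 0 and g = 1 on
  [2d, oo), and let k be supported in [2d, oo). Then k(a) u and (1 - g(a)) v are exactly orthogonal
  and hardly differ from u and v modulo I. They provide z1 and z2, up to small cut-downs.

  To see that cut-downs are way below, every increasing sequence y_n in the Cuntz semigroup needs an
  upper bound that is approximated by elements r y_n r^*. It is the sum of copies of cut-downs of
  the y_n, placed inside one another by isometries that extend each other.

  All this happens in an abstract C*-algebra. Its continuous functional calculus is obtained from
  ||p(h)|| <= sup |p| for polynomials p: if ||h|| < 1, then T_k(h) = (u^k + u^(-k)) / 2 for the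
  unitary multiplier u = h + i (1 - h^2)^(1/2), so ||T_k(h)|| <= 1, and expanding p^N in Chebyshev
  polynomials loses only a factor linear in N, which N-th roots remove.
*)
theory Submission
  imports Defs "HOL-Computational_Algebra.Polynomial"
begin

section \<open>Polynomials in a self-adjoint element\<close>

text \<open>Three obstacles shape the development. The algebra has no unit, so a function of
  \<open>h\<close> that does not vanish at 0 is only a left multiplier; estimates are therefore made
  on vectors f(h) x, and a multiplier acts from the right only through the involution. Secondly,
  way-below speaks of an abstract supremum, known only through its universal property. Such a
  supremum lies below every explicit upper bound, which is why one bound approximated from within
  the sequence is enough. Once this is available, way-below becomes the concrete relation
  \<open>cle a (cut f b)\<close> for some f > 0, and the argument is about cut-downs only. Thirdly,
  comparison modulo the ideal has to return as comparison with an added summand \<open>w\<close>: a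
  self-adjoint error in the ideal is absorbed by a positive majorant below \<open>w\<close>, and
  this is what forces a form of Roerdam's lemma with a defect term. The absence of a unit also
  affects the Chebyshev argument, where the square root is reached through 1 - (1 - h^2)^(1/2),
  which does belong to the algebra.\<close>

locale cstar =
  fixes cs :: "complex \<Rightarrow> 'a::{real_normed_algebra,banach} \<Rightarrow> 'a"
    and st :: "'a \<Rightarrow> 'a"
  assumes cstar: "cstar_algebra cs st"
begin

lemma cs_add_left: "cs (a + b) x = cs a x + cs b x"
  and cs_add_right: "cs a (x + y) = cs a x + cs a y"
  and cs_cs: "cs a (cs b x) = cs (a * b) x"
  and cs_one: "cs 1 x = x"
  and cs_of_real: "cs (complex_of_real r) x = r *\<^sub>R x"
  and norm_cs: "norm (cs c x) = cmod c * norm x"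
  and cs_mult_left: "cs c x * y = cs c (x * y)"
  and cs_mult_right: "x * cs c y = cs c (x * y)"
  and st_st [simp]: "st (st x) = x"
  and st_add: "st (x + y) = st x + st y"
  and st_mult: "st (x * y) = st y * st x"
  and st_cs: "st (cs c x) = cs (cnj c) (st x)"
  and norm_st_mult: "norm (st x * x) = (norm x)\<^sup>2"
  using cstar unfolding cstar_algebra_def by metis+

lemma st_scaleR: "st (r *\<^sub>R x) = r *\<^sub>R st x"
  using st_cs[of "complex_of_real r" x] by (simp add: cs_of_real)

lemma st_zero [simp]: "st 0 = 0"
  using st_scaleR[of 0 0] by simp

lemma st_minus: "st (- x) = - st x"
  using st_scaleR[of "-1" x] by simp

lemma st_diff: "st (x - y) = st x - st y"
  using st_add[of x "- y"] by (simp add: st_minus)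

lemma norm_st [simp]: "norm (st x) = norm x"
proof -
  have le: "norm x \<le> norm (st x)" for x
  proof (cases "x = 0")
    case False
    have "norm x * norm x \<le> norm (st x) * norm x"
      using norm_mult_ineq[of "st x" x] by (simp add: norm_st_mult power2_eq_square)
    then show ?thesis using False by simp
  qed simp
  show ?thesis using le[of x] le[of "st x"] by simp
qed

lemma bounded_linear_st: "bounded_linear st"
  by (rule bounded_linear_intro[where K = 1]) (auto simp: st_add st_scaleR)

lemmas tendsto_st [tendsto_intros] = bounded_linear.tendsto[OF bounded_linear_st]

lemma norm_mult_st: "norm (x * st x) = (norm x)\<^sup>2"
  using norm_st_mult[of "st x"] by simp

text \<open>Testing on \<open>x = st y\<close> recovers the norm through the C*-identity: the left
  regular representation is isometric. This replaces evaluation at a unit.\<close>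

lemma norm_le_left_mult:
  fixes y :: 'a
  assumes "\<And>x. norm (y * x) \<le> C * norm x" "0 \<le> C"
  shows "norm y \<le> C"
proof (cases "y = 0")
  case False
  have "norm y * norm y \<le> C * norm y"
    using assms(1)[of "st y"] by (simp add: norm_mult_st power2_eq_square)
  then show ?thesis using False by simp
qed (use assms in simp)

lemma left_mult_cancel:
  fixes y :: 'a
  assumes "\<And>x. y * x = z * x"
  shows "y = z"
proof -
  have "norm (y - z) \<le> 0"
    by (rule norm_le_left_mult) (use assms in \<open>simp_all add: left_diff_distrib\<close>)
  then show ?thesis by simp
qed

lemma right_mult_cancel:
  fixes y :: 'a
  assumes "\<And>x. x * y = x * z"
  shows "y = z"
proof -
  have "st y * x = st z * x" for x
    using arg_cong[OF assms[of "st x"], of st] by (simp add: st_mult)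
  then show ?thesis by (metis left_mult_cancel st_st)
qed

lemma norm_st_mult_self_eq: "norm x = sqrt (norm (st x * x))"
  by (simp add: norm_st_mult)

lemma st_mult_self_eq_0 [simp]: "st x * x = 0 \<longleftrightarrow> x = 0"
  using norm_st_mult[of x] by auto

lemma cs_zero_right [simp]: "cs c 0 = 0"
  using norm_cs[of c 0] by simp

lemma cs_diff_right: "cs c (x - y) = cs c x - cs c y"
  using cs_add_right[of c "x - y" y] by (simp add: algebra_simps)

lemma cs_minus_one: "cs (- 1) x = - x"
  using cs_of_real[of "-1" x] by simp

lemma cs_minus_left: "cs (- c) x = - cs c x"
  using cs_cs[of "-1" c x] by (simp add: cs_minus_one)

end

text \<open>Horner scheme for p(h) x. Without a unit the constant term of \<open>p\<close> has no
  meaning inside the algebra, so the vector \<open>x\<close> is carried along and p(h) is a left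
  multiplier.\<close>

definition pact :: "real poly \<Rightarrow> 'a::real_normed_algebra \<Rightarrow> 'a \<Rightarrow> 'a" where
  "pact p h x = fold_coeffs (\<lambda>a y. a *\<^sub>R x + h * y) p 0"

lemma pact_0 [simp]: "pact 0 h x = 0"
  by (simp add: pact_def)

lemma pact_pCons [simp]: "pact (pCons a p) h x = a *\<^sub>R x + h * pact p h x"
  by (cases "p = 0 \<and> a = 0") (auto simp: pact_def)

lemma pact_1 [simp]: "pact 1 h x = x"
  by (simp add: one_pCons)

lemma pact_add: "pact (p + q) h x = pact p h x + pact q h x"
  by (induction p arbitrary: q)
    (simp, case_tac q, auto simp: algebra_simps)

lemma pact_smult: "pact (smult c p) h x = c *\<^sub>R pact p h x"
  by (induction p) (auto simp: algebra_simps)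

lemma pact_diff: "pact (p - q) h x = pact p h x - pact q h x"
  using pact_add[of p "smult (-1) q" h x] pact_smult[of "-1" q h x] by simp

lemma pact_add_right: "pact p h (x + y) = pact p h x + pact p h y"
  by (induction p) (auto simp: algebra_simps)

lemma pact_scaleR_right: "pact p h (c *\<^sub>R x) = c *\<^sub>R pact p h x"
  by (induction p) (auto simp: algebra_simps)

lemma pact_diff_right: "pact p h (x - y) = pact p h x - pact p h y"
  using pact_add_right[of p h "x - y" y] by (simp add: algebra_simps)

lemma pact_mult_right: "pact p h x * y = pact p h (x * y)"
  by (induction p) (auto simp: algebra_simps)

lemma pact_intertwine:
  assumes "\<And>x. L (h * x) = k * L x" "\<And>x y. L (x + y) = L x + L y"
    "\<And>c x. L (c *\<^sub>R x) = c *\<^sub>R L x"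
  shows "L (pact p h x) = pact p k (L x)"
proof (induction p)
  case 0
  then show ?case using assms(3)[of 0 0] by simp
qed (simp add: assms)

lemma pact_commute: "h * pact p h x = pact p h (h * x)"
  by (rule pact_intertwine) (auto simp: algebra_simps)

lemma pact_mult: "pact (p * q) h x = pact p h (pact q h x)"
  by (induction p) (auto simp: pact_add pact_smult)

lemma pact_pcompose_scale: "pact (pcompose p [:0, c:]) h x = pact p (c *\<^sub>R h) x"
  by (induction p) (auto simp: pcompose_pCons pact_add pact_smult)

lemma pact_sum: "pact (\<Sum>i\<in>A. f i) h x = (\<Sum>i\<in>A. pact (f i) h x)"
  by (induction A rule: infinite_finite_induct) (auto simp: pact_add)

lemma pact_at_0: "pact p 0 x = poly p 0 *\<^sub>R x"
  by (cases p) auto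

lemma pact_tendsto:
  assumes "(h \<longlongrightarrow> k) F"
  shows "((\<lambda>n. pact p (h n) x) \<longlongrightarrow> pact p k x) F"
  by (induction p) (auto intro!: tendsto_intros assms)

section \<open>Chebyshev expansions with bounded coefficients\<close>

fun cheb :: "nat \<Rightarrow> real poly" where
  "cheb 0 = 1"
| "cheb (Suc 0) = [:0, 1:]"
| "cheb (Suc (Suc k)) = [:0, 2:] * cheb (Suc k) - cheb k"

lemma poly_cheb_cos: "poly (cheb k) (cos t) = cos (real k * t)"
proof (induction k rule: cheb.induct)
  case (3 k)
  have "real (Suc (Suc k)) * t = real (Suc k) * t + t" "real k * t = real (Suc k) * t - t"
    by (simp_all add: algebra_simps)
  then have "cos (real (Suc (Suc k)) * t) = 2 * cos t * cos (real (Suc k) * t) - cos (real k * t)"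
    by (simp only: cos_add cos_diff) simp
  with 3 show ?case by (simp del: of_nat_Suc)
qed auto

lemma cheb_lead: "coeff (cheb k) k > 0 \<and> degree (cheb k) \<le> k"
proof (induction k rule: cheb.induct)
  case (3 k)
  have "degree ([:0, 2:] * cheb (Suc k)) \<le> Suc (Suc k)"
    using 3 degree_mult_le[of "[:0, 2::real:]" "cheb (Suc k)"] by simp
  moreover have "coeff (cheb k) (Suc (Suc k)) = 0"
    using 3 by (intro coeff_eq_0) auto
  ultimately show ?case
    using 3 by (auto intro!: degree_diff_le simp del: mult_pCons_left) (simp)
qed auto

lemma cheb_span:
  assumes "degree p \<le> d"
  shows "\<exists>c. p = (\<Sum>k\<le>d. smult (c k) (cheb k))"
  using assms
proof (induction d arbitrary: p)
  case 0
  then obtain a where "p = [:a:]" by (metis le_zero_eq degree_eq_zeroE)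
  then show ?case by (intro exI[of _ "\<lambda>_. a"]) simp
next
  case (Suc d)
  define a where "a = coeff p (Suc d) / coeff (cheb (Suc d)) (Suc d)"
  define q where "q = p - smult a (cheb (Suc d))"
  have "degree q \<le> Suc d" unfolding q_def
    using Suc.prems cheb_lead[of "Suc d"] 
    by (intro degree_diff_le) (auto intro: order_trans[OF degree_smult_le])
  moreover have "coeff q (Suc d) = 0"
    using cheb_lead[of "Suc d"] by (simp add: q_def a_def)
  ultimately have "degree q \<le> d"
    by (metis coeff_0 degree_0 leading_coeff_0_iff le_SucE zero_le)
  then obtain c where c: "q = (\<Sum>k\<le>d. smult (c k) (cheb k))" using Suc.IH by blast
  show ?case
    by (rule exI[of _ "c(Suc d := a)"])
      (simp add: c[symmetric] q_def cong: sum.cong_simp)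
qed

lemma integral_cos_multiple:
  fixes n :: int
  shows "((\<lambda>t. cos (of_int n * t)) has_integral (if n = 0 then 2 * pi else 0)) {0..2 * pi}"
proof (cases "n = 0")
  case True
  then show ?thesis using has_integral_const_real[of "1::real" 0 "2 * pi"] by simp
next
  case False
  have "((\<lambda>t. cos (of_int n * t)) has_integral
      (sin (of_int n * (2 * pi)) / of_int n - sin (of_int n * 0) / of_int n)) {0..2 * pi}"
    by (rule fundamental_theorem_of_calculus)
      (use False in \<open>auto intro!: derivative_eq_intros simp flip: has_real_derivative_iff_has_vector_derivative\<close>)
  moreover have "sin (of_int n * (2 * pi)) = 0"
    by (metis sin_zero_iff_int2 mult.assoc of_int_mult of_int_numeral mult.commute)
  ultimately show ?thesis using False by simp
qed

text \<open>Substituting cos t turns the sum into a cosine polynomial, whose coefficient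
  \<open>c m\<close> is read off by integrating against cos(m t) over a period. The integral is at
  most 2 pi M and equals pi times \<open>c m\<close>, or twice that for \<open>m = 0\<close>, where
  the frequencies \<open>k - m\<close> and \<open>k + m\<close> vanish together.\<close>

lemma cheb_coeff_bound:
  assumes M: "\<And>t. \<bar>t\<bar> \<le> 1 \<Longrightarrow> \<bar>poly (\<Sum>k\<le>d. smult (c k) (cheb k)) t\<bar> \<le> M" and m: "m \<le> d"
  shows "\<bar>c m\<bar> \<le> 2 * M"
proof -
  let ?q = "\<Sum>k\<le>d. smult (c k) (cheb k)"
  let ?g = "\<lambda>t. \<Sum>k\<le>d. (c k / 2) * (cos (of_int (int k - int m) * t) + cos (of_int (int k + int m) * t))"
  have eq: "?g t = poly ?q (cos t) * cos (real m * t)" for t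
    by (simp add: poly_sum poly_cheb_cos sum_distrib_right algebra_simps cos_add cos_diff
        flip: sum.distrib) (simp add: sum_distrib_left algebra_simps)
  let ?I = "\<lambda>n::int. if n = 0 then 2 * pi else 0"
  have int: "(?g has_integral (\<Sum>k\<le>d. (c k / 2) * (?I (int k - int m) + ?I (int k + int m)))) {0..2 * pi}"
    by (intro has_integral_sum has_integral_mult_right has_integral_add integral_cos_multiple) auto
  have "(\<Sum>k\<le>d. (c k / 2) * (?I (int k - int m) + ?I (int k + int m)))
    = (\<Sum>k\<le>d. if k = m then (if m = 0 then 2 else 1) * pi * c m else 0)"
    by (intro sum.cong) auto
  also have "\<dots> = (if m = 0 then 2 else 1) * pi * c m" using m by simp
  finally have int': "(?g has_integral ((if m = 0 then 2 else 1) * pi * c m)) {0..2 * pi}"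
    using int by simp
  have "norm ((if m = 0 then 2 else 1) * pi * c m) \<le> M * Henstock_Kurzweil_Integration.content {0..2 * pi}"
  proof (rule has_integral_bound_real[OF _ finite.emptyI int'])
    show "0 \<le> M" using M[of 0] by simp
    show "norm (?g t) \<le> M" for t
    proof -
      have "\<bar>poly ?q (cos t)\<bar> * \<bar>cos (real m * t)\<bar> \<le> M * 1"
        using M[of 0] by (intro mult_mono M) auto
      then show ?thesis unfolding eq by (simp add: abs_mult)
    qed
  qed
  then have "pi * \<bar>c m\<bar> \<le> pi * (2 * M)"
    by (cases "m = 0") (auto simp: abs_mult algebra_simps intro: order_trans[rotated])
  then show ?thesis by simp
qed

section \<open>Norm bound for polynomials of a self-adjoint element\<close>

context cstar
begin

text \<open>The solution is 1 - (1 - h^2)^(1/2), which lies in the algebra although the square root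
  does not: the equation says (1 - y)^2 = 1 - h^2. It is the fixed point of \<open>f\<close>, and on
  the ball of radius \<open>norm h < 1\<close> this map is a contraction with that same
  factor.\<close>

lemma cayley_sqrt_exists:
  assumes h: "st h = h" "norm h < 1"
  shows "\<exists>y. st y = y \<and> h * y = y * h \<and> y + y = h * h + y * y"
proof -
  define r where "r = norm h"
  define f where "f y = (1/2) *\<^sub>R (h * h + y * y)" for y
  let ?S = "{y. norm y \<le> r \<and> st y = y \<and> h * y = y * h}"
  have r: "0 \<le> r" "r < 1" using h by (auto simp: r_def)
  have "\<exists>!y\<in>?S. f y = y"
  proof (rule Banach_fix[OF _ _ r])
    have "closed ?S"
      by (intro closed_Collect_conj closed_Collect_le closed_Collect_eq continuous_intros
          linear_continuous_on bounded_linear_st)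
    then show "complete ?S" by (simp add: complete_eq_closed)
    show "?S \<noteq> {}" using r by (intro ex_in_conv[THEN iffD1] exI[of _ 0]) simp
    show "f ` ?S \<subseteq> ?S"
    proof clarify
      fix y assume y: "norm y \<le> r" "st y = y" "h * y = y * h"
      have "norm (h * h + y * y) \<le> r * r + r * r"
        by (intro order_trans[OF norm_triangle_ineq] add_mono order_trans[OF norm_mult_ineq] mult_mono)
          (use y r in \<open>auto simp: r_def\<close>)
      also have "\<dots> \<le> 2 * r" using r mult_left_le[of r r] by simp
      finally have "norm (f y) \<le> r" by (simp add: f_def)
      moreover have "h * (y * y) = y * y * h" using y(3) by (metis mult.assoc)
      ultimately show "norm (f y) \<le> r \<and> st (f y) = f y \<and> h * f y = f y * h"
        using y h by (simp add: f_def st_scaleR st_add st_mult algebra_simps)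
    qed
    show "dist (f x) (f y) \<le> r * dist x y" if "x \<in> ?S" "y \<in> ?S" for x y
    proof -
      have "f x - f y = (1/2) *\<^sub>R (x * (x - y) + (x - y) * y)"
        by (simp add: f_def algebra_simps)
      also have "norm \<dots> \<le> (1/2) * (r * norm (x - y) + norm (x - y) * r)"
      proof -
        have "norm (x * (x - y)) \<le> r * norm (x - y)" "norm ((x - y) * y) \<le> norm (x - y) * r"
          using that r by (auto intro!: order_trans[OF norm_mult_ineq] mult_mono)
        then show ?thesis using norm_triangle_ineq[of "x * (x - y)" "(x - y) * y"]
          by (simp add: mult.commute)
      qed
      finally show ?thesis by (simp add: dist_norm)
    qed
  qed
  then obtain y where y: "y \<in> ?S" "f y = y" by blast
  have "y + y = 2 *\<^sub>R f y" using y(2) by (simp add: scaleR_2)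
  then have "y + y = h * h + y * y" by (simp add: f_def)
  then show ?thesis using y(1) by auto
qed

lemma norm_pact_cheb:
  assumes h: "st h = h" "norm h < 1"
  shows "norm (pact (cheb k) h x) \<le> norm x"
proof -
  obtain y where y: "st y = y" "h * y = y * h" "y + y = h * h + y * y"
    using cayley_sqrt_exists[OF h] by blast
  \<comment> \<open>With this \<open>y\<close>, the map \<open>r\<close> is multiplication by 1 - y
    = (1 - h^2)^(1/2), so \<open>u\<close> and \<open>v\<close> act as the unitary multiplier and
    its adjoint.\<close>
  define r where "r x = x - y * x" for x
  define u where "u x = h * x + cs \<i> (r x)" for x
  define v where "v x = h * x - cs \<i> (r x)" for x
  have r_cs: "r (cs c x) = cs c (r x)" for c x
    by (simp add: r_def cs_mult_right cs_diff_right)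
  have r_add: "r (a + b) = r a + r b" and r_diff: "r (a - b) = r a - r b" for a b
    by (simp_all add: r_def algebra_simps)
  have "h * (y * x) = y * (h * x)" for x using y(2) by (metis mult.assoc)
  then have hr: "h * r x = r (h * x)" for x
    by (simp add: r_def right_diff_distrib)
  have "y * (y * x) = y * x + y * x - h * (h * x)" for x
    using arg_cong[OF y(3), of "\<lambda>z. z * x"] by (simp add: algebra_simps)
  then have rr: "r (r x) = x - h * (h * x)" for x
    by (simp add: r_def right_diff_distrib)
  have str: "st (r x) * z = st x * r z" for x z
    by (simp add: r_def st_diff st_mult y(1) left_diff_distrib right_diff_distrib mult.assoc)
  have uv: "u (v x) = x" and vu: "v (u x) = x" for x
    by (simp_all add: u_def v_def distrib_left right_diff_distrib r_add r_diff r_cs cs_mult_right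
        hr cs_add_right cs_diff_right cs_cs rr cs_minus_one)
  have st_u: "st (u x) * z = st x * v z" and st_v: "st (v x) * z = st x * u z" for x z
    by (simp_all add: u_def v_def st_add st_diff st_mult st_cs h distrib_left right_diff_distrib
        distrib_right left_diff_distrib cs_mult_left cs_mult_right str cs_minus_left mult.assoc)
  \<comment> \<open>\<open>st (u x) * u x = st x * v (u x) = st x * x\<close>: an adjoint that is
    also an inverse makes \<open>u\<close> isometric, and likewise \<open>v\<close>.\<close>
  have nu: "norm (u x) = norm x" and nv: "norm (v x) = norm x" for x
    using norm_st_mult[of "u x"] norm_st_mult[of "v x"] norm_st_mult[of x] st_u[of x "u x"] st_v[of x "v x"]
    by (simp_all add: uv vu)
  have nuk: "norm ((u ^^ k) x) = norm x" "norm ((v ^^ k) x) = norm x" for k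
    by (induction k) (auto simp: nu nv)
  have hu: "2 *\<^sub>R (h * z) = u z + v z" for z by (simp add: u_def v_def scaleR_2)
  have add: "u (a + b) = u a + u b" "v (a + b) = v a + v b" for a b
    by (simp_all add: u_def v_def r_add distrib_left cs_add_right)
  have "2 *\<^sub>R pact (cheb k) h x = (u ^^ k) x + (v ^^ k) x"
  proof (induction k rule: cheb.induct)
    case 1
    then show ?case by (simp add: scaleR_2)
  next
    case 2
    then show ?case using hu[of x] by simp
  next
    case (3 k)
    have "2 *\<^sub>R pact (cheb (Suc (Suc k))) h x
      = 2 *\<^sub>R (h * (2 *\<^sub>R pact (cheb (Suc k)) h x)) - 2 *\<^sub>R pact (cheb k) h x"
      by (simp add: pact_diff pact_smult scaleR_diff_right)
    also have "\<dots> = (u ^^ Suc (Suc k)) x + (v ^^ Suc (Suc k)) x"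
      unfolding 3 hu add by (simp add: uv vu)
    finally show ?case .
  qed
  then have "norm (2 *\<^sub>R pact (cheb k) h x) \<le> norm x + norm x"
    using norm_triangle_ineq[of "(u ^^ k) x" "(v ^^ k) x"] by (simp add: nuk)
  then show ?thesis by simp
qed

lemma norm_pact_crude:
  assumes h: "st h = h" "norm h < 1" and d: "degree p \<le> d"
    and M: "\<And>t. \<bar>t\<bar> \<le> 1 \<Longrightarrow> \<bar>poly p t\<bar> \<le> M"
  shows "norm (pact p h x) \<le> 2 * (real d + 1) * M * norm x"
proof -
  obtain c where c: "p = (\<Sum>k\<le>d. smult (c k) (cheb k))" using cheb_span[OF d] by blast
  have "norm (pact p h x) \<le> (\<Sum>k\<le>d. norm (c k *\<^sub>R pact (cheb k) h x))"
    unfolding c pact_sum pact_smult by (rule norm_sum)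
  also have "\<dots> \<le> (\<Sum>k\<le>d. 2 * M * norm x)"
  proof (rule sum_mono)
    fix k assume "k \<in> {..d}"
    then have "\<bar>c k\<bar> \<le> 2 * M" using M unfolding c by (intro cheb_coeff_bound) auto
    then show "norm (c k *\<^sub>R pact (cheb k) h x) \<le> 2 * M * norm x"
      using norm_pact_cheb[OF h] by (auto intro!: mult_mono)
  qed
  also have "\<dots> = 2 * (real d + 1) * M * norm x" by (simp add: algebra_simps)
  finally show ?thesis .
qed

lemma st_pact:
  assumes "st h = h"
  shows "st (pact p h x) * y = st x * pact p h y"
proof (induction p arbitrary: y)
  case (pCons a p)
  have "st (h * pact p h x) * y = st (pact p h x) * (h * y)"
    by (simp only: st_mult assms mult.assoc)
  also have "\<dots> = st x * (h * pact p h y)"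
    by (simp only: pCons.IH pact_commute)
  finally show ?case by (simp add: st_add st_scaleR distrib_left distrib_right)
qed simp

lemma norm_sq_pact_le:
  assumes "st h = h"
  shows "(norm (pact p h x))\<^sup>2 \<le> norm x * norm (pact (p * p) h x)"
proof -
  have "(norm (pact p h x))\<^sup>2 = norm (st x * pact (p * p) h x)"
    by (metis assms norm_st_mult st_pact pact_mult)
  also have "\<dots> \<le> norm x * norm (pact (p * p) h x)"
    using norm_mult_ineq[of "st x" "pact (p * p) h x"] by simp
  finally show ?thesis .
qed

text \<open>Repeated squaring replaces the identity for norms of powers of a self-adjoint operator.
  Only vectors p(h) x have a norm here, so each squaring costs powers of \<open>norm x\<close>,
  recorded on both sides.\<close>

lemma norm_power_pact_le:
  assumes "st h = h"
  shows "norm x * norm (pact p h x) ^ (2 ^ n) \<le> norm x ^ (2 ^ n) * norm (pact (p ^ (2 ^ n)) h x)"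
proof (induction n arbitrary: p)
  case (Suc n)
  have "norm x * norm (pact p h x) ^ (2 ^ Suc n) = norm x * ((norm (pact p h x))\<^sup>2) ^ (2 ^ n)"
    by (simp add: power_mult)
  also have "\<dots> \<le> norm x * (norm x * norm (pact (p * p) h x)) ^ (2 ^ n)"
    by (intro mult_left_mono power_mono norm_sq_pact_le assms) auto
  also have "\<dots> = norm x ^ (2 ^ n) * (norm x * norm (pact (p * p) h x) ^ (2 ^ n))"
    by (simp add: power_mult_distrib)
  also have "\<dots> \<le> norm x ^ (2 ^ n) * (norm x ^ (2 ^ n) * norm (pact ((p * p) ^ (2 ^ n)) h x))"
    by (intro mult_left_mono Suc.IH) auto
  also have "\<dots> = norm x ^ (2 ^ Suc n) * norm (pact (p ^ (2 ^ Suc n)) h x)"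
  proof -
    have "(p * p) ^ (2 ^ n) = p ^ (2 ^ Suc n)"
      by (simp only: power_Suc power_mult power2_eq_square)
    moreover have "norm x ^ (2 ^ n) * norm x ^ (2 ^ n) = norm x ^ (2 ^ Suc n)"
      by (simp only: power_Suc mult_2 power_add)
    ultimately show ?thesis by (metis mult.assoc)
  qed
  finally show ?case .
qed simp

lemma le_1_if_power_linear_bound:
  fixes r :: real
  assumes "\<And>n. r ^ (2 ^ n) \<le> a * (real (d * 2 ^ n) + 1)"
  shows "r \<le> 1"
proof (rule ccontr)
  assume "\<not> r \<le> 1"
  then have r: "r > 1" by simp
  have "(\<lambda>n. real n * (inverse r) ^ n) \<longlonglongrightarrow> 0"
    using r by (intro powser_times_n_limit_0) (simp add: inverse_less_1_iff)
  moreover have "(\<lambda>n. (inverse r) ^ n) \<longlonglongrightarrow> 0"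
    using r by (intro LIMSEQ_power_zero) (simp add: inverse_less_1_iff)
  ultimately have "(\<lambda>n. a * (real d * (real n * (inverse r) ^ n) + (inverse r) ^ n)) \<longlonglongrightarrow> a * (real d * 0 + 0)"
    by (intro tendsto_mult tendsto_add tendsto_const)
  moreover have "filterlim (\<lambda>n. 2 ^ n :: nat) at_top sequentially"
    by (rule filterlim_subseq) (simp add: strict_mono_def)
  ultimately have "(\<lambda>n. a * (real d * (real (2 ^ n) * (inverse r) ^ (2 ^ n)) + (inverse r) ^ (2 ^ n))) \<longlonglongrightarrow> a * (real d * 0 + 0)"
    by (rule filterlim_compose)
  moreover have "1 \<le> a * (real d * (real (2 ^ n) * (inverse r) ^ (2 ^ n)) + (inverse r) ^ (2 ^ n))" for n
  proof -
    have "r ^ (2 ^ n) * inverse r ^ (2 ^ n) \<le> a * (real (d * 2 ^ n) + 1) * inverse r ^ (2 ^ n)"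
      using r by (intro mult_right_mono assms) auto
    moreover have "r ^ (2 ^ n) * inverse r ^ (2 ^ n) = 1"
      using r by (simp flip: power_mult_distrib)
    ultimately show ?thesis by (simp add: algebra_simps)
  qed
  ultimately have "1 \<le> a * (real d * 0 + 0)"
    by (intro LIMSEQ_le_const) auto
  then show False by simp
qed

text \<open>The crude bound applied to the powers of \<open>p\<close> costs only a factor linear in the degree,
  which disappears after taking roots.\<close>
lemma norm_pact_le_strict:
  assumes h: "st h = h" "norm h < 1"
    and M: "\<And>t. \<bar>t\<bar> \<le> 1 \<Longrightarrow> \<bar>poly p t\<bar> \<le> M"
  shows "norm (pact p h x) \<le> M * norm x"
proof (cases "x = 0")
  case True
  have "pact p h 0 = 0" using pact_scaleR_right[of p h 0 0] by simp
  then show ?thesis using True by simp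
next
  case x: False
  have M0: "0 \<le> M" using M[of 0] by simp
  \<comment> \<open>A strictly larger \<open>M'\<close> is positive even if \<open>M = 0\<close>, so
    it is possible to divide by it before taking roots.\<close>
  have bd: "norm (pact p h x) \<le> M' * norm x" if M': "M < M'" for M'
  proof -
    have pos: "0 < M' * norm x" using M0 M' x by simp
    have "norm (pact p h x) / (M' * norm x) \<le> 1"
    proof (rule le_1_if_power_linear_bound[where a = 2 and d = "degree p"])
      fix n
      let ?N = "2 ^ n :: nat"
      have "norm (pact (p ^ ?N) h x) \<le> 2 * (real (degree p * ?N) + 1) * M' ^ ?N * norm x"
      proof (rule norm_pact_crude[OF h])
        show "degree (p ^ ?N) \<le> degree p * ?N" by (rule degree_power_le)
        show "\<bar>poly (p ^ ?N) t\<bar> \<le> M' ^ ?N" if "\<bar>t\<bar> \<le> 1" for t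
          using M[OF that] M' by (auto simp: poly_power power_abs intro!: power_mono)
      qed
      then have "norm x * norm (pact p h x) ^ ?N
        \<le> norm x ^ ?N * (2 * (real (degree p * ?N) + 1) * M' ^ ?N * norm x)"
        by (intro order_trans[OF norm_power_pact_le[OF h(1)]] mult_left_mono) auto
      then have "norm x * norm (pact p h x) ^ ?N \<le> norm x * ((2 * (real (degree p * ?N) + 1)) * (M' * norm x) ^ ?N)"
        by (simp add: power_mult_distrib algebra_simps)
      then have "norm (pact p h x) ^ ?N \<le> (2 * (real (degree p * ?N) + 1)) * (M' * norm x) ^ ?N"
        using x by simp
      then show "(norm (pact p h x) / (M' * norm x)) ^ ?N \<le> 2 * (real (degree p * ?N) + 1)"
        using pos by (simp add: power_divide pos_divide_le_eq)
    qed
    then show ?thesis using pos by (simp add: pos_divide_le_eq)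
  qed
  show ?thesis
  proof (rule field_le_epsilon)
    fix e :: real assume "0 < e"
    then show "norm (pact p h x) \<le> M * norm x + e"
      using bd[of "M + e / norm x"] x by (simp add: algebra_simps)
  qed
qed

text \<open>Rescaling by \<open>R\<close> moves the problem to [-1, 1]; the factors n/(n+1) push the
  norm strictly below 1, as the square root in the strict version demands, and continuity in
  \<open>h\<close> removes them.\<close>

lemma norm_pact_le:
  assumes h: "st h = h" "norm h \<le> R"
    and M: "\<And>t. \<bar>t\<bar> \<le> R \<Longrightarrow> \<bar>poly p t\<bar> \<le> M"
  shows "norm (pact p h x) \<le> M * norm x"
proof (cases "R = 0")
  case True
  then show ?thesis using h M[of 0] by (auto simp: pact_at_0 intro!: mult_right_mono)
next
  case False
  then have R: "R > 0" using h(2) norm_ge_zero[of h] by linarith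
  define q where "q = pcompose p [:0, R:]"
  define r where "r n = real n / (real n + 1)" for n
  have r: "0 \<le> r n" "r n < 1" for n by (auto simp: r_def field_simps)
  have r_lim: "r \<longlonglongrightarrow> 1"
    unfolding r_def using LIMSEQ_n_over_Suc_n[where 'a = real] by (simp add: add.commute)
  have le: "norm (pact p (r n *\<^sub>R h) x) \<le> M * norm x" for n
  proof -
    let ?k = "(r n / R) *\<^sub>R h"
    have "norm ?k = r n * (norm h / R)" using R r[of n] by simp
    also have "\<dots> \<le> r n * 1" using h R r[of n] by (intro mult_left_mono) auto
    finally have "norm ?k < 1" using r[of n] by simp
    moreover have "st ?k = ?k" by (simp add: st_scaleR h)
    ultimately have "norm (pact q ?k x) \<le> M * norm x"
    proof (intro norm_pact_le_strict)
      show "\<bar>poly q t\<bar> \<le> M" if "\<bar>t\<bar> \<le> 1" for t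
        unfolding q_def poly_pcompose
        using that R by (intro M) (auto simp: abs_mult mult_le_cancel_right2)
    qed
    moreover have "R *\<^sub>R ?k = r n *\<^sub>R h" using R by simp
    ultimately show ?thesis by (metis q_def pact_pcompose_scale)
  qed
  have "(\<lambda>n. pact p (r n *\<^sub>R h) x) \<longlonglongrightarrow> pact p (1 *\<^sub>R h) x"
    by (intro pact_tendsto tendsto_intros r_lim)
  then have "norm (pact p (1 *\<^sub>R h) x) \<le> M * norm x"
    by (intro Lim_norm_ubound[OF _ _ always_eventually]) (use le in auto)
  then show ?thesis by simp
qed

end

section \<open>Continuous functional calculus\<close>

lemma weierstrass_poly:
  fixes f :: "real \<Rightarrow> real"
  assumes "continuous_on UNIV f"
  shows "\<exists>P. uniform_limit {-R..R} (\<lambda>n. poly (P n)) f sequentially"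
proof -
  have "\<exists>p. \<forall>t\<in>{-R..R}. \<bar>f t - poly p t\<bar> < inverse (Suc n)" for n
  proof -
    have "continuous_on {-R..R} f" using assms continuous_on_subset by blast
    then obtain g where g: "real_polynomial_function g" "\<And>t. t \<in> {-R..R} \<Longrightarrow> \<bar>f t - g t\<bar> < inverse (Suc n)"
      using Stone_Weierstrass_real_polynomial_function[OF compact_Icc, of "-R" R f "inverse (Suc n)"]
      by auto
    then obtain a m where "g = (\<lambda>t. \<Sum>i\<le>m. a i * t ^ i)"
      unfolding real_polynomial_function_iff_sum by blast
    then have "g t = poly (\<Sum>i\<le>m. monom (a i) i) t" for t
      by (simp add: poly_sum poly_monom)
    then show ?thesis using g(2) by (intro exI[of _ "\<Sum>i\<le>m. monom (a i) i"]) simp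
  qed
  then obtain P where P: "\<And>n t. t \<in> {-R..R} \<Longrightarrow> \<bar>f t - poly (P n) t\<bar> < inverse (Suc n)" by metis
  have "uniform_limit {-R..R} (\<lambda>n. poly (P n)) f sequentially"
  proof (rule uniform_limitI)
    fix e :: real assume "0 < e"
    then have "\<forall>\<^sub>F n in sequentially. inverse (real (Suc n)) < e"
      using LIMSEQ_inverse_real_of_nat by (rule order_tendstoD(2)[rotated])
    then show "\<forall>\<^sub>F n in sequentially. \<forall>t\<in>{-R..R}. dist (poly (P n) t) (f t) < e"
    proof eventually_elim
      case (elim n)
      show ?case
      proof
        fix t assume "t \<in> {-R..R}"
        then show "dist (poly (P n) t) (f t) < e"
          using P[of t n] elim by (simp add: dist_real_def abs_minus_commute)
      qed
    qed
  qed
  then show ?thesis by blast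
qed

context cstar
begin

text \<open>Since there is no unit, a function \<open>f\<close> with \<open>f 0 \<noteq> 0\<close> of a self-adjoint element is only a left
  multiplier; \<open>fe f h\<close> is the algebra element that implements it when \<open>f 0 = 0\<close>.\<close>

definition fc :: "(real \<Rightarrow> real) \<Rightarrow> 'a \<Rightarrow> 'a \<Rightarrow> 'a" where
  "fc f h x = lim (\<lambda>n. pact
     ((SOME P. uniform_limit {-norm h..norm h} (\<lambda>n. poly (P n)) f sequentially) n) h x)"

definition fe :: "(real \<Rightarrow> real) \<Rightarrow> 'a \<Rightarrow> 'a" where
  "fe f h = (THE y. \<forall>x. y * x = fc f h x)"

lemma uniform_cauchy_pact:
  assumes h: "st h = h" and P: "uniform_limit {-norm h..norm h} (\<lambda>n. poly (P n)) f sequentially"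
    and e: "0 < e"
  shows "\<exists>N. \<forall>m\<ge>N. \<forall>n\<ge>N. \<forall>x. norm (pact (P m) h x - pact (P n) h x) \<le> e * norm x"
proof -
  have "\<forall>\<^sub>F n in sequentially. \<forall>t\<in>{-norm h..norm h}. dist (poly (P n) t) (f t) < e / 2"
    using P e by (intro uniform_limitD) auto
  then obtain N where N: "\<And>n t. N \<le> n \<Longrightarrow> t \<in> {-norm h..norm h} \<Longrightarrow> dist (poly (P n) t) (f t) < e / 2"
    unfolding eventually_sequentially by blast
  have "norm (pact (P m) h x - pact (P n) h x) \<le> e * norm x" if "N \<le> m" "N \<le> n" for m n x
  proof -
    have "\<bar>poly (P m - P n) t\<bar> \<le> e" if "\<bar>t\<bar> \<le> norm h" for t
    proof -
      have "t \<in> {-norm h..norm h}" using that by auto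
      then show ?thesis
        using N[OF \<open>N \<le> m\<close>, of t] N[OF \<open>N \<le> n\<close>, of t] unfolding dist_real_def poly_diff by linarith
    qed
    then have "norm (pact (P m - P n) h x) \<le> e * norm x"
      by (intro norm_pact_le h order.refl) auto
    then show ?thesis by (simp add: pact_diff)
  qed
  then show ?thesis by blast
qed

lemma convergent_pact:
  assumes "st h = h" "uniform_limit {-norm h..norm h} (\<lambda>n. poly (P n)) f sequentially"
  shows "convergent (\<lambda>n. pact (P n) h x)"
proof (rule Cauchy_convergent, rule CauchyI)
  fix e :: real assume "0 < e"
  then have "0 < e / (norm x + 1)" by (simp add: add_nonneg_pos)
  from uniform_cauchy_pact[OF assms this] obtain N where
    N: "\<And>m n. N \<le> m \<Longrightarrow> N \<le> n \<Longrightarrow> norm (pact (P m) h x - pact (P n) h x) \<le> e / (norm x + 1) * norm x"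
    by blast
  have "e * norm x < e * (norm x + 1)" using \<open>0 < e\<close> by simp
  then have "e / (norm x + 1) * norm x < e"
    by (simp add: pos_divide_less_eq add_nonneg_pos)
  then show "\<exists>M. \<forall>m\<ge>M. \<forall>n\<ge>M. norm (pact (P m) h x - pact (P n) h x) < e"
    using N by (meson le_less_trans)
qed

lemma fc_tendsto:
  assumes h: "st h = h" and f: "continuous_on UNIV f"
    and P: "uniform_limit {-norm h..norm h} (\<lambda>n. poly (P n)) f sequentially"
  shows "(\<lambda>n. pact (P n) h x) \<longlonglongrightarrow> fc f h x"
proof -
  define Q where "Q = (SOME P. uniform_limit {-norm h..norm h} (\<lambda>n. poly (P n)) f sequentially)"
  have Q: "uniform_limit {-norm h..norm h} (\<lambda>n. poly (Q n)) f sequentially"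
    unfolding Q_def using weierstrass_poly[OF f] by (rule someI_ex)
  have limQ: "(\<lambda>n. pact (Q n) h x) \<longlonglongrightarrow> fc f h x"
    using convergent_pact[OF h Q] by (simp add: fc_def Q_def[symmetric] convergent_LIMSEQ_iff)
  \<comment> \<open>Interleaving two approximating sequences gives a convergent sequence, so their
    limits agree and \<open>fc\<close> does not depend on the choice operator in its
    definition.\<close>
  define PQ where "PQ n = (if even n then P (n div 2) else Q (n div 2))" for n
  have "uniform_limit {-norm h..norm h} (\<lambda>n. poly (PQ n)) f sequentially"
  proof (rule uniform_limitI)
    fix e :: real assume e: "0 < e"
    from uniform_limitD[OF P e] uniform_limitD[OF Q e] obtain N M where
      "\<And>n t. N \<le> n \<Longrightarrow> t \<in> {-norm h..norm h} \<Longrightarrow> dist (poly (P n) t) (f t) < e"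
      "\<And>n t. M \<le> n \<Longrightarrow> t \<in> {-norm h..norm h} \<Longrightarrow> dist (poly (Q n) t) (f t) < e"
      unfolding eventually_sequentially by blast
    then show "\<forall>\<^sub>F n in sequentially. \<forall>t\<in>{-norm h..norm h}. dist (poly (PQ n) t) (f t) < e"
      unfolding eventually_sequentially PQ_def
      by (intro exI[of _ "2 * (N + M)"]) auto
  qed
  from convergent_pact[OF h this, of x] obtain l where l: "(\<lambda>n. pact (PQ n) h x) \<longlonglongrightarrow> l"
    by (auto simp: convergent_def)
  have "filterlim (\<lambda>n. 2 * n) at_top (sequentially::nat filter)"
    "filterlim (\<lambda>n. 2 * n + 1) at_top (sequentially::nat filter)"
    by (auto intro!: filterlim_subseq simp: strict_mono_def)
  from this[THEN filterlim_compose[OF l]]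
  have "(\<lambda>n. pact (P n) h x) \<longlonglongrightarrow> l" "(\<lambda>n. pact (Q n) h x) \<longlonglongrightarrow> l" by (auto simp: PQ_def)
  then show ?thesis using limQ LIMSEQ_unique by blast
qed

text \<open>The radius may exceed \<open>norm h\<close>, so that one sequence of polynomials can
  serve two elements at once.\<close>

lemma fc_obtain:
  assumes "st h = h" "continuous_on UNIV f" "norm h \<le> R"
  obtains P where "uniform_limit {-R..R} (\<lambda>n. poly (P n)) f sequentially"
    "\<And>x. (\<lambda>n. pact (P n) h x) \<longlonglongrightarrow> fc f h x"
proof -
  obtain P where P: "uniform_limit {-R..R} (\<lambda>n. poly (P n)) f sequentially"
    using weierstrass_poly[OF assms(2)] by blast
  have "uniform_limit {-norm h..norm h} (\<lambda>n. poly (P n)) f sequentially"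
    by (rule uniform_limit_on_subset[OF P]) (use assms in auto)
  then show ?thesis using that P fc_tendsto assms by blast
qed

lemma continuous_on_poly_UNIV [continuous_intros]: "continuous_on UNIV (poly (p :: real poly))"
  by (intro continuous_at_imp_continuous_on ballI poly_isCont)

lemma fc_poly:
  assumes "st h = h"
  shows "fc (poly p) h x = pact p h x"
proof -
  have "(\<lambda>n. pact p h x) \<longlonglongrightarrow> fc (poly p) h x"
    by (rule fc_tendsto[OF assms continuous_on_poly_UNIV]) (auto intro!: uniform_limitI)
  then show ?thesis by (simp add: LIMSEQ_const_iff)
qed

lemma poly_const_fun: "poly [:c:] = (\<lambda>t. c :: real)" and poly_id_fun: "poly [:0, 1:] = (\<lambda>t. t :: real)"
  by (simp_all add: fun_eq_iff)

lemma fc_const: "st h = h \<Longrightarrow> fc (\<lambda>t. c) h x = c *\<^sub>R x"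
  using fc_poly[of h "[:c:]" x] by (simp add: poly_const_fun)

lemma fc_id: "st h = h \<Longrightarrow> fc (\<lambda>t. t) h x = h * x"
  using fc_poly[of h "[:0, 1:]" x] by (simp add: poly_id_fun)

lemma fc_add:
  assumes h: "st h = h" and f: "continuous_on UNIV f" and g: "continuous_on UNIV g"
  shows "fc (\<lambda>t. f t + g t) h x = fc f h x + fc g h x"
proof -
  obtain P where P: "uniform_limit {-norm h..norm h} (\<lambda>n. poly (P n)) f sequentially"
    "\<And>x. (\<lambda>n. pact (P n) h x) \<longlonglongrightarrow> fc f h x" using fc_obtain[OF h f order.refl] by blast
  obtain Q where Q: "uniform_limit {-norm h..norm h} (\<lambda>n. poly (Q n)) g sequentially"
    "\<And>x. (\<lambda>n. pact (Q n) h x) \<longlonglongrightarrow> fc g h x" using fc_obtain[OF h g order.refl] by blast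
  have "(\<lambda>n. pact (P n + Q n) h x) \<longlonglongrightarrow> fc (\<lambda>t. f t + g t) h x"
    using uniform_limit_add[OF P(1) Q(1)]
    by (intro fc_tendsto h continuous_on_add f g) (simp add: fun_eq_iff cong: uniform_limit_cong')
  moreover have "(\<lambda>n. pact (P n + Q n) h x) \<longlonglongrightarrow> fc f h x + fc g h x"
    unfolding pact_add by (intro tendsto_add P Q)
  ultimately show ?thesis by (rule LIMSEQ_unique)
qed

text \<open>The limits are taken vector by vector, so a product of two limits needs a uniform bound:
  the operators given by \<open>P n\<close> are eventually bounded by \<open>C + 1\<close>, where
  \<open>C\<close> bounds \<open>f\<close>, and this carries the inner limit through.\<close>

lemma fc_mult:
  assumes h: "st h = h" and f: "continuous_on UNIV f" and g: "continuous_on UNIV g"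
  shows "fc (\<lambda>t. f t * g t) h x = fc f h (fc g h x)"
proof -
  obtain P where P: "uniform_limit {-norm h..norm h} (\<lambda>n. poly (P n)) f sequentially"
    "\<And>x. (\<lambda>n. pact (P n) h x) \<longlonglongrightarrow> fc f h x" using fc_obtain[OF h f order.refl] by blast
  obtain Q where Q: "uniform_limit {-norm h..norm h} (\<lambda>n. poly (Q n)) g sequentially"
    "\<And>x. (\<lambda>n. pact (Q n) h x) \<longlonglongrightarrow> fc g h x" using fc_obtain[OF h g order.refl] by blast
  have bdd: "bounded (k ` {-norm h..norm h})" if "continuous_on UNIV k" for k :: "real \<Rightarrow> real"
    using that by (intro compact_imp_bounded compact_continuous_image) (auto intro: continuous_on_subset)
  have "(\<lambda>n. pact (P n * Q n) h x) \<longlonglongrightarrow> fc (\<lambda>t. f t * g t) h x"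
    using uniform_lim_mult[OF P(1) Q(1) bdd[OF f] bdd[OF g]]
    by (intro fc_tendsto h continuous_on_mult f g) (simp add: poly_mult[abs_def])
  moreover have "(\<lambda>n. pact (P n * Q n) h x) \<longlonglongrightarrow> fc f h (fc g h x)"
  proof -
    obtain C where C: "\<And>t. t \<in> {-norm h..norm h} \<Longrightarrow> \<bar>f t\<bar> \<le> C"
      using bdd[OF f] unfolding bounded_iff by (metis imageI real_norm_def)
    let ?d = "\<lambda>n. pact (Q n) h x - fc g h x"
    have "\<forall>\<^sub>F n in sequentially. \<forall>t\<in>{-norm h..norm h}. dist (poly (P n) t) (f t) < 1"
      by (rule uniform_limitD[OF P(1)]) simp
    then have "\<forall>\<^sub>F n in sequentially. norm (pact (P n) h (?d n)) \<le> norm (?d n) * (C + 1)"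
    proof eventually_elim
      case (elim n)
      have "\<bar>poly (P n) t\<bar> \<le> C + 1" if "\<bar>t\<bar> \<le> norm h" for t
        using bspec[OF elim, of t] C[of t] that by (simp add: dist_real_def abs_le_iff) linarith
      then have "norm (pact (P n) h (?d n)) \<le> (C + 1) * norm (?d n)"
        by (intro norm_pact_le h order.refl) auto
      then show ?case by (simp add: mult.commute)
    qed
    moreover have "?d \<longlonglongrightarrow> 0" using Q(2)[of x] by (simp add: LIM_zero_iff)
    ultimately have "(\<lambda>n. pact (P n) h (?d n)) \<longlonglongrightarrow> 0" by (rule tendsto_0_le[rotated])
    then have "(\<lambda>n. pact (P n) h (?d n) + pact (P n) h (fc g h x)) \<longlonglongrightarrow> 0 + fc f h (fc g h x)"
      by (intro tendsto_add P)
    then show ?thesis by (simp add: pact_mult pact_diff_right)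
  qed
  ultimately show ?thesis by (rule LIMSEQ_unique)
qed

lemma fc_scale:
  assumes "st h = h" "continuous_on UNIV f"
  shows "fc (\<lambda>t. c * f t) h x = c *\<^sub>R fc f h x"
  using fc_mult[OF assms(1) continuous_on_const assms(2), of c x] by (simp add: fc_const assms)

lemma fc_diff:
  assumes "st h = h" "continuous_on UNIV f" "continuous_on UNIV g"
  shows "fc (\<lambda>t. f t - g t) h x = fc f h x - fc g h x"
  using fc_add[OF assms(1,2), of "\<lambda>t. (-1) * g t" x] fc_scale[OF assms(1,3), of "-1" x]
  by (simp add: continuous_on_minus assms)

lemma norm_fc_le:
  assumes h: "st h = h" and f: "continuous_on UNIV f"
    and M: "\<And>t. \<bar>t\<bar> \<le> norm h \<Longrightarrow> \<bar>f t\<bar> \<le> M"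
  shows "norm (fc f h x) \<le> M * norm x"
proof -
  obtain P where P: "uniform_limit {-norm h..norm h} (\<lambda>n. poly (P n)) f sequentially"
    "\<And>x. (\<lambda>n. pact (P n) h x) \<longlonglongrightarrow> fc f h x" using fc_obtain[OF h f order.refl] by blast
  have bd: "norm (fc f h x) \<le> (M + e) * norm x" if e: "0 < e" for e
  proof (rule Lim_norm_ubound[OF _ P(2)])
    show "\<forall>\<^sub>F n in sequentially. norm (pact (P n) h x) \<le> (M + e) * norm x"
      using uniform_limitD[OF P(1) e]
    proof eventually_elim
      case (elim n)
      have "\<bar>poly (P n) t\<bar> \<le> M + e" if "\<bar>t\<bar> \<le> norm h" for t
        using bspec[OF elim, of t] M[of t] that by (simp add: dist_real_def abs_le_iff) linarith
      then show ?case by (intro norm_pact_le h order.refl) auto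
    qed
  qed simp
  then have "norm (fc f h x) \<le> M * norm x + e" if "0 < e" for e
  proof (cases "x = 0")
    case True
    then show ?thesis using bd[OF that] that by simp
  next
    case False
    then show ?thesis using bd[of "e / norm x"] that by (simp add: distrib_right)
  qed
  then show ?thesis by (rule field_le_epsilon)
qed

lemma fc_cong:
  assumes "st h = h" "continuous_on UNIV f" "continuous_on UNIV g"
    and "\<And>t. \<bar>t\<bar> \<le> norm h \<Longrightarrow> f t = g t"
  shows "fc f h x = fc g h x"
proof -
  have "norm (fc (\<lambda>t. f t - g t) h x) \<le> 0 * norm x"
    by (intro norm_fc_le continuous_intros assms) (use assms in auto)
  then show ?thesis by (simp add: fc_diff assms)
qed

lemma fc_mult_right:
  assumes "st h = h" "continuous_on UNIV f"
  shows "fc f h x * y = fc f h (x * y)"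
proof -
  obtain P where P: "\<And>x. (\<lambda>n. pact (P n) h x) \<longlonglongrightarrow> fc f h x"
    using fc_obtain[OF assms order.refl] by blast
  have "(\<lambda>n. pact (P n) h x * y) \<longlonglongrightarrow> fc f h x * y" by (intro tendsto_intros P)
  then show ?thesis using P[of "x * y"] unfolding pact_mult_right by (rule LIMSEQ_unique)
qed

text \<open>Naturality: polynomials commute with \<open>L\<close>, and a single approximating
  sequence is taken on an interval large enough for both \<open>h\<close> and \<open>k\<close>.
  Later \<open>L\<close> is multiplication by \<open>v\<close> from \<open>st v * v\<close> to
  \<open>v * st v\<close>, an isometry into an orthogonal copy, or the projection onto a direct
  summand.\<close>

lemma fc_intertwine:
  assumes h: "st h = h" "st k = k" and f: "continuous_on UNIV f"
    and L: "bounded_linear L" "\<And>x. L (h * x) = k * L x"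
  shows "L (fc f h x) = fc f k (L x)"
proof -
  obtain P where P: "uniform_limit {-max (norm h) (norm k)..max (norm h) (norm k)} (\<lambda>n. poly (P n)) f sequentially"
    "\<And>x. (\<lambda>n. pact (P n) h x) \<longlonglongrightarrow> fc f h x"
    using fc_obtain[OF h(1) f max.cobounded1] by blast
  have "uniform_limit {-norm k..norm k} (\<lambda>n. poly (P n)) f sequentially"
    by (rule uniform_limit_on_subset[OF P(1)]) auto
  then have "(\<lambda>n. pact (P n) k (L x)) \<longlonglongrightarrow> fc f k (L x)"
    by (intro fc_tendsto h f)
  moreover have "(\<lambda>n. L (pact (P n) h x)) \<longlonglongrightarrow> L (fc f h x)"
    by (intro bounded_linear.tendsto[OF L(1)] P)
  moreover have "L (pact (P n) h x) = pact (P n) k (L x)" for n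
    by (intro pact_intertwine L(2) linear_add linear_scale bounded_linear.linear L(1))
  ultimately show ?thesis using LIMSEQ_unique by simp
qed

lemma fc_add_right:
  assumes "st h = h" "continuous_on UNIV f"
  shows "fc f h (x + y) = fc f h x + fc f h y"
proof -
  obtain P where P: "\<And>x. (\<lambda>n. pact (P n) h x) \<longlonglongrightarrow> fc f h x"
    using fc_obtain[OF assms order.refl] by blast
  show ?thesis
    using P[of "x + y"] tendsto_add[OF P[of x] P[of y]] unfolding pact_add_right by (rule LIMSEQ_unique)
qed

lemma fc_scaleR_right:
  assumes "st h = h" "continuous_on UNIV f"
  shows "fc f h (c *\<^sub>R x) = c *\<^sub>R fc f h x"
  using fc_intertwine[OF assms(1,1,2) bounded_linear_scaleR_right] by simp

lemma fc_diff_right: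
  assumes "st h = h" "continuous_on UNIV f"
  shows "fc f h (x - y) = fc f h x - fc f h y"
  using fc_add_right[OF assms, of "x - y" y] by (simp add: algebra_simps)

lemma fc_zero_right:
  assumes "st h = h" "continuous_on UNIV f"
  shows "fc f h 0 = 0"
  using fc_diff_right[OF assms, of 0 0] by simp

lemma st_fc:
  assumes "st h = h" "continuous_on UNIV f"
  shows "st (fc f h x) * y = st x * fc f h y"
proof -
  obtain P where P: "\<And>x. (\<lambda>n. pact (P n) h x) \<longlonglongrightarrow> fc f h x"
    using fc_obtain[OF assms order.refl] by blast
  have "(\<lambda>n. st (pact (P n) h x) * y) \<longlonglongrightarrow> st (fc f h x) * y"
    "(\<lambda>n. st x * pact (P n) h y) \<longlonglongrightarrow> st x * fc f h y" by (intro tendsto_intros P)+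
  then show ?thesis unfolding st_pact[OF assms(1)] by (rule LIMSEQ_unique)
qed

text \<open>Split \<open>P n\<close> into its constant term and t times \<open>Q n\<close>. The
  second part is implemented by the element \<open>pact (Q n) h h\<close>, and the constants tend to
  \<open>f 0 = 0\<close>. The elements form a Cauchy sequence because the left regular
  representation is isometric.\<close>

lemma fe_exists:
  assumes h: "st h = h" and f: "continuous_on UNIV f" "f 0 = 0"
  shows "\<exists>y. \<forall>x. y * x = fc f h x"
proof -
  obtain P where P: "uniform_limit {-norm h..norm h} (\<lambda>n. poly (P n)) f sequentially"
    "\<And>x. (\<lambda>n. pact (P n) h x) \<longlonglongrightarrow> fc f h x" using fc_obtain[OF h f(1) order.refl] by blast
  define Q where "Q n = poly_shift 1 (P n)" for n
  have PQ: "P n = pCons (poly (P n) 0) (Q n)" for n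
  proof -
    obtain a p where ap: "P n = pCons a p" by (rule pCons_cases)
    have "poly_shift 1 (pCons a p) = p" by (simp add: poly_eq_iff coeff_poly_shift)
    then show ?thesis by (simp add: Q_def ap)
  qed
  have P0: "(\<lambda>n. poly (P n) 0) \<longlonglongrightarrow> 0"
    using tendsto_uniform_limitI[OF P(1), of 0] f(2) by simp
  define y where "y n = pact (Q n) h h" for n
  have yP: "y n * x = pact (P n) h x - poly (P n) 0 *\<^sub>R x" for n x
  proof -
    have "pact (P n) h x = poly (P n) 0 *\<^sub>R x + h * pact (Q n) h x"
      by (subst PQ) (rule pact_pCons)
    also have "h * pact (Q n) h x = y n * x"
      unfolding y_def pact_mult_right by (rule pact_commute)
    finally show ?thesis by simp
  qed
  have "Cauchy y"
  proof (rule CauchyI)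
    fix e :: real assume "0 < e"
    then have e4: "0 < e / 4" by simp
    obtain N where N: "\<And>m n x. N \<le> m \<Longrightarrow> N \<le> n \<Longrightarrow> norm (pact (P m) h x - pact (P n) h x) \<le> e / 4 * norm x"
      using uniform_cauchy_pact[OF h P(1) e4] by blast
    obtain M where M: "\<And>n. M \<le> n \<Longrightarrow> \<bar>poly (P n) 0\<bar> < e / 4"
      using LIMSEQ_D[OF P0 e4] by auto
    have "norm (y m - y n) < e" if mn: "N + M \<le> m" "N + M \<le> n" for m n
    proof -
      have "norm ((y m - y n) * x) \<le> (3 / 4 * e) * norm x" for x
      proof -
        have "(y m - y n) * x = (pact (P m) h x - pact (P n) h x) + (poly (P n) 0 - poly (P m) 0) *\<^sub>R x"
          by (simp add: left_diff_distrib yP scaleR_left_diff_distrib)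
        also have "norm \<dots> \<le> e / 4 * norm x + (e / 4 + e / 4) * norm x"
        proof (intro order_trans[OF norm_triangle_ineq] add_mono N)
          have "\<bar>poly (P n) 0 - poly (P m) 0\<bar> \<le> e / 4 + e / 4"
            using M[of m] M[of n] mn by linarith
          then show "norm ((poly (P n) 0 - poly (P m) 0) *\<^sub>R x) \<le> (e / 4 + e / 4) * norm x"
            unfolding norm_scaleR by (intro mult_right_mono) auto
        qed (use mn in auto)
        finally show ?thesis by (simp add: algebra_simps)
      qed
      from norm_le_left_mult[OF this] have "norm (y m - y n) \<le> 3 / 4 * e" using \<open>0 < e\<close> by simp
      then show ?thesis using \<open>0 < e\<close> by simp
    qed
    then show "\<exists>M. \<forall>m\<ge>M. \<forall>n\<ge>M. norm (y m - y n) < e"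
      by (intro exI[of _ "N + M"]) auto
  qed
  then obtain z where z: "y \<longlonglongrightarrow> z" by (meson Cauchy_convergent convergent_def)
  have "z * x = fc f h x" for x
  proof (rule LIMSEQ_unique)
    show "(\<lambda>n. y n * x) \<longlonglongrightarrow> z * x" by (intro tendsto_intros z)
    have "(\<lambda>n. pact (P n) h x - poly (P n) 0 *\<^sub>R x) \<longlonglongrightarrow> fc f h x - 0 *\<^sub>R x"
      by (intro tendsto_diff tendsto_scaleR P P0 tendsto_const)
    then show "(\<lambda>n. y n * x) \<longlonglongrightarrow> fc f h x" by (simp add: yP)
  qed
  then show ?thesis by blast
qed

lemma fe_mult:
  assumes "st h = h" "continuous_on UNIV f" "f 0 = 0"
  shows "fe f h * x = fc f h x"
proof -
  obtain y where y: "\<And>x. y * x = fc f h x" using fe_exists[OF assms] by blast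
  have "fe f h = y" unfolding fe_def
    by (rule the_equality) (auto simp: y intro: left_mult_cancel)
  then show ?thesis by (simp add: y)
qed

lemma fe_eqI:
  assumes "st h = h" "continuous_on UNIV f" "f 0 = 0" "\<And>x. y * x = fc f h x"
  shows "fe f h = y"
  by (rule left_mult_cancel) (simp add: fe_mult assms)

lemma st_fe:
  assumes "st h = h" "continuous_on UNIV f" "f 0 = 0"
  shows "st (fe f h) = fe f h"
proof (rule left_mult_cancel)
  fix x
  show "st (fe f h) * x = fe f h * x"
  proof (rule right_mult_cancel)
    fix y
    have "y * (st (fe f h) * x) = st (fe f h * st y) * x"
      by (simp add: st_mult mult.assoc)
    also have "\<dots> = y * (fe f h * x)" by (simp add: fe_mult st_fc assms)
    finally show "y * (st (fe f h) * x) = y * (fe f h * x)" .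
  qed
qed

lemma fe_id: "st h = h \<Longrightarrow> fe (\<lambda>t. t) h = h"
  by (rule fe_eqI) (auto simp: fc_id)

lemma fe_add:
  assumes "st h = h" "continuous_on UNIV f" "f 0 = 0" "continuous_on UNIV g" "g 0 = 0"
  shows "fe (\<lambda>t. f t + g t) h = fe f h + fe g h"
  by (rule fe_eqI) (auto simp: fc_add fe_mult assms distrib_right intro!: continuous_intros assms)

lemma fe_diff:
  assumes "st h = h" "continuous_on UNIV f" "f 0 = 0" "continuous_on UNIV g" "g 0 = 0"
  shows "fe (\<lambda>t. f t - g t) h = fe f h - fe g h"
  by (rule fe_eqI) (auto simp: fc_diff fe_mult assms left_diff_distrib intro!: continuous_intros assms)

lemma fe_scale:
  assumes "st h = h" "continuous_on UNIV f" "f 0 = 0"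
  shows "fe (\<lambda>t. c * f t) h = c *\<^sub>R fe f h"
  by (rule fe_eqI) (auto simp: fc_scale fe_mult assms intro!: continuous_intros assms)

lemma fc_fe:
  assumes "st h = h" "continuous_on UNIV f" "continuous_on UNIV g" "g 0 = 0"
  shows "fc f h (fe g h) = fe (\<lambda>t. f t * g t) h"
  by (rule fe_eqI[symmetric])
    (auto simp: fc_mult fe_mult fc_mult_right assms intro!: continuous_intros assms)

lemma fe_times:
  assumes "st h = h" "continuous_on UNIV f" "f 0 = 0" "continuous_on UNIV g" "g 0 = 0"
  shows "fe f h * fe g h = fe (\<lambda>t. f t * g t) h"
  by (simp add: fe_mult fc_fe assms)

lemma norm_fe_le:
  assumes "st h = h" "continuous_on UNIV f" "f 0 = 0" "\<And>t. \<bar>t\<bar> \<le> norm h \<Longrightarrow> \<bar>f t\<bar> \<le> M"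
  shows "norm (fe f h) \<le> M"
proof (rule norm_le_left_mult)
  show "norm (fe f h * x) \<le> M * norm x" for x
    by (simp add: fe_mult assms norm_fc_le)
  show "0 \<le> M" using assms(4)[of 0] by simp
qed

lemma fe_cong:
  assumes "st h = h" "continuous_on UNIV f" "f 0 = 0" "continuous_on UNIV g" "g 0 = 0"
    "\<And>t. \<bar>t\<bar> \<le> norm h \<Longrightarrow> f t = g t"
  shows "fe f h = fe g h"
proof (rule fe_eqI)
  show "fe g h * x = fc f h x" for x
    using fc_cong[OF assms(1,2,4,6), of x] by (simp add: fe_mult assms)
qed (use assms in auto)

lemma fe_zero: "st h = h \<Longrightarrow> fe (\<lambda>t. 0) h = 0"
  by (rule fe_eqI) (auto simp: fc_const)

lemma pact_fe:
  assumes "st h = h" "continuous_on UNIV g" "g 0 = 0"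
  shows "pact p (fe g h) x = fc (\<lambda>t. poly p (g t)) h x"
proof (induction p)
  case (pCons a p)
  have c: "continuous_on UNIV (\<lambda>t. poly p (g t))"
    using continuous_on_compose[OF assms(2), of "poly p"] continuous_on_poly_UNIV
    by (auto simp: o_def intro: continuous_on_subset)
  show ?case
    by (simp add: pCons.IH fc_add fc_const fc_mult fe_mult assms c continuous_on_mult)
qed (simp add: fc_const assms)

lemma fc_compose:
  assumes h: "st h = h" and f: "continuous_on UNIV f" and g: "continuous_on UNIV g" "g 0 = 0"
  shows "fc f (fe g h) x = fc (\<lambda>t. f (g t)) h x"
proof -
  have fg: "continuous_on UNIV (\<lambda>t. k (g t))" if "continuous_on UNIV k" for k :: "real \<Rightarrow> real"
    using continuous_on_compose[OF g(1), of k] that by (auto simp: o_def intro: continuous_on_subset)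
  have "compact (g ` {-norm h..norm h})"
    using g(1) by (intro compact_continuous_image) (auto intro: continuous_on_subset)
  then obtain C where C: "\<And>t. t \<in> {-norm h..norm h} \<Longrightarrow> \<bar>g t\<bar> \<le> C"
    unfolding bounded_iff by (metis compact_imp_bounded bounded_iff imageI real_norm_def)
  \<comment> \<open>The polynomials must approximate \<open>f\<close> on the range of
    \<open>g\<close> as well as on the interval that defines the calculus of
    \<open>fe g h\<close>.\<close>
  obtain P where P: "uniform_limit {-max C (norm (fe g h))..max C (norm (fe g h))} (\<lambda>n. poly (P n)) f sequentially"
    "\<And>x. (\<lambda>n. pact (P n) (fe g h) x) \<longlonglongrightarrow> fc f (fe g h) x"
    using fc_obtain[OF st_fe[OF h g] f max.cobounded2] by blast
  have "(\<lambda>n. pact (P n) (fe g h) x) \<longlonglongrightarrow> fc (\<lambda>t. f (g t)) h x"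
  proof (rule LIMSEQ_I)
    fix e :: real assume e: "0 < e"
    define d where "d = e / (norm x + 1)"
    have x1: "0 < norm x + 1" using norm_ge_zero[of x] by linarith
    then have "d * (norm x + 1) = e" by (simp add: d_def)
    then have "d * norm x + d = e" by (simp only: distrib_left mult_1_right)
    moreover have "0 < d" using e x1 by (simp add: d_def)
    ultimately have d: "0 < d" "d * norm x < e" by linarith+
    let ?I = "{-max C (norm (fe g h))..max C (norm (fe g h))}"
    obtain N where N': "\<And>n t. N \<le> n \<Longrightarrow> t \<in> ?I \<Longrightarrow> dist (poly (P n) t) (f t) < d"
      using uniform_limitD[OF P(1) d(1)] unfolding eventually_sequentially by blast
    have N: "\<bar>poly (P n) t - f t\<bar> \<le> d" if "N \<le> n" "\<bar>t\<bar> \<le> C" for n t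
    proof -
      have "t \<in> ?I" using that(2) by (simp add: abs_le_iff le_max_iff_disj minus_le_iff)
      then show ?thesis using N'[OF that(1)] by (simp add: dist_real_def less_imp_le)
    qed
    have "norm (pact (P n) (fe g h) x - fc (\<lambda>t. f (g t)) h x) < e" if "N \<le> n" for n
    proof -
      have "norm (fc (\<lambda>t. poly (P n) (g t) - f (g t)) h x) \<le> d * norm x"
        by (intro norm_fc_le continuous_on_diff fg f h continuous_on_poly_UNIV N[OF that] C)
          (simp add: abs_le_iff)
      then show ?thesis
        using d by (simp add: pact_fe fc_diff fg f h g continuous_on_poly_UNIV)
    qed
    then show "\<exists>N. \<forall>n\<ge>N. norm (pact (P n) (fe g h) x - fc (\<lambda>t. f (g t)) h x) < e" by blast
  qed
  then show ?thesis using P(2) LIMSEQ_unique by blast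
qed

lemma fe_compose:
  assumes "st h = h" "continuous_on UNIV f" "f 0 = 0" "continuous_on UNIV g" "g 0 = 0"
  shows "fe f (fe g h) = fe (\<lambda>t. f (g t)) h"
proof (rule fe_eqI[symmetric])
  show "continuous_on UNIV (\<lambda>t. f (g t))"
    using continuous_on_compose[of UNIV g f] assms by (auto simp: o_def intro: continuous_on_subset)
  show "fe f (fe g h) * x = fc (\<lambda>t. f (g t)) h x" for x
    by (simp add: fe_mult fc_compose assms st_fe)
qed (use assms in auto)

section \<open>Positive elements\<close>

text \<open>Positivity without spectra: for self-adjoint \<open>h\<close>, a vanishing negative part
  says that the spectrum lies in [0, \<infinity>).\<close>

definition pos :: "'a \<Rightarrow> bool" where
  "pos h \<longleftrightarrow> st h = h \<and> fe (\<lambda>t. max 0 (- t)) h = 0"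

lemma pos_st: "pos h \<Longrightarrow> st h = h"
  by (simp add: pos_def)

lemma cont_max_compose:
  fixes f :: "real \<Rightarrow> real"
  assumes "continuous_on UNIV f"
  shows "continuous_on UNIV (\<lambda>t. f (max 0 t))"
  by (rule continuous_on_compose2[OF assms]) (auto intro!: continuous_intros)

lemma fe_times3:
  assumes "st h = h" "continuous_on UNIV f" "f 0 = 0"
  shows "fe (\<lambda>t. f t * f t * f t) h = fe f h * fe f h * fe f h"
proof -
  have "continuous_on UNIV (\<lambda>t. f t * f t)" by (intro continuous_intros assms)
  from fe_times[OF assms(1) this _ assms(2,3)] show ?thesis
    by (simp add: fe_times assms)
qed

lemma fe_uminus:
  assumes "st h = h" "continuous_on UNIV f" "f 0 = 0"
  shows "fe (\<lambda>t. - f t) h = - fe f h"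
  using fe_scale[OF assms, of "-1"] by simp

lemma pos_fe_max: "pos h \<Longrightarrow> fe (max 0) h = h"
proof -
  assume h: "pos h"
  have "h = fe (\<lambda>t. max 0 t - max 0 (- t)) h"
    by (subst fe_id[symmetric]) (auto intro!: fe_cong continuous_intros simp: pos_st[OF h])
  also have "\<dots> = fe (max 0) h - fe (\<lambda>t. max 0 (- t)) h"
    by (rule fe_diff) (auto intro!: continuous_intros simp: pos_st[OF h])
  finally show ?thesis using h by (simp add: pos_def)
qed

text \<open>A positive \<open>h\<close> equals its own positive part, so only the values of
  \<open>f\<close> on [0, \<infinity>) matter. The bounds for positive elements therefore ask for
  conditions on [0, norm h] only.\<close>

lemma pos_fc_max:
  assumes "pos h" "continuous_on UNIV f"
  shows "fc f h x = fc (\<lambda>t. f (max 0 t)) h x"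
  using fc_compose[of h f "max 0" x] assms
  by (simp add: pos_fe_max pos_st continuous_on_max)

lemma pos_norm_fc_le:
  assumes "pos h" "continuous_on UNIV f" "\<And>t. 0 \<le> t \<Longrightarrow> t \<le> norm h \<Longrightarrow> \<bar>f t\<bar> \<le> M"
  shows "norm (fc f h x) \<le> M * norm x"
  unfolding pos_fc_max[OF assms(1,2)]
  by (rule norm_fc_le) (use assms in \<open>auto simp: pos_st intro: cont_max_compose\<close>)

lemma pos_fc_cong:
  assumes "pos h" "continuous_on UNIV f" "continuous_on UNIV g"
    and "\<And>t. 0 \<le> t \<Longrightarrow> t \<le> norm h \<Longrightarrow> f t = g t"
  shows "fc f h x = fc g h x"
  unfolding pos_fc_max[OF assms(1,2)] pos_fc_max[OF assms(1,3)]
  by (rule fc_cong) (use assms in \<open>auto simp: pos_st intro: cont_max_compose\<close>)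

lemma pos_norm_fe_le:
  assumes "pos h" "continuous_on UNIV f" "f 0 = 0" "\<And>t. 0 \<le> t \<Longrightarrow> t \<le> norm h \<Longrightarrow> \<bar>f t\<bar> \<le> M"
  shows "norm (fe f h) \<le> M"
proof (rule norm_le_left_mult)
  show "norm (fe f h * x) \<le> M * norm x" for x
    by (simp add: fe_mult pos_st assms pos_norm_fc_le)
  show "0 \<le> M" using assms(4)[of 0] by simp
qed

lemma pos_fe_cong:
  assumes "pos h" "continuous_on UNIV f" "f 0 = 0" "continuous_on UNIV g" "g 0 = 0"
    "\<And>t. 0 \<le> t \<Longrightarrow> t \<le> norm h \<Longrightarrow> f t = g t"
  shows "fe f h = fe g h"
proof (rule fe_eqI)
  show "fe g h * x = fc f h x" for x
    using pos_fc_cong[OF assms(1,2,4,6), of x] by (simp add: fe_mult assms pos_st)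
qed (use assms pos_st in auto)

lemma pos_fe_eqI:
  assumes "pos h" "continuous_on UNIV f" "f 0 = 0" "\<And>t. 0 \<le> t \<Longrightarrow> t \<le> norm h \<Longrightarrow> f t = t"
  shows "fe f h = h"
  using pos_fe_cong[OF assms(1-3) continuous_on_id, simplified, OF assms(4)]
  by (simp add: fe_id pos_st assms)

lemma fc_const_minus_id:
  assumes "st h = h"
  shows "fc (\<lambda>t. c - t) h x = c *\<^sub>R x - h * x"
  using fc_diff[OF assms continuous_on_const continuous_on_id] by (simp add: fc_const fc_id assms)

lemma pos_norm_diff_le:
  assumes "pos h" "norm h \<le> R"
  shows "norm (R *\<^sub>R x - h * x) \<le> R * norm x"
  unfolding fc_const_minus_id[OF pos_st[OF assms(1)], symmetric]
  by (rule pos_norm_fc_le) (use assms in \<open>auto intro!: continuous_intros\<close>)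

lemma norm_fc_power_le:
  assumes h: "st h = h" and R: "\<And>x. norm (R *\<^sub>R x - h * x) \<le> R * norm x" "0 \<le> R"
  shows "norm (fc (\<lambda>t. (R - t) ^ k) h x) \<le> R ^ k * norm x"
proof (induction k arbitrary: x)
  case 0
  then show ?case by (simp add: fc_const h)
next
  case (Suc k)
  have "fc (\<lambda>t. (R - t) ^ Suc k) h x = fc (\<lambda>t. R - t) h (fc (\<lambda>t. (R - t) ^ k) h x)"
    using fc_mult[OF h, of "\<lambda>t. R - t" "\<lambda>t. (R - t) ^ k" x] by (simp add: continuous_intros)
  also have "norm \<dots> \<le> R * (R ^ k * norm x)"
    unfolding fc_const_minus_id[OF h]
    by (intro order_trans[OF R(1)] mult_left_mono Suc.IH R(2))
  finally show ?case by simp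
qed

lemma linear_le_power_sum:
  fixes R s :: real
  assumes "0 < R" "0 \<le> s"
  shows "s * (real (Suc k) * R ^ k) \<le> (R + s) ^ Suc k"
proof -
  have "1 + real (Suc k) * (s / R) \<le> (1 + s / R) ^ Suc k"
    by (rule Bernoulli_inequality) (use assms divide_nonneg_pos[of s R] in linarith)
  then have "R ^ Suc k * (real (Suc k) * (s / R)) \<le> R ^ Suc k * (1 + s / R) ^ Suc k"
    using assms by (intro mult_left_mono) auto
  also have "\<dots> = (R + s) ^ Suc k"
    using assms by (simp only: flip: power_mult_distrib) (simp add: distrib_left)
  finally show ?thesis using assms by (simp add: mult_ac)
qed

lemma square_eq_zero_imp: "st x = x \<Longrightarrow> x * x = 0 \<Longrightarrow> x = 0"
  using st_mult_self_eq_0[of x] by simp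

text \<open>On the negative part of \<open>h\<close> the operator \<open>R - h\<close> is larger than \<open>R\<close>; the powers of
  \<open>R - h\<close> would therefore grow too fast if the negative part were not zero.\<close>
lemma posI_norm:
  assumes h: "st h = h" and R: "\<And>x. norm (R *\<^sub>R x - h * x) \<le> R * norm x" "0 < R"
  shows "pos h"
proof -
  let ?nf = "\<lambda>t::real. max 0 (- t)"
  define n where "n = fe ?nf h"
  have cn: "continuous_on UNIV ?nf" by (intro continuous_intros)
  have st_n: "st n = n" unfolding n_def by (rule st_fe) (auto simp: h cn)
  have "norm (n * n) \<le> R * norm n / real (Suc k)" for k
  proof -
    \<comment> \<open>On the negative half line R + ?nf t = R - t, so \<open>\<phi>\<close> undoes
      the power and n n = \<phi>(h) (R - h)^(k+1) n. Bernoulli's inequality bounds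
      \<open>\<phi>\<close> by 1 / ((k+1) R^k), while the power has norm at most R^(k+1); the
      product of the two is R / (k+1), which tends to 0.\<close>
    define \<phi> where "\<phi> t = ?nf t / (R + ?nf t) ^ Suc k" for t
    have ne: "R + max 0 a \<noteq> 0" for a :: real using R(2) by (simp add: add_pos_nonneg order.strict_implies_not_eq[symmetric])
    have c\<phi>: "continuous_on UNIV \<phi>" unfolding \<phi>_def
      by (intro continuous_intros ballI power_not_zero ne)
    have ck: "continuous_on UNIV (\<lambda>t. (R - t) ^ Suc k)" by (intro continuous_intros)
    have "\<phi> t * ((R - t) ^ Suc k * ?nf t) = ?nf t * ?nf t" for t
      using R(2) by (cases "t < 0") (auto simp: \<phi>_def max_def)
    then have "(\<lambda>t. \<phi> t * ((R - t) ^ Suc k * ?nf t)) = (\<lambda>t. ?nf t * ?nf t)" by (rule ext)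
    moreover have "fe (\<lambda>t. ?nf t * ?nf t) h = n * n"
      by (simp add: n_def fe_times[OF h cn _ cn])
    ultimately have "fe (\<lambda>t. \<phi> t * ((R - t) ^ Suc k * ?nf t)) h = n * n" by simp
    then have "n * n = fc \<phi> h (fc (\<lambda>t. (R - t) ^ Suc k) h n)"
      using fc_fe[OF h c\<phi> continuous_on_mult[OF ck cn]] fc_fe[OF h ck cn] by (simp add: n_def)
    also have "norm \<dots> \<le> (1 / (real (Suc k) * R ^ k)) * (R ^ Suc k * norm n)"
    proof (rule order_trans[OF norm_fc_le mult_left_mono])
      show "\<bar>\<phi> t\<bar> \<le> 1 / (real (Suc k) * R ^ k)" for t
      proof -
        have "\<bar>\<phi> t\<bar> = ?nf t / (R + ?nf t) ^ Suc k" using R(2) by (simp add: \<phi>_def)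
        also have "\<dots> \<le> 1 / (real (Suc k) * R ^ k)"
        proof -
          have "?nf t * (real (Suc k) * R ^ k) \<le> 1 * (R + ?nf t) ^ Suc k"
            using linear_le_power_sum[of R "?nf t" k] R(2) by simp
          moreover have "0 < real (Suc k) * R ^ k" "0 < (R + ?nf t) ^ Suc k"
            using R(2) by (simp_all add: add_pos_nonneg)
          ultimately show ?thesis by (simp only: frac_le_eq divide_le_0_iff) (simp add: mult_less_0_iff)
        qed
        finally show ?thesis .
      qed
      show "norm (fc (\<lambda>t. (R - t) ^ Suc k) h n) \<le> R ^ Suc k * norm n"
        by (rule norm_fc_power_le) (use R h in auto)
    qed (use R h c\<phi> in auto)
    also have "\<dots> = R * norm n / real (Suc k)" using R(2) by (simp del: of_nat_Suc)
    finally show ?thesis .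
  qed
  moreover have "(\<lambda>k. R * norm n / real (Suc k)) \<longlonglongrightarrow> 0"
    using tendsto_mult_right_zero[OF LIMSEQ_inverse_real_of_nat, of "R * norm n"]
    by (simp add: divide_inverse)
  ultimately have "norm (n * n) \<le> 0" by (intro LIMSEQ_le_const) auto
  then have "n = 0" using square_eq_zero_imp st_n by simp
  then show ?thesis using h by (simp add: pos_def n_def)
qed

lemma fe_zero_arg: "continuous_on UNIV f \<Longrightarrow> f 0 = 0 \<Longrightarrow> fe f 0 = 0"
  using norm_fe_le[of 0 f 0] by simp

lemma pos_zero [simp]: "pos 0"
  by (auto simp: pos_def intro!: fe_zero_arg continuous_intros)

text \<open>The negative part of a sum is not accessible, but the criterion of
  \<open>posI_norm\<close> adds up: the radii add and so do the norm estimates. The summands 1 only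
  keep the radii positive.\<close>

lemma pos_add:
  assumes "pos a" "pos b"
  shows "pos (a + b)"
proof (rule posI_norm)
  let ?R = "norm a + 1" and ?S = "norm b + 1"
  show "st (a + b) = a + b" using assms by (simp add: st_add pos_st)
  show "norm ((?R + ?S) *\<^sub>R x - (a + b) * x) \<le> (?R + ?S) * norm x" for x
  proof -
    have "(?R + ?S) *\<^sub>R x - (a + b) * x = (?R *\<^sub>R x - a * x) + (?S *\<^sub>R x - b * x)"
      by (simp only: scaleR_add_left distrib_right) simp
    also have "norm \<dots> \<le> ?R * norm x + ?S * norm x"
      by (intro order_trans[OF norm_triangle_ineq] add_mono pos_norm_diff_le assms) auto
    finally show ?thesis by (simp only: distrib_right)
  qed
  show "0 < ?R + ?S" using norm_ge_zero[of a] norm_ge_zero[of b] by linarith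
qed

lemma pos_scaleR:
  assumes "pos a" "0 \<le> c"
  shows "pos (c *\<^sub>R a)"
proof (cases "c = 0")
  case False
  show ?thesis
  proof (rule posI_norm)
    show "st (c *\<^sub>R a) = c *\<^sub>R a" using assms by (simp add: st_scaleR pos_st)
    show "norm ((c * (norm a + 1)) *\<^sub>R x - (c *\<^sub>R a) * x) \<le> (c * (norm a + 1)) * norm x" for x
    proof -
      have "(c * (norm a + 1)) *\<^sub>R x - (c *\<^sub>R a) * x = c *\<^sub>R ((norm a + 1) *\<^sub>R x - a * x)"
        by (simp add: algebra_simps)
      then show ?thesis
        using pos_norm_diff_le[OF assms(1), of "norm a + 1" x] assms(2)
        by (simp add: mult.assoc mult_left_mono)
    qed
    show "0 < c * (norm a + 1)"
      using assms False norm_ge_zero[of a] by (intro mult_pos_pos) linarith+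
  qed
qed simp

lemma pos_sum: "(\<And>i. i \<in> A \<Longrightarrow> pos (f i)) \<Longrightarrow> pos (\<Sum>i\<in>A. f i)"
  by (induction A rule: infinite_finite_induct) (auto intro: pos_add)

lemma pos_fe:
  assumes "st h = h" "continuous_on UNIV f" "f 0 = 0" "\<And>t. \<bar>t\<bar> \<le> norm h \<Longrightarrow> 0 \<le> f t"
  shows "pos (fe f h)"
proof -
  have "fe (\<lambda>t. max 0 (- t)) (fe f h) = fe (\<lambda>t. max 0 (- f t)) h"
    by (rule fe_compose) (auto intro!: continuous_intros assms)
  also have "\<dots> = fe (\<lambda>t. 0) h"
    by (rule fe_cong) (use assms in \<open>auto intro!: continuous_intros assms\<close>)
  finally show ?thesis by (simp add: pos_def st_fe fe_zero assms)
qed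

lemma pos_fe_pos:
  assumes "pos h" "continuous_on UNIV f" "f 0 = 0" "\<And>t. 0 \<le> t \<Longrightarrow> t \<le> norm h \<Longrightarrow> 0 \<le> f t"
  shows "pos (fe f h)"
proof -
  have "fe f h = fe (\<lambda>t. f (max 0 t)) h"
    by (rule pos_fe_cong) (use assms in \<open>auto intro: cont_max_compose\<close>)
  also have "pos \<dots>"
    by (rule pos_fe) (use assms in \<open>auto simp: pos_st intro: cont_max_compose\<close>)
  finally show ?thesis .
qed

lemma fe_square: "st h = h \<Longrightarrow> fe (\<lambda>t. t * t) h = h * h"
  using fe_times[of h "\<lambda>t. t" "\<lambda>t. t"] by (simp add: fe_id)

lemma pos_square: "st h = h \<Longrightarrow> pos (h * h)"
  by (subst fe_square[symmetric]) (auto intro!: pos_fe continuous_intros)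

text \<open>\<open>p\<close> and \<open>q\<close> are the real and imaginary parts of
  \<open>v\<close>; the commutator terms of the two products cancel.\<close>

lemma self_mult_st_eq_squares:
  "\<exists>p q. st p = p \<and> st q = q \<and> st v * v + v * st v = 2 *\<^sub>R (p * p) + 2 *\<^sub>R (q * q)"
proof -
  define p where "p = (1/2) *\<^sub>R (v + st v)"
  define q where "q = cs (- \<i> / 2) (v - st v)"
  have st_p: "st p = p" by (simp add: p_def st_scaleR st_add add.commute)
  have "st q = cs (\<i> / 2) (st v - v)" by (simp add: q_def st_cs st_diff)
  also have "\<dots> = q" using cs_cs[of "\<i> / 2" "-1" "v - st v"] by (simp add: q_def cs_minus_one)
  finally have st_q: "st q = q" .
  have "q * q = cs (- (1/4)) ((v - st v) * (v - st v))"
    by (simp add: q_def cs_mult_left cs_mult_right cs_cs)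
  also have "\<dots> = - ((1/4) *\<^sub>R ((v - st v) * (v - st v)))"
    using cs_of_real[of "1/4"] by (simp add: cs_minus_left)
  finally have "2 *\<^sub>R (p * p) + 2 *\<^sub>R (q * q)
    = (1/2) *\<^sub>R ((v + st v) * (v + st v) - (v - st v) * (v - st v))"
    by (simp add: p_def scaleR_right_diff_distrib)
  also have "(v + st v) * (v + st v) - (v - st v) * (v - st v) = 2 *\<^sub>R (st v * v + v * st v)"
    by (simp add: algebra_simps scaleR_2)
  finally show ?thesis using st_p st_q by force
qed

text \<open>Fukamiya--Kaplansky: if \<open>n\<close> is the negative part of \<open>y\<^sup>* y\<close> and \<open>v = y n\<close>, then
  \<open>v\<^sup>* v = - n\<^sup>3\<close>, hence \<open>v v\<^sup>*\<close> is positive, and this forces \<open>v = 0\<close>.\<close>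
lemma pos_st_mult: "pos (st y * y)"
proof -
  let ?nf = "\<lambda>t::real. max 0 (- t)"
  let ?nf3 = "\<lambda>t::real. ?nf t * ?nf t * ?nf t"
  define a where "a = st y * y"
  have a: "st a = a" by (simp add: a_def st_mult)
  define n where "n = fe ?nf a"
  have cn: "continuous_on UNIV ?nf" by (intro continuous_intros)
  have st_n: "st n = n" unfolding n_def by (rule st_fe) (auto simp: a cn)
  define c where "c = fe ?nf3 a"
  have cnn: "c = n * n * n"
    unfolding n_def c_def by (rule fe_times3[OF a cn]) simp
  have c: "pos c" unfolding c_def
    by (rule pos_fe) (auto intro!: continuous_intros simp: a)
  have "a * n = fe (\<lambda>t. t * ?nf t) a"
    unfolding n_def using fe_times[OF a continuous_on_id refl cn] by (simp add: fe_id a)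
  also have "\<dots> = fe (\<lambda>t. - (?nf t * ?nf t)) a"
  proof (rule fe_cong)
    show "t * ?nf t = - (?nf t * ?nf t)" for t by (auto simp: max_def)
  qed (auto intro!: continuous_intros simp: a)
  also have "\<dots> = - (n * n)"
    using fe_uminus[OF a continuous_on_mult[OF cn cn]] fe_times[OF a cn _ cn] by (simp add: n_def)
  finally have an: "a * n = - (n * n)" .
  define v where "v = y * n"
  have vv: "st v * v = - c"
    by (simp add: v_def st_mult st_n cnn mult.assoc)
      (metis a_def an minus_mult_right mult.assoc)
  obtain p q where pq: "st p = p" "st q = q" "st v * v + v * st v = 2 *\<^sub>R (p * p) + 2 *\<^sub>R (q * q)"
    using self_mult_st_eq_squares by blast
  have "v * st v = 2 *\<^sub>R (p * p) + 2 *\<^sub>R (q * q) + c" using pq(3) by (simp add: vv algebra_simps)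
  then have d: "pos (v * st v)" using pq c by (simp add: pos_add pos_scaleR pos_square)
  have "c = 0"
  proof -
    \<comment> \<open>Since \<open>st v * v = - c\<close> with \<open>c\<close> positive, its
      negative part is \<open>c\<close>; multiplication by \<open>v\<close> carries it to the
      negative part of \<open>v * st v\<close>, which is zero.\<close>
    have "v * c = 0"
    proof (rule left_mult_cancel)
      fix x
      have "v * (fc ?nf (st v * v) x) = fc ?nf (v * st v) (v * x)"
        by (rule fc_intertwine) (auto simp: st_mult mult.assoc bounded_linear_mult_right cn)
      also have "\<dots> = fe ?nf (v * st v) * (v * x)"
        by (rule fe_mult[symmetric]) (auto simp: st_mult cn)
      also have "\<dots> = 0" using d by (simp add: pos_def)
      also have "fc ?nf (st v * v) x = fc ?nf (fe (\<lambda>t. - ?nf3 t) a) x"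
        unfolding vv c_def by (subst fe_uminus) (auto intro!: continuous_intros simp: a)
      also have "\<dots> = fc (\<lambda>t. ?nf (- ?nf3 t)) a x"
        by (rule fc_compose) (auto intro!: continuous_intros simp: a)
      also have "\<dots> = fc ?nf3 a x"
        by (rule fc_cong) (auto intro!: continuous_intros simp: a)
      also have "\<dots> = c * x"
        unfolding c_def by (rule fe_mult[symmetric]) (auto intro!: continuous_intros simp: a)
      finally show "v * c * x = 0 * x" by (simp add: mult.assoc)
    qed
    then have "st v * v * c = 0" by (simp add: mult.assoc)
    then show ?thesis using square_eq_zero_imp c by (simp add: vv pos_st)
  qed
  then have "n * n * n = 0" by (simp only: cnn)
  then have "(n * n) * (n * n) = 0" by (simp only: mult.assoc[of "n * n" n n, symmetric] mult_zero_left)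
  then have "n * n = 0" by (rule square_eq_zero_imp[rotated]) (auto simp: st_mult st_n)
  then have "n = 0" using square_eq_zero_imp st_n by blast
  then show ?thesis using a by (simp add: pos_def n_def a_def)
qed

lemma pos_mult_st: "pos (y * st y)"
  using pos_st_mult[of "st y"] by simp

section \<open>Square roots and the operator order\<close>

definition psqrt :: "'a \<Rightarrow> 'a" where
  "psqrt = fe (\<lambda>t. sqrt (max 0 t))"

lemma pos_psqrt: "pos h \<Longrightarrow> pos (psqrt h)"
  unfolding psqrt_def by (rule pos_fe) (auto intro!: continuous_intros simp: pos_st)

lemma st_psqrt: "pos h \<Longrightarrow> st (psqrt h) = psqrt h"
  by (simp add: pos_psqrt pos_st)

lemma psqrt_mult: "pos h \<Longrightarrow> psqrt h * psqrt h = h"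
  unfolding psqrt_def
  by (subst fe_times) (auto intro!: continuous_intros pos_fe_eqI simp: pos_st)

lemma pos_conj:
  assumes "pos a"
  shows "pos (st c * a * c)"
proof -
  have "st c * a * c = st (psqrt a * c) * (psqrt a * c)"
    using psqrt_mult[OF assms] by (simp add: st_mult st_psqrt assms) (metis mult.assoc)
  then show ?thesis by (simp add: pos_st_mult)
qed

lemma pos_conj': "pos a \<Longrightarrow> pos (c * a * st c)"
  using pos_conj[of a "st c"] by simp

lemma pos_antisym:
  assumes "pos h" "pos (- h)"
  shows "h = 0"
proof -
  have h: "st h = h" using assms pos_st by blast
  have "- h = fe (\<lambda>t. (-1) * t) h" by (subst fe_scale) (auto simp: h fe_id)
  then have "fe (\<lambda>t. max 0 (- t)) (- h) = fe (\<lambda>t. max 0 (- ((-1) * t))) h"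
    by (simp only:) (rule fe_compose; auto intro!: continuous_intros simp: h)
  then have "fe (max 0) h = 0" using assms(2) by (simp add: pos_def)
  then show ?thesis using pos_fe_max[OF assms(1)] by simp
qed

text \<open>Stands in for b \<le> M 1, which cannot be stated without a unit: the multiplier (M -
  b)^(1/2) applied to \<open>x\<close> exhibits the difference as a square.\<close>

lemma pos_norm_conj:
  assumes "pos b" "norm b \<le> M"
  shows "pos (M *\<^sub>R (st x * x) - st x * b * x)"
proof -
  let ?f = "\<lambda>t. sqrt (max 0 (M - t))"
  have b: "st b = b" using assms pos_st by blast
  have cf: "continuous_on UNIV ?f" by (intro continuous_intros)
  have "st (fc ?f b x) * fc ?f b x = st x * fc (\<lambda>t. ?f t * ?f t) b x"
    by (simp only: st_fc[OF b cf] fc_mult[OF b cf cf])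
  also have "fc (\<lambda>t. ?f t * ?f t) b x = fc (\<lambda>t. M - t) b x"
    by (rule pos_fc_cong) (use assms in \<open>auto intro!: continuous_intros\<close>)
  also have "\<dots> = M *\<^sub>R x - b * x" by (rule fc_const_minus_id[OF b])
  finally show ?thesis using pos_st_mult[of "fc ?f b x"] by (simp add: right_diff_distrib mult.assoc)
qed

text \<open>With \<open>M = norm b\<close> and \<open>g\<close> the part of \<open>a\<close> above
  \<open>M\<close>, one has g a g \<le> g b g \<le> M g^2, while g a g - M g^2 = g^3 is positive.
  Hence g^3 = 0, so \<open>g\<close> vanishes and \<open>a\<close> is unchanged by truncation at
  \<open>M\<close>.\<close>

lemma pos_norm_mono:
  assumes a: "pos a" and ba: "pos (b - a)"
  shows "norm a \<le> norm b"
proof -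
  have b: "pos b" using pos_add[OF a ba] by simp
  define M where "M = norm b"
  let ?g = "\<lambda>t. max 0 (t - M)"
  have M: "0 \<le> M" by (simp add: M_def)
  define g where "g = fe ?g a"
  have cg: "continuous_on UNIV ?g" "?g 0 = 0" using M by (auto intro!: continuous_intros)
  have sta: "st a = a" using a pos_st by blast
  have st_g: "st g = g" unfolding g_def by (rule st_fe[OF sta cg])
  have "pos ((g * (b - a) * g) + (M *\<^sub>R (g * g) - g * b * g))"
    using pos_conj[OF ba, of g] pos_norm_conj[OF b, of M g] by (intro pos_add) (auto simp: st_g M_def)
  moreover have "(g * (b - a) * g) + (M *\<^sub>R (g * g) - g * b * g) = M *\<^sub>R (g * g) - g * a * g"
    by (simp add: algebra_simps)
  moreover have ggg: "g * a * g - M *\<^sub>R (g * g) = fe (\<lambda>t. ?g t * ?g t * ?g t) a"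
  proof -
    have "g * a = fe (\<lambda>t. ?g t * t) a"
      unfolding g_def using fe_times[OF sta cg continuous_on_id refl] by (simp add: fe_id sta)
    then have "g * a * g = fe (\<lambda>t. ?g t * t * ?g t) a"
      unfolding g_def using fe_times[of a "\<lambda>t. ?g t * t" ?g, OF sta _ _ cg] 
      by (simp add: continuous_on_mult[OF cg(1) continuous_on_id])
    moreover have "M *\<^sub>R (g * g) = fe (\<lambda>t. M * (?g t * ?g t)) a"
      using fe_scale[OF sta continuous_on_mult[OF cg(1) cg(1)]] cg(2)
      by (simp add: g_def fe_times[OF sta cg cg])
    moreover have "fe (\<lambda>t. ?g t * t * ?g t - M * (?g t * ?g t)) a
      = fe (\<lambda>t. ?g t * t * ?g t) a - fe (\<lambda>t. M * (?g t * ?g t)) a"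
      by (rule fe_diff[OF sta]) (use M in \<open>auto intro!: continuous_intros\<close>)
    ultimately have "g * a * g - M *\<^sub>R (g * g) = fe (\<lambda>t. ?g t * t * ?g t - M * (?g t * ?g t)) a"
      by simp
    also have "\<dots> = fe (\<lambda>t. ?g t * ?g t * ?g t) a"
    proof (rule fe_cong)
      show "?g t * t * ?g t - M * (?g t * ?g t) = ?g t * ?g t * ?g t" for t
        by (auto simp: max_def algebra_simps)
    qed (use M in \<open>auto simp: sta intro!: continuous_intros\<close>)
    finally show ?thesis .
  qed
  ultimately have "pos (- fe (\<lambda>t. ?g t * ?g t * ?g t) a)"
    by (metis minus_diff_eq)
  moreover have "pos (fe (\<lambda>t. ?g t * ?g t * ?g t) a)"
    by (rule pos_fe) (use cg in \<open>auto simp: sta intro!: continuous_intros\<close>)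
  ultimately have "fe (\<lambda>t. ?g t * ?g t * ?g t) a = 0" by (intro pos_antisym)
  moreover have "fe (\<lambda>t. ?g t * ?g t * ?g t) a = g * g * g"
    unfolding g_def by (rule fe_times3[OF sta cg])
  ultimately have "g * g * g = 0" by (rule trans[OF sym, rotated])
  then have "(g * g) * (g * g) = 0" by (simp only: mult.assoc[of "g * g" g g, symmetric] mult_zero_left)
  then have "g * g = 0" by (rule square_eq_zero_imp[rotated]) (auto simp: st_mult st_g)
  then have "g = 0" using square_eq_zero_imp st_g by blast
  have "a = fe (\<lambda>t. min t M + ?g t) a"
    by (rule pos_fe_eqI[OF a, symmetric]) (use M in \<open>auto intro!: continuous_intros\<close>)
  also have "\<dots> = fe (\<lambda>t. min t M) a + g"
    unfolding g_def by (rule fe_add) (use M in \<open>auto intro!: continuous_intros simp: sta\<close>)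
  finally have "a = fe (\<lambda>t. min t M) a" using \<open>g = 0\<close> by simp
  moreover have "norm (fe (\<lambda>t. min t M) a) \<le> M"
    by (rule pos_norm_fe_le[OF a]) (use M in \<open>auto intro!: continuous_intros\<close>)
  ultimately show ?thesis by (simp add: M_def)
qed

section \<open>Cuntz comparison\<close>

definition cle :: "'a \<Rightarrow> 'a \<Rightarrow> bool" where
  "cle a b \<longleftrightarrow> (\<forall>e>0. \<exists>r. norm (a - r * b * st r) < e)"

definition cut :: "real \<Rightarrow> 'a \<Rightarrow> 'a" where
  "cut e = fe (\<lambda>t. max 0 (t - e))"

lemma cleI_limit:
  assumes "(\<lambda>n. r n * b * st (r n)) \<longlonglongrightarrow> a"
  shows "cle a b"
  unfolding cle_def
proof (intro allI impI)
  fix e :: real assume "0 < e"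
  then obtain n where "norm (r n * b * st (r n) - a) < e"
    using LIMSEQ_D[OF assms] by blast
  then show "\<exists>r. norm (a - r * b * st r) < e" by (metis norm_minus_commute)
qed

lemma norm_conj_le: "norm (r * b * st r) \<le> (norm r)\<^sup>2 * norm b"
proof -
  have "norm (r * b * st r) \<le> norm r * norm b * norm (st r)"
    by (intro order_trans[OF norm_mult_ineq] mult_right_mono norm_mult_ineq) auto
  then show ?thesis by (simp add: power2_eq_square mult_ac)
qed

lemma norm_conj_diff_le: "norm (r * b * st r - r * c * st r) \<le> (norm r)\<^sup>2 * norm (b - c)"
  using norm_conj_le[of r "b - c"] by (simp add: algebra_simps)

lemma cle_trans:
  assumes "cle a b" "cle b c"
  shows "cle a c"
  unfolding cle_def
proof (intro allI impI)
  fix e :: real assume e: "0 < e"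
  then obtain r where r: "norm (a - r * b * st r) < e / 2"
    using assms(1) half_gt_zero unfolding cle_def by blast
  have pos: "0 < (norm r)\<^sup>2 + 1" by (simp add: add_nonneg_pos)
  then have "0 < e / 2 / ((norm r)\<^sup>2 + 1)" using e by simp
  then obtain s where s: "norm (b - s * c * st s) < e / 2 / ((norm r)\<^sup>2 + 1)"
    using assms(2) unfolding cle_def by blast
  have "norm (r * b * st r - r * (s * c * st s) * st r) \<le> (norm r)\<^sup>2 * norm (b - s * c * st s)"
    by (rule norm_conj_diff_le)
  also have "\<dots> \<le> ((norm r)\<^sup>2 + 1) * norm (b - s * c * st s)" by (intro mult_right_mono) auto
  also have "\<dots> < e / 2" using s pos by (simp only: pos_less_divide_eq mult.commute)
  finally have "norm (a - r * (s * c * st s) * st r) < e"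
    using r norm_triangle_ineq[of "a - r * b * st r" "r * b * st r - r * (s * c * st s) * st r"]
    by simp
  then show "\<exists>r. norm (a - r * c * st r) < e"
    by (intro exI[of _ "r * s"]) (simp add: st_mult mult.assoc)
qed

lemma cle_conj: "cle (c * b * st c) b"
  by (auto simp: cle_def intro!: exI[of _ c])

text \<open>Formally the squared norm is that of k(M) N k(M), which is dominated by k(M) M k(M)
  because N \<le> M; the latter is a function of \<open>M\<close> alone.\<close>

lemma norm_fc_psqrt_le:
  assumes N: "pos N" and MN: "pos (M - N)" and k: "continuous_on UNIV k"
    and e: "\<And>t. 0 \<le> t \<Longrightarrow> t \<le> norm M \<Longrightarrow> k t * k t * t \<le> e"
  shows "(norm (fc k M (psqrt N)))\<^sup>2 \<le> e"
proof -
  have M: "pos M" using pos_add[OF N MN] by simp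
  then have st_M: "st M = M" by (rule pos_st)
  \<comment> \<open>\<open>T w\<close> is k(M) w k(M). The multiplier acts from the left only, so
    its right action is obtained by passing to adjoints and back.\<close>
  define T where "T w = fc k M (st (fc k M (st w)))" for w
  have T_sq: "T (c * c) = fc k M c * st (fc k M c)" if c: "st c = c" for c
  proof -
    have cc: "fc k M (c * c) = fc k M c * c" by (simp only: fc_mult_right[OF st_M k])
    have "T (c * c) = fc k M (c * st (fc k M c))"
      by (simp only: T_def st_mult c cc)
    also have "\<dots> = fc k M c * st (fc k M c)"
      by (simp only: fc_mult_right[OF st_M k])
    finally show ?thesis .
  qed
  have ck: "continuous_on UNIV (\<lambda>t. k t * t)" and ckk: "continuous_on UNIV (\<lambda>t. k t * (k t * t))"
    by (intro continuous_intros k)+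
  have "fc k M (fe (\<lambda>t. t) M) = fe (\<lambda>t. k t * t) M"
    by (rule fc_fe) (auto simp: st_M k)
  moreover have "fc k M (fe (\<lambda>t. k t * t) M) = fe (\<lambda>t. k t * (k t * t)) M"
    by (rule fc_fe) (auto simp: st_M k ck)
  ultimately have TM: "T M = fe (\<lambda>t. k t * (k t * t)) M"
    using st_fe[OF st_M ck] by (simp add: T_def st_M fe_id)
  have T_add: "T (x + y) = T x + T y" for x y
    by (simp add: T_def st_add fc_add_right st_M k)
  have "T M = T N + T (M - N)" using T_add[of N "M - N"] by simp
  moreover have "pos (T (M - N))" "pos (T N)" "T N = fc k M (psqrt N) * st (fc k M (psqrt N))"
    using T_sq[OF st_psqrt[OF MN]] T_sq[OF st_psqrt[OF N]] psqrt_mult[OF MN] psqrt_mult[OF N]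
    by (simp_all add: pos_mult_st)
  ultimately have "norm (fc k M (psqrt N) * st (fc k M (psqrt N))) \<le> norm (T M)"
    using pos_norm_mono[of "T N" "T M"] by simp
  also have "\<dots> \<le> e"
    unfolding TM
  proof (rule pos_norm_fe_le[OF M ckk])
    fix t assume t: "0 \<le> t" "t \<le> norm M"
    then have "\<bar>k t * (k t * t)\<bar> = k t * k t * t" by (simp add: mult.assoc[symmetric])
    then show "\<bar>k t * (k t * t)\<bar> \<le> e" using e[OF t] by simp
  qed simp
  finally show ?thesis by (simp add: norm_mult_st)
qed

lemma sqrt_reg_bound:
  fixes t e :: real
  assumes "0 \<le> t" "0 < e"
  shows "\<bar>sqrt t - t / sqrt (t + e)\<bar> \<le> sqrt e"
proof -
  have "sqrt t \<le> sqrt (t + e)" "0 < sqrt (t + e)" using assms by auto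
  then have "sqrt t * sqrt t \<le> sqrt t * sqrt (t + e)" using assms by (intro mult_left_mono) auto
  then have lo: "t / sqrt (t + e) \<le> sqrt t" using assms by (simp add: pos_divide_le_eq)
  have "(sqrt t - sqrt e) * sqrt (t + e) \<le> t"
  proof (cases "t \<le> e")
    case True
    then have "(sqrt t - sqrt e) * sqrt (t + e) \<le> 0" using assms by (intro mult_nonpos_nonneg) auto
    then show ?thesis using assms by linarith
  next
    case False
    have "sqrt (t + e) \<le> sqrt t + sqrt e" using assms by (intro sqrt_add_le_add_sqrt) auto
    then have "(sqrt t - sqrt e) * sqrt (t + e) \<le> (sqrt t - sqrt e) * (sqrt t + sqrt e)"
      using False assms by (intro mult_left_mono) auto
    also have "\<dots> = t - e" using assms by (simp add: algebra_simps)
    finally show ?thesis using assms by simp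
  qed
  then have "sqrt t - sqrt e \<le> t / sqrt (t + e)" using assms by (simp add: pos_le_divide_eq)
  then show ?thesis using lo by (simp add: abs_le_iff)
qed

text \<open>The polar decomposition of \<open>m\<close>, applied to the square root of \<open>N\<close>, makes sense in the algebra
  as a norm limit because \<open>N \<le> m\<^sup>* m\<close>.\<close>
lemma pos_le_st_mult_limit:
  assumes N: "pos N" and MN: "pos (st m * m - N)"
  shows "\<exists>r x. (\<lambda>n. m * r n) \<longlonglongrightarrow> x \<and> st x * x = N"
proof -
  define M where "M = st m * m"
  have M: "pos M" "st M = M" using pos_st_mult[of m] pos_st by (auto simp: M_def)
  have MN': "pos (M - N)" using MN by (simp add: M_def)
  define c where "c = psqrt N"
  have c: "st c = c" "c * c = N" using N by (auto simp: c_def st_psqrt psqrt_mult)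
  define \<epsilon> where "\<epsilon> n = inverse (real (Suc n))" for n
  have \<epsilon>: "0 < \<epsilon> n" for n by (simp add: \<epsilon>_def)
  have \<epsilon>_lim: "\<epsilon> \<longlonglongrightarrow> 0" unfolding \<epsilon>_def by (rule LIMSEQ_inverse_real_of_nat)
  \<comment> \<open>A regularized inverse square root: \<open>m * r n\<close> is m (M +
    \<epsilon>)^(-1/2) N^(1/2), which approximates the polar part of \<open>m\<close> applied to
    N^(1/2).\<close>
  define g where "g n t = 1 / sqrt (max 0 t + \<epsilon> n)" for n t
  have mt: "0 < max 0 t + \<epsilon> n" for n t using \<epsilon>[of n] by (simp add: add_nonneg_pos)
  then have mt': "max 0 t + \<epsilon> n \<noteq> 0" for n t using less_irrefl by metis
  have g: "continuous_on UNIV (g n)" for n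
    unfolding g_def by (intro continuous_intros ballI) (use mt' in auto)
  define r where "r n = fc (g n) M c" for n
  have st_prod: "st (m * fc f M c) * (m * fc f M c) = st c * fc (\<lambda>t. f t * (t * f t)) M c"
    if f: "continuous_on UNIV f" for f
  proof -
    have cf: "continuous_on UNIV (\<lambda>t. t * f t)" by (intro continuous_intros f)
    have "st (m * fc f M c) * (m * fc f M c) = st (fc f M c) * (M * fc f M c)"
      by (simp add: st_mult M_def mult.assoc)
    also have "M * fc f M c = fc (\<lambda>t. t * f t) M c"
      using fc_mult[OF M(2) continuous_on_id f] by (simp add: fc_id M)
    also have "st (fc f M c) * fc (\<lambda>t. t * f t) M c = st c * fc (\<lambda>t. f t * (t * f t)) M c"
      by (simp add: st_fc M f fc_mult cf)
    finally show ?thesis .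
  qed
  have st_prod2: "st c * fc (\<lambda>t. f t * f t) M c = st (fc f M c) * fc f M c"
    if f: "continuous_on UNIV f" for f
    by (simp add: st_fc M f fc_mult)
  have diff: "norm (m * r n - m * r k) \<le> sqrt (\<epsilon> n) + sqrt (\<epsilon> k)" for n k
  proof -
    let ?\<phi> = "\<lambda>t. g n t - g k t"
    \<comment> \<open>One factor t^(1/2) stems from \<open>st m * m = M\<close>; the estimate for N
      \<le> M supplies the second, so that the uniformly small function t (g n - g k)
      decides.\<close>
    let ?\<chi> = "\<lambda>t. sqrt (max 0 t) * ?\<phi> t"
    have \<phi>: "continuous_on UNIV ?\<phi>" and \<chi>: "continuous_on UNIV ?\<chi>"
      by (intro continuous_intros g)+
    have "m * r n - m * r k = m * fc ?\<phi> M c"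
      by (simp add: r_def fc_diff M g right_diff_distrib)
    moreover have "fc (\<lambda>t. ?\<phi> t * (t * ?\<phi> t)) M c = fc (\<lambda>t. ?\<chi> t * ?\<chi> t) M c"
      by (rule pos_fc_cong[OF M(1)]) (auto intro!: continuous_intros g)
    ultimately have "(norm (m * r n - m * r k))\<^sup>2 = (norm (fc ?\<chi> M c))\<^sup>2"
      by (simp flip: norm_st_mult add: st_prod[OF \<phi>] st_prod2[OF \<chi>])
    also have "\<dots> \<le> (sqrt (\<epsilon> n) + sqrt (\<epsilon> k))\<^sup>2"
      unfolding c_def
    proof (rule norm_fc_psqrt_le[OF N MN' \<chi>])
      fix t :: real assume t: "0 \<le> t"
      have "\<bar>t * ?\<phi> t\<bar> = \<bar>(sqrt t - t / sqrt (t + \<epsilon> k)) - (sqrt t - t / sqrt (t + \<epsilon> n))\<bar>"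
        using t by (simp add: g_def right_diff_distrib)
      also have "\<dots> \<le> sqrt (\<epsilon> n) + sqrt (\<epsilon> k)"
        using sqrt_reg_bound[OF t \<epsilon>, of k] sqrt_reg_bound[OF t \<epsilon>, of n] by linarith
      finally have "\<bar>t * ?\<phi> t\<bar>\<^sup>2 \<le> (sqrt (\<epsilon> n) + sqrt (\<epsilon> k))\<^sup>2" by (rule power_mono) simp
      moreover have "?\<chi> t * ?\<chi> t * t = \<bar>t * ?\<phi> t\<bar>\<^sup>2" using t by (simp add: power2_eq_square)
      ultimately show "?\<chi> t * ?\<chi> t * t \<le> (sqrt (\<epsilon> n) + sqrt (\<epsilon> k))\<^sup>2" by simp
    qed
    finally show ?thesis using \<epsilon>[of n] \<epsilon>[of k] by (simp add: power2_le_iff_abs_le)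
  qed
  have "Cauchy (\<lambda>n. m * r n)"
  proof (rule CauchyI)
    fix e :: real assume "0 < e"
    moreover have "(\<lambda>n. sqrt (\<epsilon> n)) \<longlonglongrightarrow> 0" using tendsto_real_sqrt[OF \<epsilon>_lim] by simp
    ultimately obtain K where K: "\<And>n. K \<le> n \<Longrightarrow> sqrt (\<epsilon> n) < e / 2"
      using LIMSEQ_D[of "\<lambda>n. sqrt (\<epsilon> n)" 0 "e / 2"] by (metis abs_le_D1 diff_zero half_gt_zero le_less_trans order.refl real_norm_def)
    show "\<exists>K. \<forall>n\<ge>K. \<forall>k\<ge>K. norm (m * r n - m * r k) < e"
    proof (intro exI[of _ K] allI impI)
      fix n k assume "K \<le> n" "K \<le> k"
      then show "norm (m * r n - m * r k) < e" using diff[of n k] K[of n] K[of k] by linarith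
    qed
  qed
  then obtain x where x: "(\<lambda>n. m * r n) \<longlonglongrightarrow> x" by (meson Cauchy_convergent convergent_def)
  have "(\<lambda>n. st (m * r n) * (m * r n)) \<longlonglongrightarrow> N"
  proof (rule LIM_zero_cancel, rule Lim_null_comparison[OF always_eventually \<epsilon>_lim], intro allI)
    fix n
    \<comment> \<open>The defect 1 - t/(t + \<epsilon>) equals \<epsilon>/(t + \<epsilon>). It is
      written as a square so that the same estimate applies, and the extra factor t brings it below
      \<epsilon>.\<close>
    let ?k = "\<lambda>t. sqrt (\<epsilon> n / (max 0 t + \<epsilon> n))"
    have k: "continuous_on UNIV ?k" by (intro continuous_intros ballI mt')
    have cg: "continuous_on UNIV (\<lambda>t. g n t * (t * g n t))" by (intro continuous_intros g)
    have "N - st (m * r n) * (m * r n) = st c * fc (\<lambda>t. 1 - g n t * (t * g n t)) M c"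
      unfolding r_def st_prod[OF g]
      by (simp add: fc_diff fc_const M cg c right_diff_distrib)
    also have "fc (\<lambda>t. 1 - g n t * (t * g n t)) M c = fc (\<lambda>t. ?k t * ?k t) M c"
    proof (rule pos_fc_cong[OF M(1)])
      show "1 - g n t * (t * g n t) = ?k t * ?k t" if "0 \<le> t" for t
        using that \<epsilon>[of n] by (simp add: g_def field_simps)
    qed (intro continuous_intros g ballI mt')+
    finally have "norm (st (m * r n) * (m * r n) - N) = (norm (fc ?k M c))\<^sup>2"
      by (simp only: st_prod2[OF k] norm_minus_commute[of _ N] norm_st_mult)
    also have "\<dots> \<le> \<epsilon> n"
      unfolding c_def
    proof (rule norm_fc_psqrt_le[OF N MN' k])
      show "?k t * ?k t * t \<le> \<epsilon> n" if "0 \<le> t" for t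
        using that \<epsilon>[of n] by (simp add: divide_simps)
    qed
    finally show "norm (st (m * r n) * (m * r n) - N) \<le> \<epsilon> n" .
  qed
  moreover have "(\<lambda>n. st (m * r n) * (m * r n)) \<longlonglongrightarrow> st x * x" by (intro tendsto_intros x)
  ultimately show ?thesis using x LIMSEQ_unique by blast
qed

text \<open>For \<open>m\<close> the square root of \<open>b\<close>, the preceding limit makes
  \<open>st (r n) * b * r n\<close> converge to \<open>st x * x = a\<close>.\<close>

lemma cle_mono:
  assumes "pos a" "pos (b - a)"
  shows "cle a b"
proof -
  have b: "pos b" using pos_add[OF assms] by simp
  define m where "m = psqrt b"
  have m: "st m * m = b" using b by (simp add: m_def st_psqrt psqrt_mult)
  then obtain r x where rx: "(\<lambda>n. m * r n) \<longlonglongrightarrow> x" "st x * x = a"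
    using pos_le_st_mult_limit[of a m] assms by auto
  have "(\<lambda>n. st (m * r n) * (m * r n)) \<longlonglongrightarrow> st x * x" by (intro tendsto_intros rx)
  moreover have "st (m * r n) * (m * r n) = st (r n) * b * st (st (r n))" for n
    by (simp add: st_mult mult.assoc flip: m)
  ultimately show ?thesis using rx by (intro cleI_limit[where r = "\<lambda>n. st (r n)"]) simp
qed

lemma cle_refl: "pos a \<Longrightarrow> cle a a"
  by (rule cle_mono) auto

lemma cle_scaleR:
  assumes b: "pos b" and c: "0 \<le> c"
  shows "cle (c *\<^sub>R b) b"
  unfolding cle_def
proof (intro allI impI)
  fix e :: real assume "0 < e"
  then have "0 < e / (c + 1)" using c by simp
  then obtain r where r: "norm (b - r * b * st r) < e / (c + 1)"
    using cle_refl[OF b] unfolding cle_def by blast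
  have "c *\<^sub>R b - (sqrt c *\<^sub>R r) * b * st (sqrt c *\<^sub>R r) = c *\<^sub>R (b - r * b * st r)"
    using c by (simp add: st_scaleR scaleR_right_diff_distrib)
  then have "norm (c *\<^sub>R b - (sqrt c *\<^sub>R r) * b * st (sqrt c *\<^sub>R r)) \<le> (c + 1) * norm (b - r * b * st r)"
    using c by (simp add: mult_right_mono)
  also have "\<dots> < e" using r c by (simp add: pos_less_divide_eq mult.commute)
  finally show "\<exists>r. norm (c *\<^sub>R b - r * b * st r) < e" by blast
qed

lemma cle_mono_scaleR:
  assumes "pos a" "pos b" "pos (c *\<^sub>R b - a)" "0 \<le> c"
  shows "cle a b"
  using cle_trans[OF cle_mono[OF assms(1,3)] cle_scaleR[OF assms(2,4)]] .

section \<open>Cut-downs and Roerdam's lemma\<close>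

lemma cont_cut: "continuous_on UNIV (\<lambda>t::real. max 0 (t - e))"
  by (intro continuous_intros)

lemma pos_cut: "pos a \<Longrightarrow> 0 \<le> e \<Longrightarrow> pos (cut e a)"
  unfolding cut_def by (rule pos_fe) (auto simp: pos_st cont_cut)

lemma norm_diff_cut_le:
  assumes "pos a" "0 \<le> e"
  shows "norm (a - cut e a) \<le> e"
proof -
  have "a - cut e a = fe (\<lambda>t. t - max 0 (t - e)) a"
    using fe_diff[OF pos_st[OF assms(1)] continuous_on_id _ cont_cut] assms
    by (simp add: fe_id pos_st cut_def)
  also have "norm \<dots> \<le> e"
    by (rule pos_norm_fe_le) (use assms in \<open>auto intro!: continuous_intros\<close>)
  finally show ?thesis .
qed

lemma cut_cut:
  assumes "pos a" "0 \<le> d" "0 \<le> e"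
  shows "cut e (cut d a) = cut (d + e) a"
proof -
  have "cut e (cut d a) = fe (\<lambda>t. max 0 (max 0 (t - d) - e)) a"
    unfolding cut_def by (rule fe_compose) (use assms in \<open>auto simp: pos_st cont_cut\<close>)
  also have "(\<lambda>t. max 0 (max 0 (t - d) - e)) = (\<lambda>t. max 0 (t - (d + e)))"
    using assms by (auto simp: fun_eq_iff max_def)
  finally show ?thesis by (simp add: cut_def)
qed

lemma pos_cut_diff_cut:
  assumes "pos a" "0 \<le> d" "d \<le> e"
  shows "pos (cut d a - cut e a)"
proof -
  have "cut d a - cut e a = fe (\<lambda>t. max 0 (t - d) - max 0 (t - e)) a"
    unfolding cut_def by (rule fe_diff[symmetric]) (use assms in \<open>auto simp: pos_st cont_cut\<close>)
  also have "pos \<dots>"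
    by (rule pos_fe) (use assms in \<open>auto simp: pos_st intro!: continuous_intros\<close>)
  finally show ?thesis .
qed

lemma cut_0: "pos a \<Longrightarrow> cut 0 a = a"
  unfolding cut_def by (rule pos_fe_eqI) (auto intro!: continuous_intros)

lemma cle_cut_mono: "pos a \<Longrightarrow> 0 \<le> d \<Longrightarrow> d \<le> e \<Longrightarrow> cle (cut e a) (cut d a)"
  by (intro cle_mono pos_cut pos_cut_diff_cut) auto

lemma cle_cut_self: "pos a \<Longrightarrow> 0 \<le> e \<Longrightarrow> cle (cut e a) a"
  using cle_cut_mono[of a 0 e] by (simp add: cut_0)

lemma cle_closure:
  assumes "\<And>e. 0 < e \<Longrightarrow> \<exists>c. norm (a - c) \<le> e \<and> cle c b"
  shows "cle a b"
  unfolding cle_def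
proof (intro allI impI)
  fix e :: real assume "0 < e"
  then have e: "0 < e / 2" by simp
  then obtain c where c: "norm (a - c) \<le> e / 2" "cle c b" using assms by blast
  then obtain r where "norm (c - r * b * st r) < e / 2" using e unfolding cle_def by blast
  then have "norm (a - r * b * st r) < e"
    using c norm_triangle_ineq[of "a - c" "c - r * b * st r"] by simp
  then show "\<exists>r. norm (a - r * b * st r) < e" by blast
qed

text \<open>From (t - 2e)^2 \<ge> 0 one gets t - e \<le> t^2 / (4e), so every cut-down of
  \<open>a\<close> lies below a multiple of \<open>a * a\<close>, and \<open>a\<close> is the norm
  limit of its cut-downs.\<close>

lemma cle_square:
  assumes a: "pos a"
  shows "cle a (a * a)"
proof (rule cle_closure)
  fix e :: real assume e: "0 < e"
  have sa: "st a = a" using a by (rule pos_st)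
  have "(1 / (4 * e)) *\<^sub>R (a * a) - cut e a = fe (\<lambda>t. (1 / (4 * e)) * (t * t) - max 0 (t - e)) a"
    unfolding cut_def fe_square[OF sa, symmetric]
    using fe_scale[OF sa continuous_on_mult[OF continuous_on_id continuous_on_id], of "1 / (4 * e)"] e
    by (subst fe_diff) (auto simp: sa intro!: continuous_intros)
  also have "pos \<dots>"
  proof (rule pos_fe[OF sa])
    show "0 \<le> (1 / (4 * e)) * (t * t) - max 0 (t - e)" for t
    proof -
      have "0 \<le> (t - 2 * e) * (t - 2 * e)" by simp
      then have "4 * e * (t - e) \<le> t * t" by (simp add: algebra_simps)
      then have "t - e \<le> t * t / (4 * e)" using e by (simp add: pos_le_divide_eq mult.commute)
      then show ?thesis using e by simp
    qed
  qed (use e in \<open>auto intro!: continuous_intros\<close>)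
  finally have "cle (cut e a) (a * a)"
    using e a by (intro cle_mono_scaleR[where c = "1 / (4 * e)"]) (auto simp: pos_cut pos_square sa)
  then show "\<exists>c. norm (a - c) \<le> e \<and> cle c (a * a)"
    using norm_diff_cut_le[OF a, of e] e by (intro exI[of _ "cut e a"]) auto
qed

text \<open>The square of \<open>st x * x\<close> is \<open>x * st x\<close> conjugated by
  \<open>st x\<close>, and a positive element is below its own square.\<close>

lemma cle_st_mult: "cle (st x * x) (x * st x)"
proof -
  have "cle (st x * x * (st x * x)) (x * st x)"
    using cle_conj[of "st x" "x * st x"] by (simp add: mult.assoc)
  then show ?thesis using cle_trans cle_square pos_st_mult by blast
qed

lemma cle_mult_st: "cle (x * st x) (st x * x)"
  using cle_st_mult[of "st x"] by simp

text \<open>Expresses D \<ge> - e without a unit, through the multiplier (e + D)^(1/2) applied to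
  \<open>x\<close>.\<close>

lemma pos_sa_norm_bound:
  assumes D: "st D = D" "norm D \<le> e"
  shows "pos (e *\<^sub>R (st x * x) + st x * D * x)"
proof -
  let ?f = "\<lambda>t. sqrt (max 0 (e + t))"
  have cf: "continuous_on UNIV ?f" by (intro continuous_intros)
  have "st (fc ?f D x) * fc ?f D x = st x * fc (\<lambda>t. ?f t * ?f t) D x"
    by (simp only: st_fc[OF D(1) cf] fc_mult[OF D(1) cf cf])
  also have "fc (\<lambda>t. ?f t * ?f t) D x = fc (\<lambda>t. e + t) D x"
    by (rule fc_cong) (use D in \<open>auto intro!: continuous_intros\<close>)
  also have "\<dots> = e *\<^sub>R x + D * x"
    using fc_add[OF D(1) continuous_on_const continuous_on_id] by (simp add: fc_const fc_id D)
  finally show ?thesis using pos_st_mult[of "fc ?f D x"] by (simp add: distrib_left mult.assoc)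
qed

text \<open>Formally b \<ge> b - p \<ge> a - e. Conjugation by the square root \<open>c\<close> of
  \<open>cut e a\<close> gives this a meaning without a unit, because c (a - e) c is the square of
  \<open>cut e a\<close>.\<close>

lemma cut_square_le_conj:
  assumes a: "pos a" and b: "pos b" and p: "pos p" and e: "norm (a - (b - p)) \<le> e"
  shows "\<exists>c. st c = c \<and> pos (c * b * c - cut e a * cut e a)"
proof -
  have sa: "st a = a" and e0: "0 \<le> e" using a order_trans[OF norm_ge_zero e] by (auto simp: pos_st)
  define c where "c = psqrt (cut e a)"
  have pc: "pos (cut e a)" using a e0 by (rule pos_cut)
  have c: "st c = c" "c * c = cut e a" using pc by (auto simp: c_def st_psqrt psqrt_mult)
  have cc: "c = fe (\<lambda>t. sqrt (max 0 (max 0 (t - e)))) a"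
    unfolding c_def psqrt_def cut_def
    by (rule fe_compose) (use e0 in \<open>auto simp: sa intro!: continuous_intros\<close>)
  define D where "D = (b - p) - a"
  have D: "st D = D" "norm D \<le> e"
    using a b p e by (auto simp: D_def st_diff pos_st norm_minus_commute)
  have "pos (st c * p * c + (e *\<^sub>R (st c * c) + st c * D * c))"
    by (intro pos_add pos_conj p pos_sa_norm_bound D)
  moreover have "st c * p * c + (e *\<^sub>R (st c * c) + st c * D * c)
    = c * b * c - (c * a * c - e *\<^sub>R (c * c))"
    by (simp add: c D_def algebra_simps)
  moreover have "c * a * c - e *\<^sub>R (c * c) = cut e a * cut e a"
  proof -
    let ?g = "\<lambda>t. sqrt (max 0 (max 0 (t - e)))"
    have g: "continuous_on UNIV ?g" "?g 0 = 0" using e0 by (auto intro!: continuous_intros)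
    have "c * a = fe (\<lambda>t. ?g t * t) a"
      using fe_times[OF sa g continuous_on_id] by (simp add: cc fe_id sa)
    then have "c * a * c = fe (\<lambda>t. ?g t * t * ?g t) a"
      using fe_times[OF sa continuous_on_mult[OF g(1) continuous_on_id] _ g] by (simp add: cc)
    then have "c * a * c - e *\<^sub>R cut e a = fe (\<lambda>t. ?g t * t * ?g t - e * max 0 (t - e)) a"
      unfolding cut_def using e0 fe_scale[OF sa cont_cut, of e e]
      by (subst fe_diff) (auto simp: sa intro!: continuous_intros)
    also have "\<dots> = fe (\<lambda>t. max 0 (t - e) * max 0 (t - e)) a"
    proof (rule fe_cong[OF sa])
      show "?g t * t * ?g t - e * max 0 (t - e) = max 0 (t - e) * max 0 (t - e)" for t
        by (simp add: max_def algebra_simps)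
    qed (use e0 in \<open>auto intro!: continuous_intros\<close>)
    also have "\<dots> = cut e a * cut e a"
      unfolding cut_def by (rule fe_times[symmetric]) (use e0 in \<open>auto simp: sa intro!: continuous_intros\<close>)
    finally show ?thesis by (simp add: c)
  qed
  ultimately show ?thesis using c(1) by auto
qed

text \<open>A form of Roerdam's lemma in which the majorant may be diminished by a positive defect \<open>p\<close>.\<close>
lemma cle_cut_of_norm_le:
  assumes "pos a" "pos b" "pos p" "norm (a - (b - p)) \<le> e"
  shows "cle (cut e a) b"
proof -
  have pc: "pos (cut e a)" using assms order_trans[OF norm_ge_zero assms(4)] by (intro pos_cut)
  obtain c where c: "st c = c" "pos (c * b * c - cut e a * cut e a)"
    using cut_square_le_conj[OF assms] by blast
  then have "cle (cut e a * cut e a) (c * b * c)"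
    using pc by (intro cle_mono pos_square) (auto simp: pos_st)
  moreover have "cle (c * b * c) b" using cle_conj[of c b] by (simp add: c)
  ultimately show ?thesis using cle_square[OF pc] cle_trans by blast
qed

lemma cle_cut_of_norm_le':
  assumes "pos a" "pos b" "norm (a - b) \<le> e"
  shows "cle (cut e a) b"
  using cle_cut_of_norm_le[OF assms(1,2) pos_zero] assms(3) by simp

text \<open>The approximation of \<open>a\<close> through \<open>b\<close> is strict, and what
  remains of \<open>d\<close> pays for replacing \<open>b\<close> by a cut-down; conjugation by
  \<open>r\<close> amplifies that change by at most the square of \<open>norm r\<close>.\<close>

lemma cle_imp_cut_approx:
  assumes b: "pos b" and ab: "cle a b" and d: "0 < d"
  shows "\<exists>e>0. \<exists>r. norm (a - r * cut e b * st r) \<le> d"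
proof -
  obtain r where r: "norm (a - r * b * st r) < d" using ab d unfolding cle_def by blast
  define e where "e = (d - norm (a - r * b * st r)) / ((norm r)\<^sup>2 + 1)"
  have pos: "0 < (norm r)\<^sup>2 + 1" by (simp add: add_nonneg_pos)
  have e: "0 < e" using r pos by (simp add: e_def)
  have "norm (r * b * st r - r * cut e b * st r) \<le> (norm r)\<^sup>2 * norm (b - cut e b)"
    by (rule norm_conj_diff_le)
  also have "\<dots> \<le> ((norm r)\<^sup>2 + 1) * e"
    using norm_diff_cut_le[OF b, of e] e by (intro mult_mono) auto
  also have "\<dots> = d - norm (a - r * b * st r)" using pos by (simp add: e_def)
  finally have "norm (a - r * cut e b * st r) \<le> d"
    using norm_triangle_ineq[of "a - r * b * st r" "r * b * st r - r * cut e b * st r"] by simp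
  then show ?thesis using e by blast
qed

lemma cle_imp_cut_cle:
  assumes a: "pos a" and b: "pos b" and ab: "cle a b" and d: "0 < d"
  shows "\<exists>e>0. cle (cut d a) (cut e b)"
proof -
  obtain e r where e: "0 < e" and r: "norm (a - r * cut e b * st r) \<le> d"
    using cle_imp_cut_approx[OF b ab d] by blast
  then have "cle (cut d a) (r * cut e b * st r)"
    by (intro cle_cut_of_norm_le' a pos_conj' pos_cut b) auto
  then show ?thesis using cle_trans cle_conj e by blast
qed

text \<open>Slack between the two cuts on the left buys a cut on the right. This converts
  comparisons that hold with some room into way-below relations.\<close>

lemma cle_cut_cut:
  assumes "pos a" "pos b" "0 \<le> d" "d < e" "cle (cut d a) b"
  shows "\<exists>f>0. cle (cut e a) (cut f b)"
  using cle_imp_cut_cle[OF pos_cut[OF assms(1,3)] assms(2,5), of "e - d"] assms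
  by (simp add: cut_cut)

end

section \<open>Orthogonal sums\<close>

text \<open>\<open>S1\<close> and \<open>S2\<close> are left multiplications by isometries with orthogonal ranges in the multiplier
  algebra; the last axiom expresses \<open>(s a s\<^sup>*)\<^sup>* = s a\<^sup>* s\<^sup>*\<close> without mentioning multipliers.\<close>
locale cstar_stable = cstar +
  fixes S1 S2 :: "'a \<Rightarrow> 'a"
  assumes S_add: "S1 (x + y) = S1 x + S1 y" "S2 (x + y) = S2 x + S2 y"
    and S_scaleR: "S1 (r *\<^sub>R x) = r *\<^sub>R S1 x" "S2 (r *\<^sub>R x) = r *\<^sub>R S2 x"
    and S_mult: "S1 (x * y) = S1 x * y" "S2 (x * y) = S2 x * y"
    and S_inner: "st (S1 x) * S1 y = st x * y" "st (S2 x) * S2 y = st x * y" "st (S1 x) * S2 y = 0"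
    and S_st: "st (S1 (st (S1 x))) = S1 (st (S1 (st x)))" "st (S2 (st (S2 x))) = S2 (st (S2 (st x)))"
begin

lemma S_inner': "st (S2 x) * S1 y = 0"
  using arg_cong[OF S_inner(3)[of y x], of st] by (simp add: st_mult)

lemma norm_S: "norm (S1 x) = norm x" "norm (S2 x) = norm x"
  by (simp_all add: norm_st_mult_self_eq[of "S1 x"] norm_st_mult_self_eq[of "S2 x"] S_inner norm_st_mult)

lemma bounded_linear_S: "bounded_linear S1" "bounded_linear S2"
  by (rule bounded_linear_intro[where K = 1]; simp add: S_add S_scaleR norm_S)+

text \<open>For isometries s1 and s2 behind \<open>S1\<close> and \<open>S2\<close>, and primes for
  adjoints, this is s1 a s1' + s2 b s2'; the right factors are applied through the
  involution.\<close>

definition dsm :: "'a \<Rightarrow> 'a \<Rightarrow> 'a" where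
  "dsm a b = S1 (st (S1 (st a))) + S2 (st (S2 (st b)))"

lemma S_factor: "S1 (st (S1 (st (a * b)))) = S1 a * st (S1 (st b))"
  "S2 (st (S2 (st (a * b)))) = S2 a * st (S2 (st b))"
  by (simp_all add: st_mult S_mult)

lemma dsm_mult_S: "dsm a b * S1 x = S1 (a * x)" "dsm a b * S2 x = S2 (b * x)"
  by (simp_all add: dsm_def distrib_right S_inner S_inner' flip: S_mult)
    (metis (no_types) S_add add_cancel_left_left)+

lemma dsm_mult: "dsm a b * dsm c d = dsm (a * c) (b * d)"
proof -
  have "dsm a b * dsm c d = dsm a b * S1 (st (S1 (st c))) + dsm a b * S2 (st (S2 (st d)))"
    by (simp only: dsm_def[of c d] distrib_left)
  also have "\<dots> = S1 (a * st (S1 (st c))) + S2 (b * st (S2 (st d)))"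
    by (simp only: dsm_mult_S)
  also have "\<dots> = dsm (a * c) (b * d)" by (simp only: dsm_def S_factor S_mult)
  finally show ?thesis .
qed

lemma st_dsm: "st (dsm a b) = dsm (st a) (st b)"
  using S_st[of "st a"] S_st[of "st b"] by (simp add: dsm_def st_add)

lemma S_diff: "S1 (x - y) = S1 x - S1 y" "S2 (x - y) = S2 x - S2 y"
  using S_add(1)[of "x - y" y] S_add(2)[of "x - y" y] by (simp_all add: algebra_simps)

lemma dsm_diff: "dsm a b - dsm c d = dsm (a - c) (b - d)"
  by (simp add: dsm_def st_diff S_diff)

lemma norm_dsm_le: "norm (dsm a b) \<le> norm a + norm b"
  unfolding dsm_def by (rule order_trans[OF norm_triangle_ineq]) (simp add: norm_S)

lemma pos_dsm: "pos a \<Longrightarrow> pos b \<Longrightarrow> pos (dsm a b)"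
proof -
  assume a: "pos a" and b: "pos b"
  have "dsm a b = st (dsm (psqrt a) (psqrt b)) * dsm (psqrt a) (psqrt b)"
    using a b by (simp add: st_dsm dsm_mult st_psqrt psqrt_mult)
  then show ?thesis by (simp add: pos_st_mult)
qed

lemma cle_dsm:
  assumes "cle a a'" "cle b b'"
  shows "cle (dsm a b) (dsm a' b')"
  unfolding cle_def
proof (intro allI impI)
  fix e :: real assume "0 < e"
  then have e: "0 < e / 2" by simp
  obtain r s where rs: "norm (a - r * a' * st r) < e / 2" "norm (b - s * b' * st s) < e / 2"
    using assms e unfolding cle_def by blast
  have "dsm a b - dsm r s * dsm a' b' * st (dsm r s) = dsm (a - r * a' * st r) (b - s * b' * st s)"
    by (simp add: st_dsm dsm_mult dsm_diff)
  then have "norm (dsm a b - dsm r s * dsm a' b' * st (dsm r s)) < e"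
    using norm_dsm_le[of "a - r * a' * st r" "b - s * b' * st s"] rs by simp
  then show "\<exists>r. norm (dsm a b - r * dsm a' b' * st r) < e" by blast
qed

lemma pos_sum_mult_st_le: "pos (2 *\<^sub>R (s * st s + t * st t) - (s + t) * st (s + t))"
proof -
  have "2 *\<^sub>R (s * st s + t * st t) - (s + t) * st (s + t) = (s - t) * st (s - t)"
    by (simp add: algebra_simps st_add st_diff scaleR_2)
  then show ?thesis by (simp add: pos_mult_st)
qed

text \<open>The column \<open>x\<close> satisfies \<open>st x * x = a + b\<close>, while
  \<open>x * st x\<close> is at most twice the orthogonal sum, since (s + t)(s + t)' \<le> 2 (s s' +
  t t') with primes for adjoints.\<close>

lemma cle_add_dsm:
  assumes a: "pos a" and b: "pos b"
  shows "cle (a + b) (dsm a b)"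
proof -
  define x where "x = S1 (psqrt a) + S2 (psqrt b)"
  have "st x * x = a + b"
    using a b by (simp add: x_def st_add distrib_left distrib_right S_inner S_inner' st_psqrt psqrt_mult)
  moreover have "S1 (psqrt a) * st (S1 (psqrt a)) + S2 (psqrt b) * st (S2 (psqrt b)) = dsm a b"
    using S_factor(1)[of "psqrt a" "psqrt a"] S_factor(2)[of "psqrt b" "psqrt b"] a b
    by (simp add: dsm_def st_psqrt psqrt_mult)
  then have "cle (x * st x) (dsm a b)"
    using pos_sum_mult_st_le[of "S1 (psqrt a)" "S2 (psqrt b)"]
    by (intro cle_mono_scaleR[where c = 2]) (auto simp: x_def pos_mult_st pos_dsm a b)
  ultimately show ?thesis using cle_st_mult[of x] cle_trans by simp
qed

text \<open>The row \<open>y\<close> with entries \<open>u\<close> and \<open>v\<close> has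
  \<open>y * st y = u * st u + v * st v\<close>, and the off-diagonal entries of
  \<open>st y * y\<close> contain \<open>st v * u\<close> or its adjoint. Here exact orthogonality
  is indispensable; a small error would survive in the corner.\<close>

lemma cle_dsm_add_orthogonal:
  assumes "st v * u = 0"
  shows "cle (dsm (st u * u) (st v * v)) (u * st u + v * st v)"
proof -
  define y where "y = st (S1 (st u)) + st (S2 (st v))"
  have vu: "st u * v = 0" using arg_cong[OF assms, of st] by (simp add: st_mult)
  have S0: "S1 0 = 0" "S2 0 = 0" using S_diff(1)[of 0 0] S_diff(2)[of 0 0] by simp_all
  have c: "S1 (st u) * st (S2 (st v)) = 0" "S2 (st v) * st (S1 (st u)) = 0"
  proof -
    have "S1 (st u) * st (S2 (st v)) = S1 (st (S2 (st v * u)))"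
      by (simp add: S_mult st_mult)
    then show "S1 (st u) * st (S2 (st v)) = 0" by (simp add: assms S0)
    have "S2 (st v) * st (S1 (st u)) = S2 (st (S1 (st u * v)))"
      by (simp add: S_mult st_mult)
    then show "S2 (st v) * st (S1 (st u)) = 0" by (simp add: vu S0)
  qed
  have "y * st y = u * st u + v * st v"
    by (simp add: y_def st_add distrib_left distrib_right S_inner S_inner')
  moreover have "st y * y = dsm (st u * u) (st v * v)"
    using c by (simp add: y_def st_add distrib_left distrib_right dsm_def S_factor)
  ultimately show ?thesis using cle_st_mult[of y] by simp
qed

text \<open>The function is (t - e)/t above \<open>e\<close> and 0 on [0, e]; the maximum in the
  denominator keeps it continuous. In the form of a multiplier applied to \<open>a\<close>, the
  cut-down is accessible to \<open>fc_intertwine\<close>.\<close>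

lemma cut_eq_fc:
  assumes a: "pos a" and e: "0 < e"
  shows "cut e a = fc (\<lambda>t. max 0 (t - e) / max t e) a a"
proof -
  have c: "continuous_on UNIV (\<lambda>t. max 0 (t - e) / max t e)"
    by (intro continuous_intros ballI) (use e in auto)
  have "fc (\<lambda>t. max 0 (t - e) / max t e) a (fe (\<lambda>t. t) a) = fe (\<lambda>t. max 0 (t - e) / max t e * t) a"
    by (rule fc_fe) (use a c in \<open>auto simp: pos_st\<close>)
  also have "\<dots> = cut e a"
    unfolding cut_def
  proof (rule pos_fe_cong[OF a continuous_on_mult[OF c continuous_on_id] _ cont_cut])
    show "max 0 (t - e) / max t e * t = max 0 (t - e)" for t
      using e by (auto simp: max_def)
  qed (use e in auto)
  finally show ?thesis using a by (simp add: fe_id pos_st)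
qed

text \<open>Each isometry intertwines its summand with the orthogonal sum, so the multiplier form of
  \<open>cut\<close> acts on the two summands separately.\<close>

lemma cut_dsm:
  assumes a: "pos a" and b: "pos b" and e: "0 < e"
  shows "cut e (dsm a b) = dsm (cut e a) (cut e b)"
proof -
  let ?\<phi> = "\<lambda>t. max 0 (t - e) / max t e"
  have c: "continuous_on UNIV ?\<phi>" "?\<phi> 0 = 0"
    using e by (auto intro!: continuous_intros)
  have d: "pos (dsm a b)" using a b by (rule pos_dsm)
  have fS: "fc ?\<phi> (dsm a b) (S1 x) = S1 (fc ?\<phi> a x)" "fc ?\<phi> (dsm a b) (S2 x) = S2 (fc ?\<phi> b x)" for x
    using fc_intertwine[OF pos_st[OF a] pos_st[OF d] c(1) bounded_linear_S(1), of x]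
      fc_intertwine[OF pos_st[OF b] pos_st[OF d] c(1) bounded_linear_S(2), of x]
    by (simp_all add: dsm_mult_S)
  have fcut: "fc ?\<phi> a (st (S1 a)) = st (S1 (cut e a))" "fc ?\<phi> b (st (S2 b)) = st (S2 (cut e b))"
  proof -
    have gen: "fc ?\<phi> x (st (S x)) = st (S (cut e x))"
      if x: "pos x" and S: "\<And>y z. S (y * z) = S y * z" for x S
    proof -
      have "fc ?\<phi> x (st (S x)) = st (S x * fe ?\<phi> x)"
        using x c by (simp add: fe_mult pos_st st_mult st_fe)
      also have "\<dots> = st (S (st (fe ?\<phi> x * x)))"
        using x c by (simp add: st_mult S st_fe pos_st)
      also have "fe ?\<phi> x * x = cut e x"
        using x c e by (simp add: cut_eq_fc fe_mult pos_st)
      finally show ?thesis using x e by (simp add: pos_st[OF pos_cut])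
    qed
    show "fc ?\<phi> a (st (S1 a)) = st (S1 (cut e a))" "fc ?\<phi> b (st (S2 b)) = st (S2 (cut e b))"
      using gen[OF a S_mult(1)] gen[OF b S_mult(2)] by blast+
  qed
  have "cut e (dsm a b) = fc ?\<phi> (dsm a b) (S1 (st (S1 a)) + S2 (st (S2 b)))"
    using d e a b by (simp add: cut_eq_fc dsm_def pos_st)
  also have "\<dots> = S1 (st (S1 (cut e a))) + S2 (st (S2 (cut e b)))"
    by (simp add: fc_add_right pos_st[OF d] c fS fcut)
  finally show ?thesis using a b e by (simp add: dsm_def pos_st[OF pos_cut])
qed

end

section \<open>Upper bounds of increasing sequences\<close>

context cstar
begin

text \<open>The criterion of \<open>posI_norm\<close>, with one radius for the whole bounded
  sequence, passes to limits.\<close>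

lemma pos_limit:
  assumes f: "\<And>n. pos (f n)" and l: "f \<longlonglongrightarrow> l"
  shows "pos l"
proof -
  obtain R where R: "0 < R" "\<And>n. norm (f n) \<le> R"
    using convergent_imp_Bseq[of f] l by (auto simp: convergent_def Bseq_def)
  show ?thesis
  proof (rule posI_norm[OF _ _ R(1)])
    have "(\<lambda>n. st (f n)) \<longlonglongrightarrow> st l" by (intro tendsto_intros l)
    then show "st l = l" using l LIMSEQ_unique by (simp add: pos_st[OF f])
    fix x
    have "(\<lambda>n. R *\<^sub>R x - f n * x) \<longlonglongrightarrow> R *\<^sub>R x - l * x" by (intro tendsto_intros l)
    then show "norm (R *\<^sub>R x - l * x) \<le> R * norm x"
      by (rule Lim_norm_ubound[OF sequentially_bot])
        (intro always_eventually allI pos_norm_diff_le f R)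
  qed
qed

text \<open>\<open>w\<close> lives under the spectral projection of \<open>y\<close> for \<open>[d, \<infinity>)\<close>.\<close>
definition supp :: "real \<Rightarrow> 'a \<Rightarrow> 'a \<Rightarrow> bool" where
  "supp d y w \<longleftrightarrow> (\<forall>f. continuous_on UNIV f \<longrightarrow> (\<forall>s\<ge>d. f s = 1) \<longrightarrow> fc f y w = w)"

lemma supp_antimono: "supp d y w \<Longrightarrow> d' \<le> d \<Longrightarrow> supp d' y w"
  unfolding supp_def by (meson order_trans)

lemma supp_mult_right: "supp d y w \<Longrightarrow> st y = y \<Longrightarrow> supp d y (w * z)"
  unfolding supp_def by (metis fc_mult_right)

lemma supp_limit:
  assumes y: "st y = y" and w: "\<And>n. supp d y (w n)" and l: "w \<longlonglongrightarrow> l"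
  shows "supp d y l"
  unfolding supp_def
proof (intro allI impI)
  fix f assume f: "continuous_on UNIV f" "\<forall>s\<ge>d. f s = (1::real)"
  obtain C where C: "\<And>s. \<bar>s\<bar> \<le> norm y \<Longrightarrow> \<bar>f s\<bar> \<le> C"
  proof -
    have "compact (f ` {-norm y..norm y})"
      using f(1) by (intro compact_continuous_image) (auto intro: continuous_on_subset)
    then obtain C where "\<forall>z\<in>f ` {-norm y..norm y}. norm z \<le> C"
      using compact_imp_bounded bounded_iff by metis
    then show ?thesis using that[of C] by (auto simp: abs_le_iff)
  qed
  have "bounded_linear (fc f y)"
  proof (rule bounded_linear_intro)
    show "norm (fc f y x) \<le> norm x * C" for x
      using norm_fc_le[OF y f(1) C, of x] by (simp add: mult.commute)
  qed (simp_all add: fc_add_right fc_scaleR_right y f)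
  from bounded_linear.tendsto[OF this l] have "(\<lambda>n. fc f y (w n)) \<longlonglongrightarrow> fc f y l" .
  moreover have "fc f y (w n) = w n" for n using w f unfolding supp_def by blast
  ultimately show "fc f y l = l" using l LIMSEQ_unique by simp
qed

lemma supp_psqrt_cut:
  assumes y: "pos y" and d: "0 \<le> d"
  shows "supp d y (psqrt (cut d y))"
  unfolding supp_def
proof (intro allI impI)
  fix f assume f: "continuous_on UNIV f" "\<forall>s\<ge>d. f s = (1::real)"
  let ?g = "\<lambda>t. sqrt (max 0 (max 0 (t - d)))"
  have g: "continuous_on UNIV ?g" "?g 0 = 0" using d by (auto intro!: continuous_intros)
  have eq: "psqrt (cut d y) = fe ?g y"
    unfolding psqrt_def cut_def
    by (rule fe_compose) (use d y in \<open>auto simp: pos_st intro!: continuous_intros\<close>)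
  have "fc f y (fe ?g y) = fe (\<lambda>t. f t * ?g t) y"
    by (rule fc_fe[OF pos_st[OF y] f(1) g])
  also have "\<dots> = fe ?g y"
  proof (rule pos_fe_cong[OF y continuous_on_mult[OF f(1) g(1)] _ g])
    show "f t * ?g t = ?g t" for t using f(2) by (cases "d \<le> t") auto
  qed (use g(2) in simp)
  finally show "fc f y (psqrt (cut d y)) = psqrt (cut d y)" by (simp add: eq)
qed

text \<open>The function min(1, t/d) is 1 on [d, \<infinity>), so its value \<open>F\<close> at
  \<open>y\<close> fixes \<open>Q\<close> from both sides and Q = F Q F \<le> norm Q F^2. On the
  other hand F^2 \<le> y/d.\<close>

lemma pos_supp_le:
  assumes y: "pos y" and d: "0 < d" and Q: "pos Q" "supp d y Q"
  shows "pos ((norm Q / d) *\<^sub>R y - Q)"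
proof -
  let ?f = "\<lambda>t. min 1 (max 0 t / d)"
  have f: "continuous_on UNIV ?f" "?f 0 = 0" using d by (auto intro!: continuous_intros)
  define F where "F = fe ?f y"
  have sy: "st y = y" using y by (rule pos_st)
  have F: "st F = F" unfolding F_def by (rule st_fe[OF sy f])
  have "fc ?f y Q = Q" using Q(2) f(1) d unfolding supp_def by simp
  then have "F * Q = Q" by (simp add: F_def fe_mult sy f)
  moreover have "Q * F = Q" using arg_cong[OF \<open>F * Q = Q\<close>, of st] by (simp add: st_mult F pos_st Q)
  ultimately have "pos (norm Q *\<^sub>R (F * F) - Q)"
    using pos_norm_conj[OF Q(1) order.refl, of F] by (simp add: F)
  moreover have "pos ((norm Q / d) *\<^sub>R y - norm Q *\<^sub>R (F * F))"
  proof -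
    have ff: "continuous_on UNIV (\<lambda>t. ?f t * ?f t)" by (intro continuous_on_mult f)
    have "(norm Q / d) *\<^sub>R y - norm Q *\<^sub>R (F * F) = fe (\<lambda>t. norm Q / d * t) y - fe (\<lambda>t. norm Q * (?f t * ?f t)) y"
      using fe_scale[OF sy continuous_on_id, of "norm Q / d"] fe_scale[OF sy ff, of "norm Q"]
      by (simp add: F_def fe_times sy f fe_id)
    also have "\<dots> = fe (\<lambda>t. norm Q / d * t - norm Q * (?f t * ?f t)) y"
      by (rule fe_diff[symmetric]) (use d f(2) in \<open>auto simp: sy intro!: continuous_on_mult continuous_on_const continuous_on_divide f ff continuous_on_id\<close>)
    also have "pos \<dots>"
    proof (rule pos_fe_pos[OF y])
      show "0 \<le> norm Q / d * t - norm Q * (?f t * ?f t)" if "0 \<le> t" for t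
      proof -
        have "?f t * ?f t \<le> ?f t * 1" using d that by (intro mult_left_mono) auto
        also have "\<dots> \<le> t / d" using that by simp
        finally have "norm Q * (?f t * ?f t) \<le> norm Q * (t / d)" by (intro mult_left_mono) auto
        then show ?thesis by simp
      qed
    qed (use d f(2) in \<open>auto intro!: continuous_on_mult continuous_on_const continuous_on_divide continuous_on_diff f ff continuous_on_id\<close>)
    finally show ?thesis .
  qed
  ultimately show ?thesis using pos_add by fastforce
qed

text \<open>\<open>t\<close> is close to a partial isometry moving almost all of \<open>y\<close> into a part of \<open>y'\<close> that is cut
  off away from \<open>0\<close>.\<close>
lemma cle_transport:
  assumes y: "pos y" and y': "pos y'" and le: "cle y y'" and d: "0 < d"
  shows "\<exists>t \<delta>. 0 < \<delta> \<and> supp \<delta> y' t \<and> norm t \<le> 1 \<and> cle (cut d y) (st t * t) \<and>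
    (\<forall>w. supp d y w \<longrightarrow> st t * t * w = w)"
proof -
  have sy: "st y = y" and sy': "st y' = y'" using y y' pos_st by auto
  obtain \<delta> r where \<delta>: "0 < \<delta>" and r: "norm (y - r * cut \<delta> y' * st r) \<le> d / 2"
    using cle_imp_cut_approx[OF y' le, of "d / 2"] d by auto
  define b where "b = psqrt (cut \<delta> y')"
  have pc: "pos (cut \<delta> y')" using \<delta> by (intro pos_cut y') simp
  have b: "st b = b" "b * b = cut \<delta> y'" using pc by (auto simp: b_def st_psqrt psqrt_mult)
  define q where "q = cut (d / 2) y"
  have q: "pos q" "st q = q" using pos_cut[OF y, of "d / 2"] d pos_st by (auto simp: q_def)
  obtain c where c: "st c = c" "pos (c * (r * cut \<delta> y' * st r) * c - q * q)"
    using cut_square_le_conj[OF y pos_conj'[OF pc] pos_zero, of r "d / 2"] r by (auto simp: q_def)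
  define m where "m = b * st r * c"
  have "st m * m = c * (r * cut \<delta> y' * st r) * c"
    by (simp add: m_def st_mult b c mult.assoc flip: b(2))
  then obtain \<rho> x where x: "(\<lambda>n. m * \<rho> n) \<longlonglongrightarrow> x" "st x * x = q * q"
    using pos_le_st_mult_limit[of "q * q" m] c q pos_square by auto
  have "supp \<delta> y' (m * \<rho> n)" for n
    unfolding m_def b_def using \<delta> by (intro supp_mult_right sy' supp_psqrt_cut y') simp
  then have sx: "supp \<delta> y' x" using supp_limit[OF sy' _ x(1)] by blast
  let ?q = "\<lambda>s. max 0 (s - d / 2)"
  \<comment> \<open>\<open>\<eta>\<close> is 1/?q wherever ?q \<ge> d/2, that is on [d,
    \<infinity>); below, the maximum keeps the denominator away from 0. As
    \<open>st x * x = q * q\<close>, the product \<open>x * fe \<eta> y\<close> is isometric on what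
    lives under [d, \<infinity>).\<close>
  define \<eta> where "\<eta> s = ?q s / (max (?q s) (d / 2) * max (?q s) (d / 2))" for s
  have nz: "max a (d / 2) * max a (d / 2) \<noteq> 0" for a using d by auto
  have \<eta>: "continuous_on UNIV \<eta>" "\<eta> 0 = 0"
    unfolding \<eta>_def using d nz by (auto intro!: continuous_intros)
  have cq: "continuous_on UNIV ?q" "?q 0 = 0" using d by (auto intro!: continuous_intros)
  define \<kappa> where "\<kappa> s = (\<eta> s * ?q s) * (?q s * \<eta> s)" for s
  have \<eta>q: "0 \<le> \<eta> s * ?q s" "\<eta> s * ?q s \<le> 1" for s
  proof -
    show "0 \<le> \<eta> s * ?q s" by (simp add: \<eta>_def)
    have "?q s * ?q s \<le> max (?q s) (d / 2) * max (?q s) (d / 2)" by (intro mult_mono) auto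
    then show "\<eta> s * ?q s \<le> 1"
      using d by (simp add: \<eta>_def divide_le_eq_1 zero_less_mult_iff less_max_iff_disj)
  qed
  have c\<eta>q: "continuous_on UNIV (\<lambda>s. \<eta> s * ?q s)" and cq\<eta>: "continuous_on UNIV (\<lambda>s. ?q s * \<eta> s)"
    by (intro continuous_on_mult \<eta> cq)+
  have c\<kappa>: "continuous_on UNIV \<kappa>" "\<kappa> 0 = 0"
    unfolding \<kappa>_def using \<eta>(2) by (auto intro!: continuous_on_mult c\<eta>q cq\<eta>)
  have \<kappa>1: "\<kappa> s = 1" if "d \<le> s" for s
    using that d by (simp add: \<kappa>_def \<eta>_def max_absorb1)
  have \<kappa>01: "0 \<le> \<kappa> s" "\<kappa> s \<le> 1" for s
  proof -
    have "\<kappa> s = (\<eta> s * ?q s) * (\<eta> s * ?q s)" by (simp add: \<kappa>_def mult.commute)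
    then show "0 \<le> \<kappa> s" "\<kappa> s \<le> 1" using \<eta>q[of s] mult_le_one[of "\<eta> s * ?q s" "\<eta> s * ?q s"] by simp_all
  qed
  define t where "t = x * fe \<eta> y"
  have "st t * t = fe \<eta> y * (q * q) * fe \<eta> y"
    using x(2) by (simp add: t_def st_mult st_fe sy \<eta>) (metis mult.assoc)
  also have "\<dots> = (fe \<eta> y * q) * (q * fe \<eta> y)" by (simp add: mult.assoc)
  also have "\<dots> = fe \<kappa> y"
    unfolding q_def cut_def \<kappa>_def
    using \<eta> cq by (simp add: fe_times[OF sy \<eta> cq] fe_times[OF sy cq \<eta>] fe_times[OF sy c\<eta>q _ cq\<eta>])
  finally have tt: "st t * t = fe \<kappa> y" .
  have "(norm t)\<^sup>2 \<le> 1"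
    unfolding norm_st_mult[symmetric] tt
    by (rule norm_fe_le[OF sy c\<kappa>]) (use \<kappa>01 in \<open>simp add: abs_le_iff order_trans[OF _ \<kappa>01(1)]\<close>)
  then have "norm t \<le> 1" by (simp add: power_le_one_iff)
  moreover have "supp \<delta> y' t" unfolding t_def by (intro supp_mult_right sx sy')
  moreover have "st t * t * w = w" if "supp d y w" for w
    using that c\<kappa> \<kappa>1 unfolding tt by (simp add: fe_mult sy supp_def)
  moreover have "cle (cut d y) (st t * t)"
  proof (rule cle_mono_scaleR[where c = "norm y"])
    have "norm y *\<^sub>R (st t * t) - cut d y = fe (\<lambda>s. norm y * \<kappa> s) y - fe (\<lambda>s. max 0 (s - d)) y"
      by (simp add: tt fe_scale[OF sy c\<kappa>] cut_def)
    also have "\<dots> = fe (\<lambda>s. norm y * \<kappa> s - max 0 (s - d)) y"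
      by (rule fe_diff[symmetric]) (use d c\<kappa> in \<open>auto simp: sy cont_cut intro!: continuous_on_mult\<close>)
    also have "pos \<dots>"
    proof (rule pos_fe_pos[OF y])
      show "0 \<le> norm y * \<kappa> s - max 0 (s - d)" if "0 \<le> s" "s \<le> norm y" for s
        using that d \<kappa>1[of s] \<kappa>01[of s] by (cases "d \<le> s") auto
    qed (use d c\<kappa> in \<open>auto intro!: continuous_on_mult continuous_on_diff cont_cut\<close>)
    finally show "pos (norm y *\<^sub>R (st t * t) - cut d y)" .
  qed (use d y in \<open>auto simp: pos_st_mult pos_cut\<close>)
  ultimately show ?thesis using \<delta> by blast
qed

section \<open>Compatible transports along an increasing sequence\<close>

lemma cle_chain:
  assumes "\<And>n. pos (ys n)" "\<And>n. cle (ys n) (ys (Suc n))" "k \<le> n"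
  shows "cle (ys k) (ys n)"
  using assms(3)
proof (induction n rule: dec_induct)
  case base
  then show ?case using assms(1) by (rule cle_refl)
next
  case (step n)
  then show ?case using assms(2) cle_trans by blast
qed

lemma transport_sequence:
  assumes pos: "\<And>n. pos (ys n)" and le: "\<And>n. cle (ys n) (ys (Suc n))"
  obtains \<delta> t where "\<And>n. 0 < \<delta> n" "\<And>n. supp (\<delta> n) (ys (Suc n)) (t n)" "\<And>n. norm (t n) \<le> 1"
    "\<And>n. st (t (Suc n)) * t (Suc n) * t n = t n"
    "\<And>k n. k \<le> n \<Longrightarrow> cle (cut (inverse (Suc n)) (ys k)) (st (t n) * t n)"
proof -
  \<comment> \<open>A single level \<open>\<rho> n\<close> at stage \<open>n\<close> must capture
    all earlier \<open>ys k\<close> up to precision 1/(n+1); otherwise the bound built from the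
    transports would not dominate every \<open>ys k\<close>.\<close>
  have "\<exists>\<rho>>0. \<forall>k\<le>n. cle (cut (inverse (Suc n)) (ys k)) (cut \<rho> (ys n))" for n
  proof -
    have "\<exists>e>0. cle (cut (inverse (Suc n)) (ys k)) (cut e (ys n))" if "k \<le> n" for k
      by (rule cle_imp_cut_cle[OF pos pos cle_chain[of ys, OF pos le that]]) simp
    then obtain e where e: "\<And>k. k \<le> n \<Longrightarrow> 0 < e k"
      "\<And>k. k \<le> n \<Longrightarrow> cle (cut (inverse (Suc n)) (ys k)) (cut (e k) (ys n))" by metis
    define \<rho> where "\<rho> = Min (e ` {..n})"
    have "0 < \<rho>" using e(1) by (simp add: \<rho>_def)
    moreover have "cle (cut (inverse (Suc n)) (ys k)) (cut \<rho> (ys n))" if "k \<le> n" for k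
    proof -
      have "\<rho> \<le> e k" using that by (simp add: \<rho>_def)
      then have "cle (cut (e k) (ys n)) (cut \<rho> (ys n))" using \<open>0 < \<rho>\<close> by (intro cle_cut_mono pos) auto
      then show ?thesis using e(2)[OF that] cle_trans by blast
    qed
    ultimately show ?thesis by blast
  qed
  then obtain \<rho> where \<rho>: "\<And>n. 0 < \<rho> n"
    "\<And>n k. k \<le> n \<Longrightarrow> cle (cut (inverse (Suc n)) (ys k)) (cut (\<rho> n) (ys n))" by metis
  let ?P = "\<lambda>n (t, \<delta>). 0 < \<delta> \<and> supp \<delta> (ys (Suc n)) t \<and> norm t \<le> 1 \<and> cle (cut (\<rho> n) (ys n)) (st t * t)"
  have "\<exists>f. \<forall>n. ?P n (f n) \<and> st (fst (f (Suc n))) * fst (f (Suc n)) * fst (f n) = fst (f n)"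
  proof (rule dependent_nat_choice)
    show "\<exists>p. ?P 0 p" using cle_transport[OF pos[of 0] pos[of "Suc 0"] le[of 0] \<rho>(1)[of 0]] by auto
    fix p n assume P: "?P n p"
    obtain t \<delta> where p: "p = (t, \<delta>)" by (cases p)
    \<comment> \<open>Two demands meet: d \<le> \<delta> makes the next transport isometric on the
      range of the present one, and d \<le> \<rho> (Suc n) makes it capture the required
      cut-down.\<close>
    define d where "d = min \<delta> (\<rho> (Suc n))"
    have d: "0 < d" "d \<le> \<delta>" "d \<le> \<rho> (Suc n)" using P \<rho>(1) by (auto simp: d_def p)
    obtain t' \<delta>' where t': "0 < \<delta>'" "supp \<delta>' (ys (Suc (Suc n))) t'" "norm t' \<le> 1"
      "cle (cut d (ys (Suc n))) (st t' * t')" "\<And>w. supp d (ys (Suc n)) w \<Longrightarrow> st t' * t' * w = w"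
      using cle_transport[OF pos pos le d(1), of "Suc n"] by blast
    have "cle (cut (\<rho> (Suc n)) (ys (Suc n))) (st t' * t')"
      using t'(4) cle_cut_mono[OF pos _ d(3)] d(1) cle_trans less_imp_le by blast
    moreover have "st t' * t' * t = t"
      using P d(2) by (intro t'(5)) (auto simp: p intro: supp_antimono)
    ultimately show "\<exists>p'. ?P (Suc n) p' \<and> st (fst p') * fst p' * fst p = fst p"
      using t' by (intro exI[of _ "(t', \<delta>')"]) (simp add: p)
  qed
  then obtain f where f: "\<And>n. ?P n (f n)"
    "\<And>n. st (fst (f (Suc n))) * fst (f (Suc n)) * fst (f n) = fst (f n)"
    unfolding all_conj_distrib by (elim exE conjE) blast
  show thesis
  proof (rule that[of "\<lambda>n. snd (f n)" "\<lambda>n. fst (f n)"])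
    fix k n :: nat assume "k \<le> n"
    then show "cle (cut (inverse (Suc n)) (ys k)) (st (fst (f n)) * fst (f n))"
      using cle_trans[OF \<rho>(2)] f(1)[of n] by (simp only: case_prod_beta)
  qed (use f in \<open>auto simp: case_prod_beta\<close>)
qed

lemma pos_suminf:
  assumes f: "\<And>n. pos (f n)" and "summable f"
  shows "pos (suminf f - f k)"
proof (rule pos_limit)
  have "(\<lambda>n. sum f {..<n + Suc k}) \<longlonglongrightarrow> suminf f"
    using summable_LIMSEQ[OF assms(2)] by (rule LIMSEQ_ignore_initial_segment)
  then show "(\<lambda>n. sum f {..<n + Suc k} - f k) \<longlonglongrightarrow> suminf f - f k"
    by (intro tendsto_intros)
  show "pos (sum f {..<n + Suc k} - f k)" for n
  proof -
    have "sum f {..<n + Suc k} = f k + sum f ({..<n + Suc k} - {k})"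
      by (rule sum.remove) auto
    then show ?thesis using pos_sum[of "{..<n + Suc k} - {k}" f] f by simp
  qed
qed

end

section \<open>Nested isometries and the upper bound\<close>

context cstar_stable
begin

text \<open>Left multiplication by s2^n s1: two isometries with orthogonal ranges generate
  infinitely many.\<close>

primrec tow :: "nat \<Rightarrow> 'a \<Rightarrow> 'a" where
  "tow 0 x = S1 x"
| "tow (Suc n) x = S2 (tow n x)"

lemma tow_inner: "st (tow m x) * tow n y = (if m = n then st x * y else 0)"
proof (induction m arbitrary: n)
  case 0
  then show ?case by (cases n) (simp_all add: S_inner)
next
  case (Suc m)
  then show ?case by (cases n) (simp_all add: S_inner S_inner')
qed

lemma tow_add: "tow n (x + y) = tow n x + tow n y"
  and tow_scaleR: "tow n (r *\<^sub>R x) = r *\<^sub>R tow n x"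
  and tow_mult: "tow n (x * y) = tow n x * y"
  by (induction n) (simp_all add: S_add S_scaleR S_mult)

lemma tow_0: "tow n 0 = 0"
  using tow_scaleR[of n 0 0] by simp

text \<open>\<open>V n\<close> are isometries with values in the first \<open>n + 1\<close> orthogonal copies;
  \<open>V (n + 1)\<close> extends \<open>V n\<close> transported along \<open>t n\<close> and puts the defect of \<open>t n\<close> into the next copy.\<close>
primrec V :: "(nat \<Rightarrow> 'a) \<Rightarrow> nat \<Rightarrow> 'a \<Rightarrow> 'a" where
  "V t 0 x = tow 0 x"
| "V t (Suc n) x = V t n (st (t n) * x) + tow (Suc n) (fc (\<lambda>s. sqrt (max 0 (1 - s))) (t n * st (t n)) x)"

lemma cont_defect: "continuous_on UNIV (\<lambda>s::real. sqrt (max 0 (1 - s)))"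
  by (intro continuous_intros)

lemma st_defect_mult:
  assumes "norm t \<le> 1"
  defines "\<sigma> \<equiv> fc (\<lambda>s. sqrt (max 0 (1 - s))) (t * st t)"
  shows "st (\<sigma> x) * \<sigma> y = st x * (y - t * st t * y)"
proof -
  let ?f = "\<lambda>s::real. sqrt (max 0 (1 - s))"
  have p: "pos (t * st t)" "st (t * st t) = t * st t" by (simp_all add: pos_mult_st st_mult)
  have n: "norm (t * st t) \<le> 1" using assms(1) by (simp add: norm_mult_st power_le_one)
  have "st (\<sigma> x) * \<sigma> y = st x * fc (\<lambda>s. ?f s * ?f s) (t * st t) y"
    by (simp only: \<sigma>_def st_fc[OF p(2) cont_defect] fc_mult[OF p(2) cont_defect cont_defect])
  also have "fc (\<lambda>s. ?f s * ?f s) (t * st t) y = fc (\<lambda>s. 1 - s) (t * st t) y"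
    by (rule pos_fc_cong[OF p(1)]) (use n in \<open>auto intro!: continuous_intros\<close>)
  also have "\<dots> = y - t * st t * y" using fc_const_minus_id[OF p(2), of 1 y] by simp
  finally show ?thesis .
qed

lemma V_linear: "V t n (x + y) = V t n x + V t n y" "V t n (r *\<^sub>R x) = r *\<^sub>R V t n x"
  "V t n (x * y) = V t n x * y"
proof -
  have p: "st (t n * st (t n)) = t n * st (t n)" for n by (simp add: st_mult)
  show "V t n (x + y) = V t n x + V t n y" "V t n (r *\<^sub>R x) = r *\<^sub>R V t n x"
    "V t n (x * y) = V t n x * y"
    by (induction n arbitrary: x y)
      (simp_all add: S_add S_scaleR S_mult tow_add tow_scaleR tow_mult distrib_left distrib_right
        scaleR_add_right fc_add_right[OF p cont_defect] fc_scaleR_right[OF p cont_defect]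
        fc_mult_right[OF p cont_defect, symmetric] mult.assoc[symmetric])
qed

lemma V_inner_tow: "n < m \<Longrightarrow> st (V t n x) * tow m y = 0"
proof (induction n arbitrary: x)
  case 0
  then show ?case using tow_inner[of 0 x m y] by simp
next
  case (Suc n)
  then show ?case by (simp only: V.simps st_add distrib_right tow_inner) simp
qed

text \<open>The old copies contribute \<open>t n * st (t n)\<close> to the inner product and the new
  copy contributes its complement, because the defect enters as a square root.\<close>

lemma V_inner:
  assumes "\<And>n. norm (t n) \<le> 1"
  shows "st (V t n x) * V t n y = st x * y"
proof (induction n arbitrary: x y)
  case 0
  then show ?case by (simp add: S_inner)
next
  case (Suc n)
  let ?\<sigma> = "fc (\<lambda>s. sqrt (max 0 (1 - s))) (t n * st (t n))"
  have 0: "st (tow (Suc n) a) * V t n b = 0" for a b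
    using arg_cong[OF V_inner_tow[of n "Suc n" t b a], of st] by (simp add: st_mult del: tow.simps)
  have "st (V t (Suc n) x) * V t (Suc n) y
    = st (st (t n) * x) * (st (t n) * y) + st (?\<sigma> x) * ?\<sigma> y"
    by (simp only: V.simps st_add distrib_left distrib_right Suc V_inner_tow[OF lessI] 0 tow_inner)
      simp
  also have "\<dots> = st x * y"
    unfolding st_defect_mult[OF assms] by (simp add: st_mult right_diff_distrib mult.assoc)
  finally show ?case .
qed

text \<open>Where \<open>t n\<close> is isometric its defect vanishes on the image:
  \<open>t n * st (t n) * (t n * w) = t n * w\<close>. Nothing enters the new copy, so
  \<open>V t (Suc n)\<close> extends \<open>V t n\<close> along \<open>t n\<close>.\<close>

lemma V_Suc_mult:
  assumes "norm (t n) \<le> 1" and w: "st (t n) * t n * w = w"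
  shows "V t (Suc n) (t n * w) = V t n w"
proof -
  let ?z = "fc (\<lambda>s. sqrt (max 0 (1 - s))) (t n * st (t n)) (t n * w)"
  have "st ?z * ?z = st (t n * w) * (t n * w - t n * st (t n) * (t n * w))"
    by (rule st_defect_mult[OF assms(1)])
  also have "t n * st (t n) * (t n * w) = t n * (st (t n) * t n * w)" by (simp add: mult.assoc)
  finally have "?z = 0" by (simp add: w)
  moreover have "st (t n) * (t n * w) = w" using w by (simp add: mult.assoc)
  ultimately show ?thesis by (simp only: V.simps tow_0) simp
qed

text \<open>The weights 2^(-n) make the sum of the copies converge but are invisible to Cuntz
  comparison, so each copy stays below \<open>s\<close>. Conversely the first copies all factor
  through one isometry \<open>V t (Suc N)\<close>; hence a partial sum is comparable to an element
  supported in \<open>ys (Suc N)\<close>.\<close>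

theorem cle_upper_bound:
  assumes pos: "\<And>n. pos (ys n)" and le: "\<And>n. cle (ys n) (ys (Suc n))"
  shows "\<exists>s. pos s \<and> (\<forall>n. cle (ys n) s) \<and> (\<forall>e>0. \<exists>k. \<exists>r. norm (s - r * ys k * st r) < e)"
proof -
  obtain \<delta> t where t: "\<And>n. 0 < \<delta> n" "\<And>n. supp (\<delta> n) (ys (Suc n)) (t n)" "\<And>n. norm (t n) \<le> 1"
    "\<And>n. st (t (Suc n)) * t (Suc n) * t n = t n"
    "\<And>k n. k \<le> n \<Longrightarrow> cle (cut (inverse (Suc n)) (ys k)) (st (t n) * t n)"
    by (rule transport_sequence[of ys, OF pos le], rule that)
  define E where "E n = V t (Suc n) (t n)" for n
  have E_st: "st (E n) * E n = st (t n) * t n" for n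
    unfolding E_def by (rule V_inner[OF t(3)])
  have E_norm: "norm (E n) \<le> 1" for n
    using t(3)[of n] by (simp add: norm_st_mult_self_eq[of "E n"] E_st norm_st_mult)
  define g where "g n = (1/2) ^ n *\<^sub>R (E n * st (E n))" for n
  have g_pos: "pos (g n)" for n unfolding g_def by (intro pos_scaleR pos_mult_st) simp
  have "norm (g n) \<le> (1/2) ^ n" for n
    using E_norm[of n] by (simp add: g_def norm_mult_st power_le_one mult_left_le)
  then have g_sum: "summable g"
    using summable_comparison_test'[of "\<lambda>n. (1/2) ^ n" 0 g] summable_geometric[of "1/2 :: real"] by simp
  define s where "s = suminf g"
  have sg: "pos (s - g n)" for n unfolding s_def by (rule pos_suminf[OF g_pos g_sum])
  have s: "pos s" using pos_add[OF sg[of 0] g_pos[of 0]] by simp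
  have upper: "cle (ys k) s" for k
  proof (rule cle_closure)
    fix e :: real assume "0 < e"
    then obtain N where N: "inverse (real (Suc N)) < e" using reals_Archimedean by blast
    define n where "n = max k N"
    have n: "k \<le> n" "inverse (real (Suc n)) \<le> e"
      using N by (auto simp: n_def intro!: order_trans[OF le_imp_inverse_le less_imp_le[OF N]])
    have "cle (E n * st (E n)) s"
    proof (rule cle_mono_scaleR[where c = "2 ^ n"])
      have "2 ^ n *\<^sub>R s - E n * st (E n) = 2 ^ n *\<^sub>R (s - g n)"
        by (simp add: g_def scaleR_right_diff_distrib flip: power_mult_distrib)
      then show "pos (2 ^ n *\<^sub>R s - E n * st (E n))" using sg by (simp add: pos_scaleR)
    qed (auto simp: pos_mult_st s)
    moreover have "cle (cut (inverse (Suc n)) (ys k)) (E n * st (E n))"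
      using cle_trans[OF t(5)[OF n(1)]] cle_st_mult[of "E n"] by (simp only: E_st)
    ultimately have "cle (cut (inverse (Suc n)) (ys k)) s" using cle_trans by blast
    moreover have "norm (ys k - cut (inverse (Suc n)) (ys k)) \<le> e"
      using norm_diff_cut_le[OF pos, of "inverse (Suc n)" k] n(2) by simp
    ultimately show "\<exists>c. norm (ys k - c) \<le> e \<and> cle c s" by blast
  qed
  \<comment> \<open>\<open>p n j\<close> is the product of \<open>t (n + j)\<close> down to
    \<open>t n\<close>. It carries the n-th copy into later stages, where
    \<open>E n = V t (Suc (n + j)) (p n j)\<close>.\<close>
  define p where "p n = rec_nat (t n) (\<lambda>j w. t (Suc (n + j)) * w)" for n
  have p0: "p n 0 = t n" and pS: "p n (Suc j) = t (Suc (n + j)) * p n j" for n j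
    by (simp_all add: p_def)
  have p_ex: "\<exists>w. p n (Suc j) = t (Suc (n + j)) * w" for n j using pS by blast
  have p_fix: "st (t (Suc (n + j))) * t (Suc (n + j)) * p n j = p n j" for n j
  proof (cases j)
    case 0
    then show ?thesis using t(4) by (simp add: p0)
  next
    case (Suc i)
    then show ?thesis using t(4)[of "n + j"] by (simp only: pS add_Suc_right mult.assoc[symmetric])
  qed
  have p_supp: "supp (\<delta> (n + j)) (ys (Suc (n + j))) (p n j)" for n j
    using t(2) supp_mult_right[OF t(2) pos_st[OF pos]]
    by (cases j) (simp_all only: p0 pS add_Suc_right add_0_right)
  have E_V: "E n = V t (Suc (n + j)) (p n j)" for n j
  proof (induction j)
    case 0
    then show ?case by (simp add: E_def p0 del: V.simps)
  next
    case (Suc j)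
    then show ?case using V_Suc_mult[of t "Suc (n + j)" "p n j", OF t(3) p_fix] by (simp only: pS add_Suc_right)
  qed
  have lower: "cle (sum g {..N}) (ys (Suc N))" for N
  proof -
    let ?q = "\<lambda>n. p n (N - n)"
    let ?V = "V t (Suc N)"
    \<comment> \<open>\<open>F w\<close> is V w V' for the isometry V = ?V and its adjoint V'; being
      linear and multiplicative, it identifies the partial sum with \<open>Q\<close>, which lives in
      the hereditary subalgebra of \<open>ys (Suc N)\<close>.\<close>
    define F where "F w = ?V (st (?V (st w)))" for w
    have F_prod: "F (a * st b) = ?V a * st (?V b)" for a b
      unfolding F_def by (simp only: st_mult st_st V_linear(3))
    have F_add: "F (a + b) = F a + F b" and F_scale: "F (c *\<^sub>R a) = c *\<^sub>R F a" for a b c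
      unfolding F_def by (simp_all only: V_linear st_add st_scaleR)
    have F_0: "F 0 = 0" using F_scale[of 0 0] by simp
    define Q where "Q = (\<Sum>n\<le>N. (1/2) ^ n *\<^sub>R (?q n * st (?q n)))"
    have Q: "pos Q" unfolding Q_def by (intro pos_sum pos_scaleR pos_mult_st) simp
    have "F (\<Sum>n\<in>A. (1/2) ^ n *\<^sub>R (?q n * st (?q n))) = (\<Sum>n\<in>A. (1/2) ^ n *\<^sub>R (?V (?q n) * st (?V (?q n))))" for A
      by (induction A rule: infinite_finite_induct) (simp_all only: sum.infinite sum.empty sum.insert F_0 F_add F_scale F_prod simp_thms)
    then have "F Q = (\<Sum>n\<le>N. (1/2) ^ n *\<^sub>R (?V (?q n) * st (?V (?q n))))" unfolding Q_def .
    also have "\<dots> = sum g {..N}"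
    proof (rule sum.cong[OF refl])
      fix n assume "n \<in> {..N}"
      then have "E n = ?V (?q n)" using E_V[of n "N - n"] by simp
      then show "(1/2) ^ n *\<^sub>R (?V (?q n) * st (?V (?q n))) = g n" by (simp only: g_def)
    qed
    finally have FQ: "F Q = sum g {..N}" .
    have "F Q = ?V (psqrt Q) * st (?V (psqrt Q))"
      using F_prod[of "psqrt Q" "psqrt Q"] by (simp only: st_psqrt[OF Q] psqrt_mult[OF Q])
    moreover have "st (?V (psqrt Q)) * ?V (psqrt Q) = Q"
      by (simp only: V_inner[OF t(3)] st_psqrt[OF Q] psqrt_mult[OF Q])
    ultimately have "cle (sum g {..N}) Q" using cle_mult_st[of "?V (psqrt Q)"] by (simp only: FQ)
    moreover have "cle Q (ys (Suc N))"
    proof (rule cle_mono_scaleR[OF Q pos])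
      have sy: "st (ys (Suc N)) = ys (Suc N)" using pos pos_st by blast
      have "supp (\<delta> N) (ys (Suc N)) (\<Sum>n\<in>A. (1/2) ^ n *\<^sub>R (?q n * st (?q n)))" if "A \<subseteq> {..N}" for A
        unfolding supp_def
      proof (intro allI impI)
        fix f assume f: "continuous_on UNIV f" "\<forall>s\<ge>\<delta> N. f s = (1::real)"
        have "fc f (ys (Suc N)) (?q n * st (?q n)) = ?q n * st (?q n)" if "n \<le> N" for n
          using supp_mult_right[OF p_supp pos_st[OF pos], of n "N - n" "st (?q n)"] that f by (simp add: supp_def)
        then show "fc f (ys (Suc N)) (\<Sum>n\<in>A. (1/2) ^ n *\<^sub>R (?q n * st (?q n))) = (\<Sum>n\<in>A. (1/2) ^ n *\<^sub>R (?q n * st (?q n)))"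
          using that by (induction A rule: infinite_finite_induct)
            (simp_all add: fc_zero_right fc_add_right fc_scaleR_right sy f)
      qed
      then have "supp (\<delta> N) (ys (Suc N)) Q" unfolding Q_def by simp
      then show "pos ((norm Q / \<delta> N) *\<^sub>R ys (Suc N) - Q)"
        by (intro pos_supp_le pos t(1) Q)
      show "0 \<le> norm Q / \<delta> N" using t(1)[of N] by simp
    qed
    ultimately show ?thesis using cle_trans by blast
  qed
  have approx: "\<exists>k. \<exists>r. norm (s - r * ys k * st r) < e" if e: "0 < e" for e
  proof -
    have "(\<lambda>N. sum g {..N}) \<longlonglongrightarrow> s" unfolding s_def by (rule summable_LIMSEQ'[OF g_sum])
    then obtain N where N: "norm (sum g {..N} - s) < e / 2"
      using LIMSEQ_D[of _ s "e / 2"] e half_gt_zero by blast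
    obtain r where r: "norm (sum g {..N} - r * ys (Suc N) * st r) < e / 2"
      using lower[of N] e half_gt_zero unfolding cle_def by blast
    have "norm (s - r * ys (Suc N) * st r) < e"
      using norm_triangle_ineq[of "s - sum g {..N}" "sum g {..N} - r * ys (Suc N) * st r"] N r
      by (simp add: norm_minus_commute)
    then show ?thesis by blast
  qed
  show ?thesis using s upper approx by blast
qed

end

section \<open>The factorization argument modulo an ideal\<close>

context cstar
begin

text \<open>The vector \<open>u\<close> contributes \<open>u * st u\<close>, so the squared norm is
  that of the function t \<psi>(t)^2 evaluated at \<open>u * st u\<close>.\<close>

lemma norm_sq_fc_self_le:
  assumes \<psi>: "continuous_on UNIV \<psi>"
    and e: "\<And>t. 0 \<le> t \<Longrightarrow> \<psi> t * \<psi> t * t \<le> e"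
  shows "(norm (fc \<psi> (u * st u) u))\<^sup>2 \<le> e"
proof -
  define a where "a = u * st u"
  have a: "pos a" "st a = a" by (simp_all add: a_def pos_mult_st st_mult)
  define f where "f t = \<psi> t * t" for t
  have f: "continuous_on UNIV f" "f 0 = 0" unfolding f_def by (auto intro!: continuous_intros \<psi>)
  have "fc \<psi> a a = fe f a"
    using fc_fe[OF a(2) \<psi> continuous_on_id] by (simp add: fe_id a f_def[abs_def])
  then have "fc \<psi> a u * st u = fe f a" using fc_mult_right[OF a(2) \<psi>, of u "st u"] by (simp add: a_def)
  then have "u * st (fc \<psi> a u) = fe f a"
    using arg_cong[of _ _ st] st_fe[OF a(2) f] by (metis st_mult st_st)
  then have "fc \<psi> a u * st (fc \<psi> a u) = fe (\<lambda>t. \<psi> t * f t) a"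
    by (simp add: fc_mult_right a \<psi> fc_fe f)
  moreover have "norm (fe (\<lambda>t. \<psi> t * f t) a) \<le> e"
  proof (rule pos_norm_fe_le[OF a(1)])
    fix t :: real assume "0 \<le> t"
    moreover have "\<psi> t * f t = \<psi> t * \<psi> t * t" by (simp add: f_def)
    ultimately show "\<bar>\<psi> t * f t\<bar> \<le> e" using e[of t] by (simp only: abs_mult) simp
  qed (use f in \<open>auto intro!: continuous_on_mult \<psi>\<close>)
  ultimately show ?thesis by (simp add: a_def flip: norm_mult_st)
qed

lemma norm_mult3_le:
  fixes a b c :: 'a
  assumes "norm a \<le> 1" "norm c \<le> 1"
  shows "norm (a * b * c) \<le> norm b"
proof -
  have "norm (a * b * c) \<le> norm a * norm b * norm c"
    by (rule order_trans[OF norm_mult_ineq mult_right_mono[OF norm_mult_ineq norm_ge_zero]])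
  also have "\<dots> \<le> 1 * norm b * 1" by (intro mult_mono assms) auto
  finally show ?thesis by simp
qed

text \<open>Substitute for the unit when a corner of an orthogonal sum is cut out: the isometry
  behind \<open>S1\<close> is only a multiplier, whereas \<open>S1 s\<close> is an element.\<close>

lemma local_unit:
  assumes x: "pos x" and e: "0 < e"
  shows "\<exists>s. st s = s \<and> norm s \<le> 1 \<and> norm (x - s * x * s) \<le> e"
proof -
  let ?f = "\<lambda>t. min 1 (max 0 t / e)"
  have f: "continuous_on UNIV ?f" "?f 0 = 0" using e by (auto intro!: continuous_intros)
  have sx: "st x = x" using x by (rule pos_st)
  have f01: "0 \<le> ?f t" "?f t \<le> 1" for t using e by auto
  define s where "s = fe ?f x"
  have s: "st s = s" "norm s \<le> 1"
    unfolding s_def using f01 by (auto intro!: st_fe[OF sx f] norm_fe_le[OF sx f])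
  have c: "continuous_on UNIV (\<lambda>t. ?f t * t)" by (intro continuous_on_mult f continuous_on_id)
  have "s * x * s = fe (\<lambda>t. ?f t * t * ?f t) x"
    using fe_times[OF sx f continuous_on_id] fe_times[OF sx c _ f] by (simp add: s_def fe_id sx)
  then have "x - s * x * s = fe (\<lambda>t. t - ?f t * t * ?f t) x"
    using fe_diff[OF sx continuous_on_id _ continuous_on_mult[OF c f(1)]] by (simp add: fe_id sx)
  also have "norm \<dots> \<le> e"
  proof (rule pos_norm_fe_le[OF x])
    show "\<bar>t - ?f t * t * ?f t\<bar> \<le> e" if "0 \<le> t" for t
    proof (cases "t \<le> e")
      case True
      have "0 \<le> ?f t * t * ?f t" by (intro mult_nonneg_nonneg f01(1) that)
      moreover have "?f t * t * ?f t \<le> 1 * t * 1" using f01[of t] that by (intro mult_mono) auto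
      ultimately show ?thesis using True that by linarith
    next
      case False
      then have "?f t = 1" using e by simp
      then show ?thesis using e by simp
    qed
  qed (auto intro!: continuous_on_diff continuous_on_mult c f continuous_on_id)
  finally show ?thesis using s by blast
qed

lemma norm_st_mult_diff_le:
  assumes "norm (a - b) \<le> e" "norm a \<le> K"
  shows "norm (st a * a - st b * b) \<le> e * (2 * K + e)"
proof -
  have "norm b \<le> K + e" using assms norm_triangle_ineq4[of a "a - b"] by simp
  have "st a * a - st b * b = st a * (a - b) + st (a - b) * b"
    by (simp add: st_diff algebra_simps)
  also have "norm \<dots> \<le> K * e + e * (K + e)"
    by (intro order_trans[OF norm_triangle_ineq] add_mono order_trans[OF norm_mult_ineq] mult_mono)
      (use assms \<open>norm b \<le> K + e\<close> order_trans[OF norm_ge_zero assms(2)]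
        order_trans[OF norm_ge_zero assms(1)] in \<open>simp_all\<close>)
  finally show ?thesis by (simp add: algebra_simps)
qed

end

section \<open>Comparison modulo the ideal of an idempotent class\<close>

context cstar_stable
begin

text \<open>If \<open>2 [w] = [w]\<close>, this is the closed ideal generated by \<open>w\<close>.\<close>
definition idl :: "'a \<Rightarrow> 'a \<Rightarrow> bool" where
  "idl w t \<longleftrightarrow> cle (st t * t) w"

context
  fixes w
  assumes w: "pos w" and ww: "cle (dsm w w) w"
begin

text \<open>The place where 2[w] = [w] enters: a sum is below the orthogonal sum, hence below two
  copies of \<open>w\<close>. This makes the elements below \<open>w\<close> closed under
  addition.\<close>

lemma cle_add_idem:
  assumes "pos a" "pos b" "cle a w" "cle b w"
  shows "cle (a + b) w"
  using cle_trans[OF cle_trans[OF cle_add_dsm cle_dsm] ww] assms by blast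

lemma idl_add:
  assumes "idl w s" "idl w t"
  shows "idl w (s + t)"
proof -
  have "cle (st (s + t) * (s + t)) (st s * s + st t * t)"
  proof (rule cle_mono_scaleR[where c = 2])
    show "pos (2 *\<^sub>R (st s * s + st t * t) - st (s + t) * (s + t))"
      using pos_sum_mult_st_le[of "st s" "st t"] by (simp add: st_add)
  qed (simp_all add: pos_st_mult pos_add)
  then show ?thesis
    using cle_add_idem assms pos_st_mult cle_trans unfolding idl_def by blast
qed

lemma idl_mult_left:
  assumes "idl w t"
  shows "idl w (c * t)"
proof -
  have "st (c * t) * (c * t) = st t * (st c * c) * t" by (simp add: st_mult mult.assoc)
  then have "cle (st (c * t) * (c * t)) (st t * t)"
    using cle_mono_scaleR[OF pos_st_mult pos_st_mult, of "norm (st c * c)" t "c * t"]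
      pos_norm_conj[OF pos_st_mult order.refl, of c t] by simp
  then show ?thesis using assms cle_trans unfolding idl_def by blast
qed

lemma idl_mult_right:
  assumes "idl w t"
  shows "idl w (t * c)"
proof -
  have "cle (st (t * c) * (t * c)) (st t * t)"
    using cle_conj[of "st c" "st t * t"] by (simp add: st_mult mult.assoc)
  then show ?thesis using assms cle_trans unfolding idl_def by blast
qed

lemma idl_st: "idl w t \<Longrightarrow> idl w (st t)"
  unfolding idl_def using cle_mult_st[of t] cle_trans by simp

lemma idl_minus: "idl w t \<Longrightarrow> idl w (- t)"
  unfolding idl_def by (simp add: st_minus)

lemma idl_diff: "idl w s \<Longrightarrow> idl w t \<Longrightarrow> idl w (s - t)"
  using idl_add[of s "- t"] idl_minus by simp

text \<open>The absolute value \<open>p\<close> of \<open>t\<close> dominates \<open>t\<close>, and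
  it is below its square \<open>st t * t\<close>, hence below \<open>w\<close>.\<close>

lemma idl_majorant:
  assumes t: "st t = t" "idl w t"
  shows "\<exists>p. pos p \<and> pos (p - t) \<and> cle p w"
proof -
  let ?a = "\<lambda>s::real. \<bar>s\<bar>"
  have a: "continuous_on UNIV ?a" "?a 0 = 0" by (auto intro!: continuous_intros)
  define p where "p = fe ?a t"
  have p: "pos p" unfolding p_def by (rule pos_fe[OF t(1) a]) simp
  have "p - t = fe (\<lambda>s. \<bar>s\<bar> - s) t"
    using fe_diff[OF t(1) a continuous_on_id] by (simp add: p_def fe_id t)
  then have "pos (p - t)" using t(1) by (auto intro!: pos_fe continuous_intros)
  moreover have "p * p = st t * t"
    using fe_times[OF t(1) a a] t(1) by (simp add: p_def fe_square)
  then have "cle p w" using cle_square[OF p] t(2) cle_trans unfolding idl_def by simp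
  ultimately show ?thesis using p by blast
qed

text \<open>How an ideal error becomes a summand \<open>w\<close>: with a positive majorant
  \<open>p\<close> of \<open>i\<close>, write b + i = (b + p) - (p - i). Roerdam's lemma tolerates
  the positive defect p - i, and b + p is below the orthogonal sum of \<open>b\<close> and
  \<open>w\<close>.\<close>

lemma cle_cut_mod_idl:
  assumes a: "pos a" and b: "pos b" and i: "st i = i" "idl w i" and e: "norm (a - (b + i)) \<le> e"
  shows "cle (cut e a) (dsm b w)"
proof -
  obtain p where p: "pos p" "pos (p - i)" "cle p w" using idl_majorant[OF i] by blast
  have "cle (cut e a) (b + p)"
    using e by (intro cle_cut_of_norm_le[OF a pos_add[OF b p(1)] p(2)]) (simp add: algebra_simps)
  moreover have "cle (b + p) (dsm b w)"
    using cle_trans[OF cle_add_dsm[OF b p(1)] cle_dsm[OF cle_refl[OF b] p(3)]] .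
  ultimately show ?thesis using cle_trans by blast
qed

text \<open>From an approximate factorization of \<open>x \<oplus> y\<close> through \<open>z \<oplus> w\<close>: the vectors \<open>u\<close> and \<open>v\<close> come
  from the \<open>z\<close>-part, \<open>u'\<close> and \<open>v'\<close> from the \<open>w\<close>-part.\<close>
lemma dsm_factorization:
  assumes x: "pos x" and y: "pos y" and z: "pos z"
    and le: "cle (dsm x y) (dsm z w)" and e: "0 < e"
  shows "\<exists>m n u' v'. let \<zeta> = psqrt (psqrt z); u = \<zeta> * m; v = \<zeta> * n in
    idl w u' \<and> idl w v' \<and>
    norm (x - (st u * u + st u' * u')) \<le> e \<and> norm (y - (st v * v + st v' * v')) \<le> e \<and>
    norm (st u * v + st u' * v') \<le> e"
proof -
  define \<zeta>1 where "\<zeta>1 = psqrt z"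
  \<comment> \<open>Writing z^(1/2) as \<open>\<zeta> * \<zeta>\<close> leaves one
    \<open>\<zeta>\<close> in front of the vectors and absorbs the other into \<open>m\<close> and
    \<open>n\<close>. The factor in front keeps u times its adjoint below a multiple of z^(1/2),
    hence Cuntz below \<open>z\<close>.\<close>
  define \<zeta> where "\<zeta> = psqrt \<zeta>1"
  define \<omega> where "\<omega> = psqrt w"
  have \<zeta>1: "pos \<zeta>1" "\<zeta>1 * \<zeta>1 = z" "st \<zeta>1 = \<zeta>1" using z by (auto simp: \<zeta>1_def pos_psqrt psqrt_mult st_psqrt)
  then have \<zeta>: "st \<zeta> = \<zeta>" "\<zeta> * \<zeta> = \<zeta>1" by (auto simp: \<zeta>_def psqrt_mult st_psqrt)
  have \<omega>: "st \<omega> = \<omega>" "\<omega> * \<omega> = w" using w by (auto simp: \<omega>_def psqrt_mult st_psqrt)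
  have e2: "0 < e / 2" using e by simp
  obtain r where r: "norm (dsm x y - r * dsm z w * st r) < e / 2"
    using le e2 unfolding cle_def by blast
  obtain s where s: "st s = s" "norm s \<le> 1" "norm (x - s * x * s) \<le> e / 2"
    using local_unit[OF x e2] by blast
  obtain k where k: "st k = k" "norm k \<le> 1" "norm (y - k * y * k) \<le> e / 2"
    using local_unit[OF y e2] by blast
  \<comment> \<open>\<open>p\<close> passes through z^(1/2) and \<open>q\<close> through w^(1/2), so
    that \<open>r * dsm z w * st r\<close> splits as \<open>st p * p + st q * q\<close> with
    \<open>q\<close> in the ideal.\<close>
  define p where "p = st (r * S1 \<zeta>1)"
  define q where "q = st (r * S2 \<omega>)"
  have D: "r * dsm z w * st r = st p * p + st q * q"
  proof -
    have "dsm z w = S1 \<zeta>1 * st (S1 \<zeta>1) + S2 \<omega> * st (S2 \<omega>)"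
      using S_factor(1)[of \<zeta>1 \<zeta>1] S_factor(2)[of \<omega> \<omega>] by (simp add: dsm_def \<zeta>1 \<omega>)
    then show ?thesis by (simp add: p_def q_def st_mult algebra_simps)
  qed
  have "idl w (S2 \<omega>)" unfolding idl_def using cle_refl[OF w] by (simp add: S_inner \<omega>)
  then have q: "idl w q" unfolding q_def by (intro idl_st idl_mult_left)
  define u where "u = p * S1 s"
  define v where "v = p * S2 k"
  define u' where "u' = q * S1 s"
  define v' where "v' = q * S2 k"
  have bd: "norm (st a * dsm x y * b - (st (p * a) * (p * b) + st (q * a) * (q * b))) \<le> e / 2"
    if "norm a \<le> 1" "norm b \<le> 1" for a b
  proof -
    have "st a * dsm x y * b - (st (p * a) * (p * b) + st (q * a) * (q * b))
      = st a * (dsm x y - r * dsm z w * st r) * b"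
      unfolding D by (simp add: st_mult algebra_simps)
    then show ?thesis
      using norm_mult3_le[of "st a" b "dsm x y - r * dsm z w * st r"] that r by simp
  qed
  have nS: "norm (S1 s) \<le> 1" "norm (S2 k) \<le> 1" using s k by (simp_all add: norm_S)
  have xs: "st (S1 s) * dsm x y * S1 s = s * x * s"
    by (simp add: mult.assoc dsm_mult_S S_inner s)
  have yk: "st (S2 k) * dsm x y * S2 k = k * y * k"
    by (simp add: mult.assoc dsm_mult_S S_inner k)
  have xy: "st (S1 s) * dsm x y * S2 k = 0"
    by (simp add: mult.assoc dsm_mult_S S_inner)
  have "norm (x - (st u * u + st u' * u')) \<le> e"
    using norm_diff_triangle_le[OF s(3) bd[OF nS(1) nS(1), unfolded xs]]
    unfolding u_def[symmetric] u'_def[symmetric] by simp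
  moreover have "norm (y - (st v * v + st v' * v')) \<le> e"
    using norm_diff_triangle_le[OF k(3) bd[OF nS(2) nS(2), unfolded yk]]
    unfolding v_def[symmetric] v'_def[symmetric] by simp
  moreover have "norm (st u * v + st u' * v') \<le> e"
    using bd[OF nS] e norm_minus_cancel[of "st u * v + st u' * v'"]
    unfolding xy u_def[symmetric] u'_def[symmetric] v_def[symmetric] v'_def[symmetric] by simp
  moreover have "p = \<zeta> * (st (S1 \<zeta>) * st r)"
  proof -
    have "S1 \<zeta>1 = S1 \<zeta> * \<zeta>" using S_mult(1)[of \<zeta> \<zeta>] by (simp add: \<zeta>)
    then show ?thesis by (simp add: p_def st_mult \<zeta> mult.assoc)
  qed
  then have "u = \<zeta> * (st (S1 \<zeta>) * st r * S1 s)" "v = \<zeta> * (st (S1 \<zeta>) * st r * S2 k)"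
    by (simp_all add: u_def v_def mult.assoc)
  moreover have "idl w u'" "idl w v'" unfolding u'_def v'_def by (intro idl_mult_right q)+
  ultimately show ?thesis
    by (intro exI[of _ "st (S1 \<zeta>) * st r * S1 s"] exI[of _ "st (S1 \<zeta>) * st r * S2 k"]
        exI[of _ u'] exI[of _ v']) (simp add: Let_def \<zeta>_def \<zeta>1_def)
qed

text \<open>Both terms lie below multiples of z^(1/2), so their sum does too: no second copy of
  \<open>z\<close> is spent. The root itself is below its square \<open>z\<close>.\<close>

lemma cle_psqrt_conj:
  assumes z: "pos z"
  defines "\<zeta> \<equiv> psqrt (psqrt z)"
  shows "cle (\<zeta> * m * st (\<zeta> * m) + \<zeta> * n * st (\<zeta> * n)) z"
proof -
  have p: "pos (psqrt z)" using z by (rule pos_psqrt)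
  have \<zeta>: "st \<zeta> = \<zeta>" "\<zeta> * \<zeta> = psqrt z" using p by (auto simp: \<zeta>_def psqrt_mult st_psqrt)
  have le: "pos (norm (m * st m) *\<^sub>R psqrt z - \<zeta> * m * st (\<zeta> * m))" for m
    using pos_norm_conj[OF pos_mult_st[of m] order.refl, of \<zeta>]
    by (simp add: \<zeta> st_mult mult.assoc)
  have "pos ((norm (m * st m) + norm (n * st n)) *\<^sub>R psqrt z - (\<zeta> * m * st (\<zeta> * m) + \<zeta> * n * st (\<zeta> * n)))"
    using pos_add[OF le[of m] le[of n]] by (simp add: algebra_simps)
  then have "cle (\<zeta> * m * st (\<zeta> * m) + \<zeta> * n * st (\<zeta> * n)) (psqrt z)"
    by (rule cle_mono_scaleR[rotated 2]) (auto intro: pos_add pos_mult_st p)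
  moreover have "cle (psqrt z) z" using cle_square[OF p] psqrt_mult[OF z] by simp
  ultimately show ?thesis using cle_trans by blast
qed

text \<open>Modulo the ideal of \<open>w\<close> the vectors \<open>u\<close> and \<open>v\<close> are almost orthogonal; cutting both by functions of
  \<open>u u\<^sup>*\<close> with disjoint supports makes them exactly orthogonal and changes little modulo the ideal.\<close>
lemma orthogonalize_mod_idl:
  assumes d: "0 < d" and K: "1 \<le> K" "norm u \<le> K" "norm v \<le> K"
    and u: "u = \<zeta> * m" and v: "v = \<zeta> * n" and i: "idl w i"
    and e: "norm (st u * v + i) * K \<le> 2 * d * min 1 (d / (3 * K))"
  shows "\<exists>m' n' j. let \<alpha> = \<zeta> * m'; \<beta> = \<zeta> * n' in st \<beta> * \<alpha> = 0 \<and> st j = j \<and> idl w j \<and>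
    norm (st u * u - st \<alpha> * \<alpha>) \<le> 4 * d \<and> norm (st \<beta> * \<beta> - (st v * v + j)) \<le> d"
proof -
  define a where "a = u * st u"
  have a: "pos a" "st a = a" by (simp_all add: a_def pos_mult_st st_mult)
  let ?M = "\<lambda>t. max t (2 * d)"
  have M: "0 < ?M t" for t using d by (simp add: less_max_iff_disj)
  then have M0: "?M t \<noteq> 0" for t using less_irrefl by metis
  \<comment> \<open>\<open>\<kappa>\<close> vanishes up to 2d and is 1 from 4d on, while
    \<open>g\<close> is 1 from 2d on, so (1 - g) \<kappa> = 0. Both functions are t times a
    continuous function: the factor \<open>u * st u\<close> split off in this way keeps the new
    vectors in the form \<open>\<zeta>\<close> times an element.\<close>
  define \<kappa>' where "\<kappa>' t = min 1 (max 0 (t / (2 * d) - 1)) / ?M t" for t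
  define \<kappa> where "\<kappa> t = t * \<kappa>' t" for t
  define \<gamma> where "\<gamma> t = max 0 t / (?M t * ?M t)" for t
  define g where "g t = t * \<gamma> t" for t
  have c\<kappa>': "continuous_on UNIV \<kappa>'" "\<kappa>' 0 = 0"
    unfolding \<kappa>'_def using d M0 by (auto intro!: continuous_intros simp del: max_less_iff_conj)
  have c\<kappa>: "continuous_on UNIV \<kappa>" "\<kappa> 0 = 0" unfolding \<kappa>_def by (auto intro!: continuous_intros c\<kappa>')
  have c\<gamma>: "continuous_on UNIV \<gamma>" "\<gamma> 0 = 0"
    unfolding \<gamma>_def using d M0 by (auto intro!: continuous_intros)
  have cg: "continuous_on UNIV g" "g 0 = 0" unfolding g_def by (auto intro!: continuous_intros c\<gamma>)
  have fe_split: "fe (\<lambda>t. t * f t) a = a * fe f a" if "continuous_on UNIV f" "f 0 = 0" for f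
    using fe_times[OF a(2) continuous_on_id _ that] by (simp add: fe_id a)
  have \<kappa>_small: "\<kappa> t = 0" if "t \<le> 2 * d" for t
  proof -
    have "t / (2 * d) \<le> 1" using that d by simp
    then show ?thesis by (simp add: \<kappa>_def \<kappa>'_def)
  qed
  have \<kappa>_big: "\<kappa> t = 1" if "4 * d \<le> t" for t
  proof -
    have "2 \<le> t / (2 * d)" using that d by (simp add: pos_le_divide_eq)
    then show ?thesis using that d by (simp add: \<kappa>_def \<kappa>'_def max_absorb1)
  qed
  have \<kappa>_01: "0 \<le> \<kappa> t \<and> \<kappa> t \<le> 1" if "0 \<le> t" for t
  proof (cases "t \<le> 2 * d")
    case False
    then have "\<kappa> t = min 1 (max 0 (t / (2 * d) - 1))" using d by (simp add: \<kappa>_def \<kappa>'_def max_absorb1)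
    then show ?thesis by simp
  qed (simp add: \<kappa>_small)
  have g_01: "0 \<le> g t" "g t \<le> 1" if "0 \<le> t" for t
  proof -
    show "0 \<le> g t" using that by (simp add: g_def \<gamma>_def)
    have "t * t \<le> ?M t * ?M t" using that d by (intro mult_mono) auto
    then show "g t \<le> 1" using that M[of t] by (simp add: g_def \<gamma>_def divide_le_eq_1 zero_less_mult_iff)
  qed
  have g_big: "g t = 1" if "2 * d \<le> t" for t
    using that d by (simp add: g_def \<gamma>_def max_absorb1)
  have \<gamma>_le: "\<bar>\<gamma> t\<bar> \<le> 1 / (2 * d)" if "0 \<le> t" for t
  proof -
    have "\<gamma> t = (t / ?M t) / ?M t" using that by (simp add: \<gamma>_def)
    also have "\<dots> \<le> 1 / (2 * d)" using that d M[of t] by (intro frac_le) auto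
    finally show ?thesis using that by (simp add: \<gamma>_def)
  qed
  define \<alpha> where "\<alpha> = fc \<kappa> a u"
  define \<beta> where "\<beta> = fc (\<lambda>t. 1 - g t) a v"
  have c1g: "continuous_on UNIV (\<lambda>t. 1 - g t)" by (intro continuous_intros cg)
  have "st \<beta> * \<alpha> = st v * fc (\<lambda>t. (1 - g t) * \<kappa> t) a u"
    by (simp only: \<alpha>_def \<beta>_def st_fc[OF a(2) c1g] fc_mult[OF a(2) c1g c\<kappa>(1)])
  also have "fc (\<lambda>t. (1 - g t) * \<kappa> t) a u = fc (\<lambda>t. 0) a u"
  proof (rule fc_cong[OF a(2) continuous_on_mult[OF c1g c\<kappa>(1)]])
    show "(1 - g t) * \<kappa> t = 0" for t using \<kappa>_small[of t] g_big[of t] by (cases "t \<le> 2 * d") auto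
  qed simp
  finally have orth: "st \<beta> * \<alpha> = 0" by (simp add: fc_const a)
  have \<alpha>_form: "\<alpha> = \<zeta> * (m * (st u * (fe \<kappa>' a * u)))"
  proof -
    have "\<alpha> = fe \<kappa> a * u" by (simp add: \<alpha>_def fe_mult a c\<kappa>)
    also have "fe \<kappa> a = a * fe \<kappa>' a" unfolding \<kappa>_def by (rule fe_split[OF c\<kappa>'])
    finally have "\<alpha> = u * (st u * (fe \<kappa>' a * u))" by (simp add: a_def mult.assoc)
    also have "\<dots> = \<zeta> * (m * (st u * (fe \<kappa>' a * u)))" by (subst u) (simp only: mult.assoc)
    finally show ?thesis .
  qed
  have \<beta>_eq: "\<beta> = v - fe \<gamma> a * a * v" and \<beta>_eq': "\<beta> = v - a * (fe \<gamma> a * v)"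
  proof -
    have *: "\<beta> = v - fe g a * v"
      using fc_diff[OF a(2) continuous_on_const cg(1), of 1 v] by (simp add: \<beta>_def fc_const a fe_mult cg)
    moreover have "fe g a = a * fe \<gamma> a" unfolding g_def by (rule fe_split[OF c\<gamma>])
    ultimately show "\<beta> = v - a * (fe \<gamma> a * v)" by (simp add: mult.assoc)
    have "fe g a = fe \<gamma> a * a"
      using fe_times[OF a(2) c\<gamma> continuous_on_id] by (simp add: g_def[abs_def] fe_id a mult.commute)
    with * show "\<beta> = v - fe \<gamma> a * a * v" by simp
  qed
  have \<beta>_form: "\<beta> = \<zeta> * (n - m * (st u * (fe \<gamma> a * v)))"
  proof -
    have "\<beta> = v - u * (st u * (fe \<gamma> a * v))" by (simp add: \<beta>_eq' a_def mult.assoc)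
    also have "\<dots> = \<zeta> * (n - m * (st u * (fe \<gamma> a * v)))"
      by (subst (1) v, subst (1) u) (simp only: right_diff_distrib mult.assoc)
    finally show ?thesis .
  qed
  have near_\<alpha>: "norm (st u * u - st \<alpha> * \<alpha>) \<le> 4 * d"
  proof -
    let ?\<psi> = "\<lambda>t. sqrt (max 0 (1 - \<kappa> t * \<kappa> t))"
    have c\<kappa>\<kappa>: "continuous_on UNIV (\<lambda>t. \<kappa> t * \<kappa> t)" by (intro continuous_on_mult c\<kappa>)
    have c\<psi>: "continuous_on UNIV ?\<psi>" by (intro continuous_intros c\<kappa>)
    have "st u * u - st \<alpha> * \<alpha> = st u * fc (\<lambda>t. 1 - \<kappa> t * \<kappa> t) a u"
      using fc_diff[OF a(2) continuous_on_const c\<kappa>\<kappa>, of 1 u] fc_mult[OF a(2) c\<kappa>(1) c\<kappa>(1), of u]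
      by (simp add: \<alpha>_def st_fc a c\<kappa> fc_const right_diff_distrib)
    also have "fc (\<lambda>t. 1 - \<kappa> t * \<kappa> t) a u = fc (\<lambda>t. ?\<psi> t * ?\<psi> t) a u"
    proof (rule pos_fc_cong[OF a(1)])
      show "1 - \<kappa> t * \<kappa> t = ?\<psi> t * ?\<psi> t" if "0 \<le> t" for t
        using \<kappa>_01[OF that] mult_le_one[of "\<kappa> t" "\<kappa> t"] by simp
    qed (intro continuous_intros c\<kappa> c\<psi>)+
    also have "st u * fc (\<lambda>t. ?\<psi> t * ?\<psi> t) a u = st (fc ?\<psi> a u) * fc ?\<psi> a u"
      by (simp only: st_fc[OF a(2) c\<psi>] fc_mult[OF a(2) c\<psi> c\<psi>])
    finally have "norm (st u * u - st \<alpha> * \<alpha>) = (norm (fc ?\<psi> a u))\<^sup>2" by (simp only: norm_st_mult)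
    also have "\<dots> \<le> 4 * d"
      unfolding a_def
    proof (rule norm_sq_fc_self_le[OF c\<psi>])
      fix t :: real assume t: "0 \<le> t"
      have k: "0 \<le> \<kappa> t * \<kappa> t" "\<kappa> t * \<kappa> t \<le> 1" using \<kappa>_01[OF t] mult_le_one[of "\<kappa> t" "\<kappa> t"] by auto
      then have eq: "?\<psi> t * ?\<psi> t * t = (1 - \<kappa> t * \<kappa> t) * t" by simp
      show "?\<psi> t * ?\<psi> t * t \<le> 4 * d"
      proof (cases "4 * d \<le> t")
        case True
        then show ?thesis unfolding eq using \<kappa>_big d by simp
      next
        case False
        then have "(1 - \<kappa> t * \<kappa> t) * t \<le> 1 * (4 * d)" using k t by (intro mult_mono) auto
        then show ?thesis unfolding eq by simp
      qed
    qed
    finally show ?thesis .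
  qed
  \<comment> \<open>As \<open>\<gamma>\<close> is at most 1/(2d) and \<open>u\<close> at most
    \<open>K\<close>, the hypothesis puts \<open>\<beta>\<close> within \<open>\<epsilon>\<close> of
    \<open>v + h\<close>. Passing to \<open>st \<beta> * \<beta>\<close> costs a factor 2 K +
    \<epsilon> \<le> 3 K, whence d/(3 K).\<close>
  define \<epsilon> where "\<epsilon> = min 1 (d / (3 * K))"
  \<comment> \<open>In \<beta> = v - \<gamma>(a) u (st u v) the product \<open>st u * v\<close> is
    close to \<open>- i\<close>; replacing it gives \<open>v + h\<close> with \<open>h\<close> in
    the ideal, and \<open>j\<close> collects the terms of \<open>st (v + h) * (v + h)\<close> that
    contain \<open>h\<close>.\<close>
  define h where "h = fe \<gamma> a * u * i"
  define j where "j = st v * h + st h * v + st h * h"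
  have h: "idl w h" unfolding h_def by (intro idl_mult_left i)
  have j: "st j = j" by (simp add: j_def st_add st_mult add_ac)
  have "idl w j" unfolding j_def
    by (intro idl_add idl_mult_left h idl_mult_right idl_st)
  moreover have "norm (st \<beta> * \<beta> - (st v * v + j)) \<le> d"
  proof -
    have "v + h - \<beta> = fe \<gamma> a * u * (st u * v + i)"
      by (simp add: \<beta>_eq h_def a_def distrib_left mult.assoc)
    then have "norm (v + h - \<beta>) \<le> norm (fe \<gamma> a) * norm u * norm (st u * v + i)"
      by (simp only:) (rule order_trans[OF norm_mult_ineq mult_right_mono[OF norm_mult_ineq norm_ge_zero]])
    then have "norm (\<beta> - (v + h)) \<le> norm (fe \<gamma> a) * norm u * norm (st u * v + i)"
      by (simp only: norm_minus_commute)
    also have "\<dots> \<le> (1 / (2 * d)) * K * norm (st u * v + i)"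
      by (intro mult_right_mono mult_mono pos_norm_fe_le[OF a(1) c\<gamma>] \<gamma>_le K)
        (use d in auto)
    also have "\<dots> \<le> (1 / (2 * d)) * (2 * d * \<epsilon>)"
      using mult_left_mono[OF e, of "1 / (2 * d)"] d by (simp add: \<epsilon>_def mult_ac)
    also have "\<dots> = \<epsilon>" using d by simp
    finally have near: "norm (\<beta> - (v + h)) \<le> \<epsilon>" .
    have "norm \<beta> \<le> 1 * norm v" unfolding \<beta>_def
      by (rule pos_norm_fc_le[OF a(1) c1g]) (use g_01 in auto)
    then have "norm (st \<beta> * \<beta> - st (v + h) * (v + h)) \<le> \<epsilon> * (2 * K + \<epsilon>)"
      using K by (intro norm_st_mult_diff_le near) simp
    also have "\<dots> \<le> (d / (3 * K)) * (2 * K + K)"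
      using K d by (intro mult_mono) (auto simp: \<epsilon>_def)
    also have "\<dots> = d" using K by simp
    finally show ?thesis by (simp add: j_def st_add algebra_simps)
  qed
  ultimately show ?thesis
    using orth near_\<alpha> j
    by (intro exI[of _ "m * (st u * (fe \<kappa>' a * u))"] exI[of _ "n - m * (st u * (fe \<gamma> a * v))"] exI[of _ j])
      (simp add: Let_def flip: \<alpha>_form \<beta>_form)
qed

text \<open>Dropping the positive term \<open>st u' * u'\<close> does not increase the norm, and t
  \<le> t^2 for t \<ge> 1 avoids a square root in the bound.\<close>

lemma norm_le_of_approx:
  assumes "norm (x - (st u * u + st u' * u')) \<le> 1"
  shows "norm u \<le> norm x + 1"
proof -
  have "norm (st u * u) \<le> norm (st u * u + st u' * u')"
    by (rule pos_norm_mono) (simp_all add: pos_st_mult)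
  also have "\<dots> \<le> norm x + 1"
    using norm_triangle_sub[of "st u * u + st u' * u'" x] assms
    by (simp only: norm_minus_commute[of _ x])
  finally have "(norm u)\<^sup>2 \<le> norm x + 1" by (simp add: norm_st_mult)
  also have "\<dots> \<le> (norm x + 1)\<^sup>2" by (rule self_le_power) auto
  finally show ?thesis by (rule power2_le_imp_le) (simp add: add_nonneg_nonneg)
qed

theorem O8_cle:
  assumes x: "pos x" and y: "pos y" and z: "pos z"
    and le: "cle (dsm x y) (dsm z w)" and e: "0 < e"
  shows "\<exists>z1 z2. pos z1 \<and> pos z2 \<and> (\<exists>f>0. cle (dsm z1 z2) (cut f z)) \<and>
    (\<exists>f>0. cle (cut e x) (cut f (dsm z1 w))) \<and> (\<exists>f>0. cle (cut e y) (cut f (dsm z2 w))) \<and>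
    (\<exists>f>0. cle z1 (cut f (dsm x w))) \<and> (\<exists>f>0. cle z2 (cut f (dsm y w)))"
proof -
  \<comment> \<open>The estimate for \<open>x\<close> accumulates d + 4d + 6d from factorization,
    orthogonalization and cutting; one further \<open>d\<close> leaves strict room below
    \<open>e\<close>.\<close>
  define d where "d = e / 12"
  have d: "0 < d" using e by (simp add: d_def)
  define K where "K = norm x + norm y + 1"
  have K: "1 \<le> K" "norm x + 1 \<le> K" "norm y + 1 \<le> K" by (simp_all add: K_def)
  \<comment> \<open>The bound 1 controls the norms of \<open>u\<close> and \<open>v\<close> by
    \<open>K\<close>, the bound \<open>d\<close> controls the diagonal errors, and the last term is
    the smallness of the off-diagonal error that orthogonalization requires.\<close>
  define \<eta> where "\<eta> = min (min 1 d) (2 * d * min 1 (d / (3 * K)) / K)"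
  have \<eta>: "0 < \<eta>" "\<eta> \<le> 1" "\<eta> \<le> d" "\<eta> \<le> 2 * d * min 1 (d / (3 * K)) / K"
    using d K by (auto simp: \<eta>_def)
  define \<zeta> where "\<zeta> = psqrt (psqrt z)"
  obtain m n u' v' where f: "idl w u'" "idl w v'"
    "norm (x - (st (\<zeta> * m) * (\<zeta> * m) + st u' * u')) \<le> \<eta>"
    "norm (y - (st (\<zeta> * n) * (\<zeta> * n) + st v' * v')) \<le> \<eta>"
    "norm (st (\<zeta> * m) * (\<zeta> * n) + st u' * v') \<le> \<eta>"
    using dsm_factorization[OF x y z le \<eta>(1)] unfolding Let_def \<zeta>_def by blast
  define u where "u = \<zeta> * m"
  define v where "v = \<zeta> * n"
  note f = f[folded u_def v_def]
  have nu: "norm u \<le> K" "norm v \<le> K"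
    using norm_le_of_approx[OF order_trans[OF f(3) \<eta>(2)]] norm_le_of_approx[OF order_trans[OF f(4) \<eta>(2)]] K
    by linarith+
  have "norm (st u * v + st u' * v') * K \<le> \<eta> * K" using f(5) K by (intro mult_right_mono) auto
  also have "\<dots> \<le> 2 * d * min 1 (d / (3 * K))" using \<eta>(4) K by (simp add: pos_le_divide_eq)
  finally have small: "norm (st u * v + st u' * v') * K \<le> 2 * d * min 1 (d / (3 * K))" .
  obtain m' n' j where o: "st (\<zeta> * n') * (\<zeta> * m') = 0" "st j = j" "idl w j"
    "norm (st u * u - st (\<zeta> * m') * (\<zeta> * m')) \<le> 4 * d"
    "norm (st (\<zeta> * n') * (\<zeta> * n') - (st v * v + j)) \<le> d"
    using orthogonalize_mod_idl[OF d K(1) nu u_def v_def idl_mult_left[OF f(2)] small]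
    unfolding Let_def by blast
  define \<alpha> where "\<alpha> = \<zeta> * m'"
  define \<beta> where "\<beta> = \<zeta> * n'"
  note o = o[folded \<alpha>_def \<beta>_def]
  define Z1 where "Z1 = st \<alpha> * \<alpha>"
  define Z2 where "Z2 = st \<beta> * \<beta>"
  have Z: "pos Z1" "pos Z2" by (simp_all add: Z1_def Z2_def pos_st_mult)
  \<comment> \<open>Modulo the ideal, \<open>Z1\<close> differs from \<open>x\<close> by at most 5 d
    and \<open>Z2\<close> from \<open>y\<close> by at most 2 d. Cutting at 6 d leaves the strict
    room that a way-below relation needs.\<close>
  define z1 where "z1 = cut (6 * d) Z1"
  define z2 where "z2 = cut (6 * d) Z2"
  have p: "pos z1" "pos z2" using Z d by (simp_all add: z1_def z2_def pos_cut)
  have n1: "norm (Z1 - z1) \<le> 6 * d" and n2: "norm (Z2 - z2) \<le> 6 * d"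
    using norm_diff_cut_le Z d by (simp_all add: z1_def z2_def)
  define i1 where "i1 = st u' * u'"
  define i2 where "i2 = st v' * v'"
  have i: "st i1 = i1" "idl w i1" "st i2 = i2" "idl w i2"
    unfolding i1_def i2_def by (simp_all add: st_mult idl_mult_left f)
  have fx: "norm (x - (st u * u + i1)) \<le> d" and fy: "norm (y - (st v * v + i2)) \<le> d"
    using f(3,4) \<eta>(3) by (simp_all add: i1_def i2_def)
  have oZ: "norm (st u * u - Z1) \<le> 4 * d" "norm (Z2 - (st v * v + j)) \<le> d"
    using o by (simp_all add: Z1_def Z2_def)
  have "cle (dsm Z1 Z2) (\<alpha> * st \<alpha> + \<beta> * st \<beta>)"
    unfolding Z1_def Z2_def by (rule cle_dsm_add_orthogonal[OF o(1)])
  moreover have "cle (\<alpha> * st \<alpha> + \<beta> * st \<beta>) z"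
    unfolding \<alpha>_def \<beta>_def \<zeta>_def by (rule cle_psqrt_conj[OF z])
  ultimately have "cle (dsm Z1 Z2) z" using cle_trans by blast
  then have "\<exists>f>0. cle (cut (6 * d) (dsm Z1 Z2)) (cut f z)"
    using d by (intro cle_imp_cut_cle pos_dsm Z z) auto
  then have c1: "\<exists>f>0. cle (dsm z1 z2) (cut f z)"
    using d by (simp add: cut_dsm Z z1_def z2_def)
  have "norm (x - (z1 + i1)) \<le> 11 * d"
  proof -
    have "x - (z1 + i1) = (x - (st u * u + i1)) + ((st u * u - Z1) + (Z1 - z1))" by simp
    also have "norm \<dots> \<le> d + (4 * d + 6 * d)"
      by (intro norm_triangle_le add_mono fx order.refl norm_triangle_mono oZ n1)
    finally show ?thesis by simp
  qed
  then have "cle (cut (11 * d) x) (dsm z1 w)" by (rule cle_cut_mod_idl[OF x p(1) i(1,2)])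
  then have c2: "\<exists>f>0. cle (cut e x) (cut f (dsm z1 w))"
    using d by (intro cle_cut_cut[OF x pos_dsm[OF p(1) w]]) (auto simp: d_def)
  \<comment> \<open>Orthogonalizing \<open>v\<close> added the ideal element \<open>j\<close> to
    \<open>st v * v\<close>, so it has to be subtracted again here.\<close>
  have "norm (y - (z2 + (i2 - j))) \<le> 8 * d"
  proof -
    have "y - (z2 + (i2 - j)) = (y - (st v * v + i2)) + (- (Z2 - (st v * v + j)) + (Z2 - z2))" by simp
    also have "norm \<dots> \<le> d + (d + 6 * d)"
      by (intro norm_triangle_mono fy n2) (simp only: norm_minus_cancel oZ)
    finally show ?thesis by simp
  qed
  moreover have ij: "st (i2 - j) = i2 - j" "idl w (i2 - j)" using i o by (auto simp: st_diff idl_diff)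
  ultimately have "cle (cut (8 * d) y) (dsm z2 w)" by (intro cle_cut_mod_idl[OF y p(2)])
  then have c3: "\<exists>f>0. cle (cut e y) (cut f (dsm z2 w))"
    using d by (intro cle_cut_cut[OF y pos_dsm[OF p(2) w]]) (auto simp: d_def)
  have "norm (Z1 - (x + - i1)) \<le> 5 * d"
  proof -
    have "Z1 - (x + - i1) = - (x - (st u * u + i1)) + - (st u * u - Z1)" by simp
    also have "norm \<dots> \<le> d + 4 * d"
      by (intro norm_triangle_mono; simp only: norm_minus_cancel fx oZ)
    finally show ?thesis by simp
  qed
  then have "cle (cut (5 * d) Z1) (dsm x w)"
    using i by (intro cle_cut_mod_idl[OF Z(1) x _ idl_minus[OF i(2)]]) (simp_all add: st_minus)
  then have c4: "\<exists>f>0. cle z1 (cut f (dsm x w))"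
    unfolding z1_def using d by (intro cle_cut_cut[OF Z(1) pos_dsm[OF x w]]) auto
  have "norm (Z2 - (y + (j - i2))) \<le> 2 * d"
  proof -
    have "Z2 - (y + (j - i2)) = (Z2 - (st v * v + j)) + - (y - (st v * v + i2))" by simp
    also have "norm \<dots> \<le> d + d"
      by (intro norm_triangle_mono oZ) (simp only: norm_minus_cancel fy)
    finally show ?thesis by simp
  qed
  then have "cle (cut (2 * d) Z2) (dsm y w)"
    using i o by (intro cle_cut_mod_idl[OF Z(2) y]) (auto simp: st_diff idl_diff)
  then have c5: "\<exists>f>0. cle z2 (cut f (dsm y w))"
    unfolding z2_def using d by (intro cle_cut_cut[OF Z(2) pos_dsm[OF y w]]) auto
  show ?thesis using p c1 c2 c3 c4 c5 by blast
qed

end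

end

section \<open>The norm of matrices over a C*-algebra\<close>

context cstar
begin

definition ip :: "nat \<Rightarrow> (nat \<Rightarrow> 'a) \<Rightarrow> (nat \<Rightarrow> 'a) \<Rightarrow> 'a" where
  "ip n \<xi> \<eta> = (\<Sum>i<n. st (\<xi> i) * \<eta> i)"

definition vn :: "nat \<Rightarrow> (nat \<Rightarrow> 'a) \<Rightarrow> real" where
  "vn n \<xi> = sqrt (norm (ip n \<xi> \<xi>))"

lemma st_sum: "st (\<Sum>i\<in>A. f i) = (\<Sum>i\<in>A. st (f i))"
  by (induction A rule: infinite_finite_induct) (simp_all add: st_add)

lemma st_ip: "st (ip n \<xi> \<eta>) = ip n \<eta> \<xi>"
  by (simp add: ip_def st_sum st_mult)

lemma pos_ip: "pos (ip n \<xi> \<xi>)"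
  unfolding ip_def by (intro pos_sum pos_st_mult)

lemma vn_nonneg [simp]: "0 \<le> vn n \<xi>"
  by (simp add: vn_def)

lemma vn_sq: "(vn n \<xi>)\<^sup>2 = norm (ip n \<xi> \<xi>)"
  by (simp add: vn_def)

lemma ip_add_left: "ip n (\<lambda>i. \<xi> i + \<xi>' i) \<eta> = ip n \<xi> \<eta> + ip n \<xi>' \<eta>"
  and ip_add_right: "ip n \<eta> (\<lambda>i. \<xi> i + \<xi>' i) = ip n \<eta> \<xi> + ip n \<eta> \<xi>'"
  and ip_diff_left: "ip n (\<lambda>i. \<xi> i - \<xi>' i) \<eta> = ip n \<xi> \<eta> - ip n \<xi>' \<eta>"
  and ip_diff_right: "ip n \<eta> (\<lambda>i. \<xi> i - \<xi>' i) = ip n \<eta> \<xi> - ip n \<eta> \<xi>'"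
  by (simp_all add: ip_def st_add st_diff distrib_left distrib_right left_diff_distrib
      right_diff_distrib sum.distrib sum_subtractf)

lemma ip_scaleR_left: "ip n (\<lambda>i. r *\<^sub>R \<xi> i) \<eta> = r *\<^sub>R ip n \<xi> \<eta>"
  and ip_scaleR_right: "ip n \<eta> (\<lambda>i. r *\<^sub>R \<xi> i) = r *\<^sub>R ip n \<eta> \<xi>"
  by (simp_all add: ip_def st_scaleR scaleR_sum_right)

lemma ip_mult_left: "ip n (\<lambda>i. \<xi> i * a) \<eta> = st a * ip n \<xi> \<eta>"
  and ip_mult_right: "ip n \<eta> (\<lambda>i. \<xi> i * a) = ip n \<eta> \<xi> * a"
  by (simp_all add: ip_def st_mult sum_distrib_left sum_distrib_right mult.assoc)

text \<open>Completing the square with the vector \<eta> - \<xi> a / N. The scalar \<open>N\<close>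
  replaces the algebra element \<open>ip n \<xi> \<xi>\<close>, which need not be invertible; it
  must be positive, hence the small surplus that is removed at the end.\<close>

lemma ip_cauchy_schwarz: "norm (ip n \<xi> \<eta>) \<le> vn n \<xi> * vn n \<eta>"
proof -
  define a where "a = ip n \<xi> \<eta>"
  have bd: "(norm a)\<^sup>2 \<le> N * norm (ip n \<eta> \<eta>)" if N: "norm (ip n \<xi> \<xi>) \<le> N" "0 < N" for N
  proof -
    let ?\<zeta> = "\<lambda>i. \<eta> i - (1 / N) *\<^sub>R (\<xi> i * a)"
    have st_a: "ip n \<eta> \<xi> = st a" by (simp add: a_def st_ip)
    have "ip n ?\<zeta> ?\<zeta> = ip n \<eta> \<eta> - (2 / N) *\<^sub>R (st a * a) + (1 / N) *\<^sub>R ((1 / N) *\<^sub>R (st a * ip n \<xi> \<xi> * a))"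
      by (simp add: ip_diff_left ip_diff_right ip_scaleR_left ip_scaleR_right ip_mult_left ip_mult_right
          st_a a_def[symmetric] mult.assoc scaleR_diff_right)
        (simp add: algebra_simps flip: scaleR_add_left)
    then have "pos (ip n \<eta> \<eta> - (2 / N) *\<^sub>R (st a * a) + (1 / N) *\<^sub>R ((1 / N) *\<^sub>R (st a * ip n \<xi> \<xi> * a)))"
      using pos_ip[of n ?\<zeta>] by simp
    moreover have "pos ((1 / N) *\<^sub>R (1 / N) *\<^sub>R (N *\<^sub>R (st a * a) - st a * ip n \<xi> \<xi> * a))"
      using N by (intro pos_scaleR pos_norm_conj pos_ip) auto
    ultimately have "pos (ip n \<eta> \<eta> - (2 / N) *\<^sub>R (st a * a) + (1 / N) *\<^sub>R ((1 / N) *\<^sub>R (st a * ip n \<xi> \<xi> * a))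
        + (1 / N) *\<^sub>R (1 / N) *\<^sub>R (N *\<^sub>R (st a * a) - st a * ip n \<xi> \<xi> * a))"
      by (rule pos_add)
    also have "ip n \<eta> \<eta> - (2 / N) *\<^sub>R (st a * a) + (1 / N) *\<^sub>R ((1 / N) *\<^sub>R (st a * ip n \<xi> \<xi> * a))
        + (1 / N) *\<^sub>R (1 / N) *\<^sub>R (N *\<^sub>R (st a * a) - st a * ip n \<xi> \<xi> * a)
      = ip n \<eta> \<eta> - (1 / N) *\<^sub>R (st a * a)"
    proof -
      have "(2 / N) *\<^sub>R (st a * a) = (1 / N) *\<^sub>R (st a * a) + (1 / N) *\<^sub>R (st a * a)"
        by (simp flip: scaleR_add_left)
      then show ?thesis using N by (simp add: scaleR_diff_right)
    qed
    finally have "norm ((1 / N) *\<^sub>R (st a * a)) \<le> norm (ip n \<eta> \<eta>)"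
      using N by (intro pos_norm_mono pos_scaleR pos_st_mult) auto
    then show ?thesis using N by (simp add: norm_st_mult field_simps)
  qed
  have "(norm a)\<^sup>2 \<le> norm (ip n \<xi> \<xi>) * norm (ip n \<eta> \<eta>)"
  proof (rule field_le_epsilon)
    fix e :: real assume e: "0 < e"
    define M where "M = norm (ip n \<eta> \<eta>) + 1"
    have M: "0 < M" "norm (ip n \<eta> \<eta>) \<le> M" by (simp_all add: M_def add_nonneg_pos)
    have "(norm a)\<^sup>2 \<le> (norm (ip n \<xi> \<xi>) + e / M) * norm (ip n \<eta> \<eta>)"
      using e M by (intro bd) (auto simp: add_nonneg_pos)
    also have "\<dots> = norm (ip n \<xi> \<xi>) * norm (ip n \<eta> \<eta>) + (e / M) * norm (ip n \<eta> \<eta>)"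
      by (rule distrib_right)
    also have "(e / M) * norm (ip n \<eta> \<eta>) \<le> (e / M) * M" using e M by (intro mult_left_mono) auto
    finally show "(norm a)\<^sup>2 \<le> norm (ip n \<xi> \<xi>) * norm (ip n \<eta> \<eta>) + e" using M by simp
  qed
  then have "(norm a)\<^sup>2 \<le> (vn n \<xi> * vn n \<eta>)\<^sup>2" by (simp add: power_mult_distrib vn_sq)
  then show ?thesis unfolding a_def by (rule power2_le_imp_le) simp
qed

lemma vn_triangle: "vn n (\<lambda>i. \<xi> i + \<eta> i) \<le> vn n \<xi> + vn n \<eta>"
proof (rule power2_le_imp_le)
  have "(vn n (\<lambda>i. \<xi> i + \<eta> i))\<^sup>2 = norm (ip n \<xi> \<xi> + ip n \<xi> \<eta> + (ip n \<eta> \<xi> + ip n \<eta> \<eta>))"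
    by (simp add: vn_sq ip_add_left ip_add_right algebra_simps)
  also have "\<dots> \<le> (vn n \<xi>)\<^sup>2 + vn n \<xi> * vn n \<eta> + (vn n \<eta> * vn n \<xi> + (vn n \<eta>)\<^sup>2)"
    by (intro norm_triangle_mono ip_cauchy_schwarz) (simp_all add: vn_sq)
  finally show "(vn n (\<lambda>i. \<xi> i + \<eta> i))\<^sup>2 \<le> (vn n \<xi> + vn n \<eta>)\<^sup>2" by (simp add: power2_eq_square algebra_simps)
qed simp

lemma vn_scaleR: "vn n (\<lambda>i. r *\<^sub>R \<xi> i) = \<bar>r\<bar> * vn n \<xi>"
  by (simp add: vn_def ip_scaleR_left ip_scaleR_right real_sqrt_mult flip: mult.assoc)

lemma vn_cs: "vn n (\<lambda>i. cs c (\<xi> i)) = cmod c * vn n \<xi>"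
proof -
  have "ip n (\<lambda>i. cs c (\<xi> i)) (\<lambda>i. cs c (\<xi> i)) = (\<Sum>i<n. cs (of_real ((cmod c)\<^sup>2)) (st (\<xi> i) * \<xi> i))"
    by (simp add: ip_def st_cs cs_mult_left cs_mult_right cs_cs complex_norm_square del: of_real_power)
  also have "\<dots> = (cmod c)\<^sup>2 *\<^sub>R ip n \<xi> \<xi>"
    by (simp add: cs_of_real ip_def scaleR_sum_right del: of_real_power)
  finally show ?thesis by (simp add: vn_def real_sqrt_mult)
qed

lemma vn_mono_index:
  assumes "n \<le> m"
  shows "vn n \<xi> \<le> vn m \<xi>"
proof -
  have "ip m \<xi> \<xi> - ip n \<xi> \<xi> = (\<Sum>i\<in>{n..<m}. st (\<xi> i) * \<xi> i)"
    unfolding ip_def using sum.atLeastLessThan_concat[of 0 n m "\<lambda>i. st (\<xi> i) * \<xi> i"] assms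
    by (simp add: lessThan_atLeast0 algebra_simps)
  then have "pos (ip m \<xi> \<xi> - ip n \<xi> \<xi>)" by (simp add: pos_sum pos_st_mult)
  then show ?thesis unfolding vn_def by (intro real_sqrt_le_mono pos_norm_mono pos_ip)
qed

lemma norm_component_le:
  assumes "i < n"
  shows "norm (\<xi> i) \<le> vn n \<xi>"
proof -
  have "ip n \<xi> \<xi> - st (\<xi> i) * \<xi> i = (\<Sum>k\<in>{..<n} - {i}. st (\<xi> k) * \<xi> k)"
    unfolding ip_def using assms by (simp add: sum_diff1)
  then have "pos (ip n \<xi> \<xi> - st (\<xi> i) * \<xi> i)" by (simp add: pos_sum pos_st_mult)
  then have "norm (st (\<xi> i) * \<xi> i) \<le> norm (ip n \<xi> \<xi>)" by (intro pos_norm_mono pos_st_mult)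
  then have "(norm (\<xi> i))\<^sup>2 \<le> (vn n \<xi>)\<^sup>2" by (simp add: norm_st_mult vn_sq)
  then show ?thesis by (rule power2_le_imp_le) simp
qed

lemma vn_le_sum: "vn n \<xi> \<le> (\<Sum>i<n. norm (\<xi> i))"
proof -
  have "norm (ip n \<xi> \<xi>) \<le> (\<Sum>i<n. (norm (\<xi> i))\<^sup>2)"
    unfolding ip_def by (rule order_trans[OF norm_sum]) (simp add: norm_st_mult)
  then have "vn n \<xi> \<le> L2_set (\<lambda>i. norm (\<xi> i)) {..<n}"
    unfolding vn_def L2_set_def by (rule real_sqrt_le_mono)
  also have "\<dots> \<le> (\<Sum>i<n. norm (\<xi> i))" by (rule L2_set_le_sum) simp
  finally show ?thesis .
qed

lemma vn_cong: "(\<And>i. i < n \<Longrightarrow> \<xi> i = \<eta> i) \<Longrightarrow> vn n \<xi> = vn n \<eta>"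
  unfolding vn_def ip_def by (intro arg_cong[where f = "\<lambda>x. sqrt (norm x)"] sum.cong) auto

section \<open>Operator norms of finite matrices\<close>

abbreviation mnrm :: "nat \<Rightarrow> 'a kmat \<Rightarrow> real" where
  "mnrm \<equiv> mnorm st"

lemma mnorm_eq: "mnrm n X = Sup {vn n (mvec n X \<xi>) |\<xi>. norm (ip n \<xi> \<xi>) \<le> 1}"
  by (simp add: mnorm_def vn_def ip_def)

lemma vn_mvec_le_sum: "vn n (mvec n X \<xi>) \<le> (\<Sum>i<n. \<Sum>j<n. norm (X i j)) * vn n \<xi>"
proof -
  have "vn n (mvec n X \<xi>) \<le> (\<Sum>i<n. \<Sum>j<n. norm (X i j) * vn n \<xi>)"
  proof (rule order_trans[OF vn_le_sum sum_mono])
    fix i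
    show "norm (mvec n X \<xi> i) \<le> (\<Sum>j<n. norm (X i j) * vn n \<xi>)"
      unfolding mvec_def
      by (rule order_trans[OF norm_sum sum_mono])
        (auto intro!: order_trans[OF norm_mult_ineq] mult_left_mono norm_component_le)
  qed
  then show ?thesis by (simp add: sum_distrib_right)
qed

lemma mnorm_bdd: "bdd_above {vn n (mvec n X \<xi>) |\<xi>. norm (ip n \<xi> \<xi>) \<le> 1}"
proof (rule bdd_aboveI, clarify)
  fix \<xi> assume "norm (ip n \<xi> \<xi>) \<le> 1"
  then have "vn n \<xi> \<le> 1" by (simp add: vn_def)
  then have "(\<Sum>i<n. \<Sum>j<n. norm (X i j)) * vn n \<xi> \<le> (\<Sum>i<n. \<Sum>j<n. norm (X i j)) * 1"
    by (intro mult_left_mono sum_nonneg) auto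
  then show "vn n (mvec n X \<xi>) \<le> (\<Sum>i<n. \<Sum>j<n. norm (X i j))"
    using vn_mvec_le_sum[of n X \<xi>] by simp
qed

lemma mnorm_nonneg: "0 \<le> mnrm n X"
proof -
  have "vn n (mvec n X (\<lambda>_. 0)) \<in> {vn n (mvec n X \<xi>) |\<xi>. norm (ip n \<xi> \<xi>) \<le> 1}"
    by (rule CollectI, rule exI[of _ "\<lambda>_. 0"]) (simp add: ip_def)
  from cSup_upper[OF this mnorm_bdd] show ?thesis unfolding mnorm_eq by (rule order_trans[OF vn_nonneg])
qed

lemma mvec_scaleR: "mvec n X (\<lambda>i. r *\<^sub>R \<xi> i) = (\<lambda>i. r *\<^sub>R mvec n X \<xi> i)"
  by (simp add: mvec_def fun_eq_iff scaleR_sum_right)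

lemma vn_mvec_le: "vn n (mvec n X \<xi>) \<le> mnrm n X * vn n \<xi>"
proof (cases "vn n \<xi> = 0")
  case True
  then show ?thesis using vn_mvec_le_sum[of n X \<xi>] by simp
next
  case False
  define r where "r = vn n \<xi>"
  have r: "0 < r" using False vn_nonneg[of n \<xi>] unfolding r_def by linarith
  let ?\<eta> = "\<lambda>i. (1 / r) *\<^sub>R \<xi> i"
  have "vn n ?\<eta> = 1" using r by (simp add: vn_scaleR flip: r_def)
  then have "norm (ip n ?\<eta> ?\<eta>) \<le> 1" by (simp add: vn_def)
  then have "vn n (mvec n X ?\<eta>) \<le> mnrm n X"
    unfolding mnorm_eq by (intro cSup_upper mnorm_bdd) blast
  then show ?thesis using r by (simp add: mvec_scaleR vn_scaleR field_simps flip: r_def)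
qed

lemma mnorm_leI:
  assumes "\<And>\<xi>. vn n (mvec n X \<xi>) \<le> C * vn n \<xi>" "0 \<le> C"
  shows "mnrm n X \<le> C"
  unfolding mnorm_eq
proof (rule cSup_least)
  have "norm (ip n (\<lambda>_. 0) (\<lambda>_. 0)) \<le> 1" by (simp add: ip_def)
  then show "{vn n (mvec n X \<xi>) |\<xi>. norm (ip n \<xi> \<xi>) \<le> 1} \<noteq> {}" by blast
  fix x assume "x \<in> {vn n (mvec n X \<xi>) |\<xi>. norm (ip n \<xi> \<xi>) \<le> 1}"
  then obtain \<xi> where \<xi>: "x = vn n (mvec n X \<xi>)" "norm (ip n \<xi> \<xi>) \<le> 1" by blast
  then have "vn n \<xi> \<le> 1" by (simp add: vn_def)
  then have "C * vn n \<xi> \<le> C * 1" using assms(2) by (intro mult_left_mono)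
  then show "x \<le> C" using assms(1)[of \<xi>] \<xi> by simp
qed

lemma mvec_cong: "(\<And>j. j < n \<Longrightarrow> X i j = Y i j) \<Longrightarrow> (\<And>j. j < n \<Longrightarrow> \<xi> j = \<eta> j) \<Longrightarrow> mvec n X \<xi> i = mvec n Y \<eta> i"
  unfolding mvec_def by (intro sum.cong) auto

lemma mnorm_cong:
  assumes "\<And>i j. i < n \<Longrightarrow> j < n \<Longrightarrow> X i j = Y i j"
  shows "mnrm n X = mnrm n Y"
proof -
  have "vn n (mvec n X \<xi>) = vn n (mvec n Y \<xi>)" for \<xi>
    using assms by (intro vn_cong mvec_cong) auto
  then show ?thesis by (simp add: mnorm_eq)
qed

lemma mnorm_le_sum: "mnrm n X \<le> (\<Sum>i<n. \<Sum>j<n. norm (X i j))"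
  by (intro mnorm_leI vn_mvec_le_sum sum_nonneg) auto

lemma mnorm_add: "mnrm n (\<lambda>i j. X i j + Y i j) \<le> mnrm n X + mnrm n Y"
proof (rule mnorm_leI)
  fix \<xi>
  have "mvec n (\<lambda>i j. X i j + Y i j) \<xi> = (\<lambda>i. mvec n X \<xi> i + mvec n Y \<xi> i)"
    by (simp add: mvec_def fun_eq_iff distrib_right sum.distrib)
  then have "vn n (mvec n (\<lambda>i j. X i j + Y i j) \<xi>) \<le> vn n (mvec n X \<xi>) + vn n (mvec n Y \<xi>)"
    by (simp add: vn_triangle)
  also have "\<dots> \<le> (mnrm n X + mnrm n Y) * vn n \<xi>"
    using vn_mvec_le[of n X \<xi>] vn_mvec_le[of n Y \<xi>] by (simp add: distrib_right)
  finally show "vn n (mvec n (\<lambda>i j. X i j + Y i j) \<xi>) \<le> (mnrm n X + mnrm n Y) * vn n \<xi>" .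
qed (simp add: mnorm_nonneg)

lemma mnorm_cs_le: "mnrm n (\<lambda>i j. cs c (X i j)) \<le> cmod c * mnrm n X"
proof (rule mnorm_leI)
  fix \<xi>
  have cs_sum: "(\<Sum>i\<in>A. cs c (f i)) = cs c (\<Sum>i\<in>A. f i)" for f and A :: "nat set"
    by (induction A rule: infinite_finite_induct) (simp_all add: cs_add_right)
  have "mvec n (\<lambda>i j. cs c (X i j)) \<xi> = (\<lambda>i. cs c (mvec n X \<xi> i))"
    by (simp add: mvec_def fun_eq_iff cs_mult_left cs_sum)
  then have "vn n (mvec n (\<lambda>i j. cs c (X i j)) \<xi>) = cmod c * vn n (mvec n X \<xi>)" by (simp add: vn_cs)
  also have "\<dots> \<le> cmod c * mnrm n X * vn n \<xi>"
    using mult_left_mono[OF vn_mvec_le[of n X \<xi>], of "cmod c"] by (simp add: mult.assoc)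
  finally show "vn n (mvec n (\<lambda>i j. cs c (X i j)) \<xi>) \<le> cmod c * mnrm n X * vn n \<xi>" .
qed (simp add: mnorm_nonneg)

definition mm :: "nat \<Rightarrow> 'a kmat \<Rightarrow> 'a kmat \<Rightarrow> 'a kmat" where
  "mm n X Y = (\<lambda>i j. \<Sum>k<n. X i k * Y k j)"

lemma mvec_mm: "mvec n (mm n X Y) \<xi> = mvec n X (mvec n Y \<xi>)"
proof
  fix i
  have "mvec n (mm n X Y) \<xi> i = (\<Sum>j<n. \<Sum>k<n. X i k * (Y k j * \<xi> j))"
    by (simp add: mvec_def mm_def sum_distrib_right mult.assoc)
  also have "\<dots> = (\<Sum>k<n. \<Sum>j<n. X i k * (Y k j * \<xi> j))" by (rule sum.swap)
  also have "\<dots> = mvec n X (mvec n Y \<xi>) i" by (simp add: mvec_def sum_distrib_left)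
  finally show "mvec n (mm n X Y) \<xi> i = mvec n X (mvec n Y \<xi>) i" .
qed

lemma mnorm_mm: "mnrm n (mm n X Y) \<le> mnrm n X * mnrm n Y"
proof (rule mnorm_leI)
  fix \<xi>
  have "vn n (mvec n (mm n X Y) \<xi>) \<le> mnrm n X * vn n (mvec n Y \<xi>)"
    unfolding mvec_mm by (rule vn_mvec_le)
  also have "\<dots> \<le> mnrm n X * (mnrm n Y * vn n \<xi>)" by (intro mult_left_mono vn_mvec_le mnorm_nonneg)
  finally show "vn n (mvec n (mm n X Y) \<xi>) \<le> mnrm n X * mnrm n Y * vn n \<xi>" by (simp add: mult.assoc)
qed (simp add: mnorm_nonneg)

lemma ip_mvec_adjoint: "ip n (mvec n X \<xi>) \<eta> = ip n \<xi> (mvec n (kstar st X) \<eta>)"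
proof -
  have "ip n (mvec n X \<xi>) \<eta> = (\<Sum>i<n. \<Sum>j<n. st (\<xi> j) * (st (X i j) * \<eta> i))"
    by (simp add: ip_def mvec_def st_sum st_mult sum_distrib_right mult.assoc)
  also have "\<dots> = (\<Sum>j<n. \<Sum>i<n. st (\<xi> j) * (st (X i j) * \<eta> i))" by (rule sum.swap)
  also have "\<dots> = ip n \<xi> (mvec n (kstar st X) \<eta>)"
    by (simp add: ip_def mvec_def kstar_def sum_distrib_left)
  finally show ?thesis .
qed

lemma kstar_kstar [simp]: "kstar st (kstar st X) = X"
  by (simp add: kstar_def)

lemma mnorm_kstar_le: "mnrm n (kstar st X) \<le> mnrm n X"
proof (rule mnorm_leI[OF _ mnorm_nonneg])
  fix \<eta>
  let ?\<zeta> = "mvec n (kstar st X) \<eta>"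
  have "vn n ?\<zeta> * vn n ?\<zeta> = norm (ip n (mvec n X ?\<zeta>) \<eta>)"
    by (simp add: ip_mvec_adjoint vn_sq flip: power2_eq_square)
  also have "\<dots> \<le> vn n (mvec n X ?\<zeta>) * vn n \<eta>" by (rule ip_cauchy_schwarz)
  also have "\<dots> \<le> mnrm n X * vn n ?\<zeta> * vn n \<eta>" by (intro mult_right_mono vn_mvec_le) simp
  finally have "vn n ?\<zeta> * vn n ?\<zeta> \<le> (mnrm n X * vn n \<eta>) * vn n ?\<zeta>" by (simp add: mult_ac)
  then show "vn n ?\<zeta> \<le> mnrm n X * vn n \<eta>"
    using vn_nonneg[of n ?\<zeta>] mnorm_nonneg[of n X] by (cases "vn n ?\<zeta> = 0") (auto simp: mult_le_cancel_right)
qed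

lemma mnorm_sq_le: "(mnrm n X)\<^sup>2 \<le> mnrm n (mm n (kstar st X) X)"
proof -
  let ?C = "mnrm n (mm n (kstar st X) X)"
  have "mnrm n X \<le> sqrt ?C"
  proof (rule mnorm_leI)
    fix \<xi>
    have "(vn n (mvec n X \<xi>))\<^sup>2 = norm (ip n \<xi> (mvec n (mm n (kstar st X) X) \<xi>))"
      by (simp add: vn_sq ip_mvec_adjoint mvec_mm)
    also have "\<dots> \<le> vn n \<xi> * vn n (mvec n (mm n (kstar st X) X) \<xi>)" by (rule ip_cauchy_schwarz)
    also have "\<dots> \<le> vn n \<xi> * (?C * vn n \<xi>)" by (intro mult_left_mono vn_mvec_le) simp
    also have "\<dots> = (sqrt ?C * vn n \<xi>)\<^sup>2" by (simp add: power_mult_distrib mnorm_nonneg power2_eq_square)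
    finally show "vn n (mvec n X \<xi>) \<le> sqrt ?C * vn n \<xi>"
      by (rule power2_le_imp_le) (simp add: mnorm_nonneg)
  qed (simp add: mnorm_nonneg)
  then have "(mnrm n X)\<^sup>2 \<le> (sqrt ?C)\<^sup>2" by (rule power_mono) (rule mnorm_nonneg)
  then show ?thesis by (simp add: mnorm_nonneg)
qed

text \<open>A vector with the single entry \<open>b\<close> at position \<open>j\<close> shows that
  left multiplication by \<open>X i j\<close> is bounded by \<open>mnrm n X\<close>, and left
  multiplication determines the norm.\<close>

lemma norm_entry_le:
  assumes "i < n" "j < n"
  shows "norm (X i j) \<le> mnrm n X"
proof (rule norm_le_left_mult[OF _ mnorm_nonneg])
  fix b :: 'a
  let ?\<xi> = "\<lambda>k. if k = j then b else 0"
  have "ip n ?\<xi> ?\<xi> = (\<Sum>k<n. if k = j then st b * b else 0)"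
    unfolding ip_def by (intro sum.cong) auto
  then have "vn n ?\<xi> = norm b" using assms by (simp add: vn_def norm_st_mult)
  moreover have "mvec n X ?\<xi> i = (\<Sum>k<n. if k = j then X i j * b else 0)"
    unfolding mvec_def by (intro sum.cong) auto
  then have "mvec n X ?\<xi> i = X i j * b" using assms by simp
  ultimately show "norm (X i j * b) \<le> mnrm n X * norm b"
    using norm_component_le[OF assms(1), of "mvec n X ?\<xi>"] vn_mvec_le[of n X ?\<xi>] by simp
qed

lemma mnorm_mono_index:
  assumes "n \<le> m"
  shows "mnrm n X \<le> mnrm m X"
proof (rule mnorm_leI[OF _ mnorm_nonneg])
  fix \<xi> :: "nat \<Rightarrow> 'a"
  let ?\<eta> = "\<lambda>i. if i < n then \<xi> i else 0"
  have "mvec m X ?\<eta> i = mvec n X \<xi> i" for i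
  proof -
    have "mvec m X ?\<eta> i = (\<Sum>j<m. if j < n then X i j * \<xi> j else 0)"
      unfolding mvec_def by (intro sum.cong) auto
    also have "\<dots> = (\<Sum>j\<in>{..<m} \<inter> {j. j < n}. X i j * \<xi> j)" by (simp add: sum.inter_restrict)
    also have "{..<m} \<inter> {j. j < n} = {..<n}" using assms by auto
    finally show ?thesis by (simp add: mvec_def)
  qed
  then have "vn n (mvec n X \<xi>) \<le> vn m (mvec m X ?\<eta>)"
    using vn_mono_index[OF assms, of "mvec n X \<xi>"] by (simp add: vn_cong[of m "mvec m X ?\<eta>" "mvec n X \<xi>"])
  also have "\<dots> \<le> mnrm m X * vn m ?\<eta>" by (rule vn_mvec_le)
  also have "vn m ?\<eta> = vn n \<xi>"
  proof -
    have "ip m ?\<eta> ?\<eta> = (\<Sum>j<m. if j < n then st (\<xi> j) * \<xi> j else 0)"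
      unfolding ip_def by (intro sum.cong) auto
    also have "\<dots> = (\<Sum>j\<in>{..<m} \<inter> {j. j < n}. st (\<xi> j) * \<xi> j)" by (simp add: sum.inter_restrict)
    also have "{..<m} \<inter> {j. j < n} = {..<n}" using assms by auto
    finally show ?thesis by (simp add: vn_def ip_def)
  qed
  finally show "vn n (mvec n X \<xi>) \<le> mnrm m X * vn n \<xi>" .
qed

lemma mnorm_ktrunc_le: "mnrm m (ktrunc n X) \<le> mnrm n X"
proof -
  have "mnrm m (ktrunc n X) \<le> mnrm (max m n) (ktrunc n X)" by (rule mnorm_mono_index) simp
  also have "\<dots> \<le> mnrm n X"
  proof (rule mnorm_leI[OF _ mnorm_nonneg])
    fix \<xi>
    let ?M = "max m n"
    have sub: "{..<?M} \<inter> {j. j < n} = {..<n}" by auto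
    have eq: "mvec ?M (ktrunc n X) \<xi> i = (if i < n then mvec n X \<xi> i else 0)" for i
    proof -
      have "mvec ?M (ktrunc n X) \<xi> i = (\<Sum>j<?M. if j < n then (if i < n then X i j * \<xi> j else 0) else 0)"
        unfolding mvec_def ktrunc_def by (intro sum.cong) auto
      also have "\<dots> = (\<Sum>j\<in>{..<?M} \<inter> {j. j < n}. if i < n then X i j * \<xi> j else 0)" by (simp add: sum.inter_restrict)
      finally show ?thesis by (simp add: sub mvec_def)
    qed
    have "ip ?M (mvec ?M (ktrunc n X) \<xi>) (mvec ?M (ktrunc n X) \<xi>)
      = (\<Sum>i<?M. if i < n then st (mvec n X \<xi> i) * mvec n X \<xi> i else 0)"
      unfolding ip_def eq by (intro sum.cong) auto
    also have "\<dots> = (\<Sum>i\<in>{..<?M} \<inter> {j. j < n}. st (mvec n X \<xi> i) * mvec n X \<xi> i)" by (simp add: sum.inter_restrict)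
    finally have "vn ?M (mvec ?M (ktrunc n X) \<xi>) = vn n (mvec n X \<xi>)" by (simp add: sub vn_def ip_def)
    also have "\<dots> \<le> mnrm n X * vn n \<xi>" by (rule vn_mvec_le)
    also have "\<dots> \<le> mnrm n X * vn ?M \<xi>" by (intro mult_left_mono vn_mono_index mnorm_nonneg) simp
    finally show "vn ?M (mvec ?M (ktrunc n X) \<xi>) \<le> mnrm n X * vn ?M \<xi>" .
  qed
  finally show ?thesis .
qed

text \<open>Lower semicontinuity: for a fixed finite size, entrywise convergence already gives
  convergence of the image of each vector.\<close>

lemma mnorm_limit:
  assumes "\<And>i j. (\<lambda>n. F n i j) \<longlonglongrightarrow> G i j" "\<forall>\<^sub>F n in sequentially. mnrm N (F n) \<le> C" "0 \<le> C"
  shows "mnrm N G \<le> C"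
proof (rule mnorm_leI[OF _ assms(3)])
  fix \<xi>
  have "(\<lambda>n. vn N (mvec N (F n) \<xi>)) \<longlonglongrightarrow> vn N (mvec N G \<xi>)"
    unfolding vn_def ip_def mvec_def by (intro tendsto_intros assms(1))
  moreover have "\<forall>\<^sub>F n in sequentially. vn N (mvec N (F n) \<xi>) \<le> C * vn N \<xi>"
    using assms(2) by eventually_elim (blast intro: order_trans[OF vn_mvec_le mult_right_mono] vn_nonneg)
  ultimately show "vn N (mvec N G \<xi>) \<le> C * vn N \<xi>"
    by (rule tendsto_upperbound) simp
qed

section \<open>The stabilization as a C*-algebra\<close>

abbreviation knrm :: "'a kmat \<Rightarrow> real" where
  "knrm \<equiv> knorm st"

text \<open>\<open>knorm\<close> is a real supremum and is informative only if the norms of the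
  finite corners are bounded.\<close>

definition kbdd :: "'a kmat \<Rightarrow> bool" where
  "kbdd X \<longleftrightarrow> bdd_above (range (\<lambda>n. mnrm n X))"

lemma mnorm_le_knorm: "kbdd X \<Longrightarrow> mnrm n X \<le> knrm X"
  unfolding kbdd_def knorm_def by (rule cSUP_upper) simp_all

lemma kbddI: "(\<And>n. mnrm n X \<le> C) \<Longrightarrow> kbdd X"
  unfolding kbdd_def by (rule bdd_aboveI2)

lemma knorm_leI: "(\<And>n. mnrm n X \<le> C) \<Longrightarrow> knrm X \<le> C"
  unfolding knorm_def by (rule cSUP_least) auto

lemma knorm_zero_le: "knrm (\<lambda>i j. 0) \<le> 0"
  using mnorm_le_sum[of _ "\<lambda>i j. 0"] by (intro knorm_leI) simp

lemma knorm_nonneg: "kbdd X \<Longrightarrow> 0 \<le> knrm X"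
  using mnorm_le_knorm[of X 0] mnorm_nonneg[of 0 X] by simp

lemma kbdd_ktrunc [simp]: "kbdd (ktrunc n X)"
  by (rule kbddI[OF mnorm_ktrunc_le])

lemma knorm_ktrunc_le_mnorm: "knrm (ktrunc n X) \<le> mnrm n X"
  by (rule knorm_leI[OF mnorm_ktrunc_le])

lemma knorm_ktrunc_le: "kbdd X \<Longrightarrow> knrm (ktrunc n X) \<le> knrm X"
  by (rule order_trans[OF knorm_ktrunc_le_mnorm mnorm_le_knorm])

lemma norm_entry_le_knorm: "kbdd X \<Longrightarrow> norm (X i j) \<le> knrm X"
  using norm_entry_le[of i "Suc (i + j)" j X] mnorm_le_knorm[of X "Suc (i + j)"] by simp

lemma knorm_eq_0: "kbdd X \<Longrightarrow> knrm X \<le> 0 \<Longrightarrow> X = (\<lambda>i j. 0)"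
  by (rule ext)+ (metis norm_entry_le_knorm norm_le_zero_iff order_trans)

lemma
  assumes "kbdd X" "kbdd Y"
  shows kbdd_add: "kbdd (\<lambda>i j. X i j + Y i j)"
    and knorm_add: "knrm (\<lambda>i j. X i j + Y i j) \<le> knrm X + knrm Y"
proof -
  have "mnrm n (\<lambda>i j. X i j + Y i j) \<le> knrm X + knrm Y" for n
    by (intro order_trans[OF mnorm_add] add_mono mnorm_le_knorm assms)
  then show "kbdd (\<lambda>i j. X i j + Y i j)" "knrm (\<lambda>i j. X i j + Y i j) \<le> knrm X + knrm Y"
    by (intro kbddI knorm_leI; assumption)+
qed

lemma
  assumes "kbdd X"
  shows kbdd_cs: "kbdd (\<lambda>i j. cs c (X i j))"
    and knorm_cs_le: "knrm (\<lambda>i j. cs c (X i j)) \<le> cmod c * knrm X"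
proof -
  have "mnrm n (\<lambda>i j. cs c (X i j)) \<le> cmod c * knrm X" for n
    by (intro order_trans[OF mnorm_cs_le] mult_left_mono mnorm_le_knorm assms) simp
  then show "kbdd (\<lambda>i j. cs c (X i j))" "knrm (\<lambda>i j. cs c (X i j)) \<le> cmod c * knrm X"
    by (intro kbddI knorm_leI; assumption)+
qed

lemma knorm_cs:
  assumes "kbdd X"
  shows "knrm (\<lambda>i j. cs c (X i j)) = cmod c * knrm X"
proof (cases "c = 0")
  case True
  have "cs 0 x = 0" for x using norm_cs[of 0 x] by simp
  then have "mnrm n (\<lambda>i j. cs c (X i j)) \<le> 0" for n
    using mnorm_le_sum[of n "\<lambda>i j. cs c (X i j)"] by (simp add: True)
  then have "knrm (\<lambda>i j. cs c (X i j)) \<le> 0" by (rule knorm_leI)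
  then show ?thesis using knorm_nonneg[OF kbdd_cs[OF assms, of c]] by (simp add: True)
next
  case False
  have "knrm X = knrm (\<lambda>i j. cs (1 / c) (cs c (X i j)))" using False by (simp add: cs_cs cs_one)
  also have "\<dots> \<le> cmod (1 / c) * knrm (\<lambda>i j. cs c (X i j))" by (rule knorm_cs_le[OF kbdd_cs[OF assms]])
  finally have "cmod c * knrm X \<le> knrm (\<lambda>i j. cs c (X i j))"
    using False by (simp add: norm_divide pos_le_divide_eq mult.commute)
  then show ?thesis using knorm_cs_le[OF assms, of c] by simp
qed

lemma kbdd_minus: "kbdd X \<Longrightarrow> kbdd (\<lambda>i j. - X i j)"
  and knorm_minus: "kbdd X \<Longrightarrow> knrm (\<lambda>i j. - X i j) = knrm X"
  using kbdd_cs[of X "-1"] knorm_cs[of X "-1"] by (simp_all add: cs_minus_one)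

lemma
  assumes "kbdd X" "kbdd Y"
  shows kbdd_diff: "kbdd (X - Y)"
    and knorm_diff: "knrm (X - Y) \<le> knrm X + knrm Y"
  using kbdd_add[OF assms(1) kbdd_minus[OF assms(2)]] knorm_add[OF assms(1) kbdd_minus[OF assms(2)]]
  by (simp_all add: knorm_minus[OF assms(2)] fun_diff_def)

lemma knorm_diff_commute:
  assumes "kbdd (X - Y)"
  shows "knrm (Y - X) = knrm (X - Y)"
  using knorm_minus[OF assms] by (simp add: fun_diff_def)

lemma knorm_diff_triangle:
  assumes "kbdd (X - Y)" "kbdd (Y - Z)"
  shows "knrm (X - Z) \<le> knrm (X - Y) + knrm (Y - Z)" "kbdd (X - Z)"
  using knorm_add[OF assms] kbdd_add[OF assms] by (simp_all add: fun_diff_def)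

lemma
  assumes "kbdd X"
  shows kbdd_kstar: "kbdd (kstar st X)" and knorm_kstar: "knrm (kstar st X) = knrm X"
proof -
  have le: "kbdd (kstar st X) \<and> knrm (kstar st X) \<le> knrm X" if "kbdd X" for X
  proof -
    have "mnrm n (kstar st X) \<le> knrm X" for n
      by (rule order_trans[OF mnorm_kstar_le mnorm_le_knorm[OF that]])
    then show ?thesis using kbddI knorm_leI by blast
  qed
  show "kbdd (kstar st X)" using le assms by blast
  show "knrm (kstar st X) = knrm X" using le[OF assms] le[of "kstar st X"] by simp
qed

text \<open>Turns the Cauchy condition into convergence of the truncations to \<open>X\<close>
  itself: every finite corner of \<open>X - ktrunc n X\<close> sits inside a difference of two
  truncations, which also yields boundedness.\<close>

lemma stab_iff:
  "X \<in> stab st \<longleftrightarrow> kbdd X \<and> (\<forall>e>0. \<exists>N. \<forall>n\<ge>N. knrm (X - ktrunc n X) \<le> e)"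
proof
  assume X: "X \<in> stab st"
  have tail: "mnrm m (X - ktrunc n X) \<le> e"
    if "\<And>m n. N \<le> m \<Longrightarrow> N \<le> n \<Longrightarrow> knrm (ktrunc m X - ktrunc n X) < e" "N \<le> n" for N n m e
  proof -
    let ?M = "max m N"
    have "mnrm m (X - ktrunc n X) \<le> mnrm ?M (X - ktrunc n X)" by (rule mnorm_mono_index) simp
    also have "\<dots> = mnrm ?M (ktrunc ?M X - ktrunc n X)"
      by (rule mnorm_cong) (simp add: ktrunc_def)
    also have "\<dots> \<le> knrm (ktrunc ?M X - ktrunc n X)" by (intro mnorm_le_knorm kbdd_diff) simp_all
    also have "\<dots> \<le> e" using that by (intro less_imp_le) simp
    finally show ?thesis .
  qed
  have cauchy: "\<exists>N. \<forall>m\<ge>N. \<forall>n\<ge>N. knrm (ktrunc m X - ktrunc n X) < e" if "0 < e" for e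
    using X that unfolding stab_def by blast
  obtain N where N: "\<And>m n. N \<le> m \<Longrightarrow> N \<le> n \<Longrightarrow> knrm (ktrunc m X - ktrunc n X) < 1"
    using cauchy[of 1] by auto
  have "kbdd (X - ktrunc N X)" by (rule kbddI[OF tail[OF N order.refl]])
  from kbdd_add[OF this kbdd_ktrunc[of N X]] have "kbdd X" by simp
  moreover have "\<exists>N. \<forall>n\<ge>N. knrm (X - ktrunc n X) \<le> e" if e: "0 < e" for e
  proof -
    obtain N where "\<And>m n. N \<le> m \<Longrightarrow> N \<le> n \<Longrightarrow> knrm (ktrunc m X - ktrunc n X) < e"
      using cauchy[OF e] by blast
    from tail[OF this] show ?thesis by (intro exI[of _ N] allI impI knorm_leI)
  qed
  ultimately show "kbdd X \<and> (\<forall>e>0. \<exists>N. \<forall>n\<ge>N. knrm (X - ktrunc n X) \<le> e)" by blast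
next
  assume X: "kbdd X \<and> (\<forall>e>0. \<exists>N. \<forall>n\<ge>N. knrm (X - ktrunc n X) \<le> e)"
  show "X \<in> stab st"
    unfolding stab_def
  proof (intro CollectI allI impI)
    fix e :: real assume "0 < e"
    then have "0 < e / 3" by simp
    then obtain N where N: "\<And>n. N \<le> n \<Longrightarrow> knrm (X - ktrunc n X) \<le> e / 3" using X by blast
    have "knrm (ktrunc m X - ktrunc n X) < e" if "N \<le> m" "N \<le> n" for m n
    proof -
      have b: "kbdd (X - ktrunc n X)" for n using X by (intro kbdd_diff) simp_all
      have b': "kbdd (ktrunc n X - X)" for n using X by (intro kbdd_diff) simp_all
      have "knrm (ktrunc m X - ktrunc n X) \<le> knrm (ktrunc m X - X) + knrm (X - ktrunc n X)"
        by (rule knorm_diff_triangle[OF b' b])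
      also have "\<dots> \<le> e / 3 + e / 3"
        unfolding knorm_diff_commute[OF b] by (intro add_mono N that)
      finally show ?thesis using \<open>0 < e\<close> by simp
    qed
    then show "\<exists>N. \<forall>m\<ge>N. \<forall>n\<ge>N. knrm (ktrunc m X - ktrunc n X) < e" by blast
  qed
qed

lemma stab_kbdd: "X \<in> stab st \<Longrightarrow> kbdd X"
  by (simp add: stab_iff)

lemma ktrunc_ktrunc: "m \<le> n \<Longrightarrow> ktrunc n (ktrunc m X) = ktrunc m X"
  by (auto simp: ktrunc_def fun_eq_iff)

lemma stab_ktrunc: "ktrunc m X \<in> stab st"
  unfolding stab_def
proof (intro CollectI allI impI exI[of _ m])
  fix e :: real and k n assume "0 < e" "m \<le> k" "m \<le> n"
  show "knrm (ktrunc k (ktrunc m X) - ktrunc n (ktrunc m X)) < e"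
    using knorm_zero_le \<open>0 < e\<close> \<open>m \<le> k\<close> \<open>m \<le> n\<close> by (simp add: ktrunc_ktrunc fun_diff_def)
qed

lemma stab_finite_support:
  assumes "\<And>i j. m \<le> i \<or> m \<le> j \<Longrightarrow> X i j = 0"
  shows "X \<in> stab st"
proof -
  have "ktrunc m X i j = X i j" for i j
    using assms[of i j] by (cases "i < m \<and> j < m") (auto simp: ktrunc_def)
  then have "ktrunc m X = X" by (intro ext)
  then show ?thesis using stab_ktrunc[of m X] by simp
qed

lemma stab_limitI:
  assumes "\<And>e. 0 < e \<Longrightarrow> \<exists>Y\<in>stab st. kbdd (X - Y) \<and> knrm (X - Y) \<le> e"
  shows "X \<in> stab st"
  unfolding stab_iff
proof (intro conjI allI impI)
  obtain Y where Y: "Y \<in> stab st" "kbdd (X - Y)" using assms[of 1] by auto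
  from kbdd_add[OF Y(2) stab_kbdd[OF Y(1)]] show "kbdd X" by simp
  fix e :: real assume "0 < e"
  then have e3: "0 < e / 3" by simp
  then obtain Y where Y: "Y \<in> stab st" "kbdd (X - Y)" "knrm (X - Y) \<le> e / 3" using assms by blast
  then obtain N where N: "\<And>n. N \<le> n \<Longrightarrow> knrm (Y - ktrunc n Y) \<le> e / 3"
    using e3 unfolding stab_iff by blast
  have "knrm (X - ktrunc n X) \<le> e" if "N \<le> n" for n
  proof -
    have b: "kbdd (Y - ktrunc n Y)" by (intro kbdd_diff stab_kbdd stab_ktrunc Y)
    have eq: "ktrunc n Y - ktrunc n X = (\<lambda>i j. - ktrunc n (X - Y) i j)"
      by (auto simp: fun_eq_iff ktrunc_def)
    have b': "kbdd (ktrunc n Y - ktrunc n X)" by (intro kbdd_diff) simp_all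
    have "knrm (ktrunc n Y - ktrunc n X) \<le> knrm (X - Y)"
      unfolding eq by (simp add: knorm_minus knorm_ktrunc_le Y)
    then show ?thesis
      using knorm_diff_triangle(1)[OF Y(2) knorm_diff_triangle(2)[OF b b']]
        knorm_diff_triangle(1)[OF b b'] Y(3) N[OF that] by linarith
  qed
  then show "\<exists>N. \<forall>n\<ge>N. knrm (X - ktrunc n X) \<le> e" by blast
qed

lemma stab_trunc_approx:
  assumes "X \<in> stab st" "0 < e"
  obtains n where "knrm (X - ktrunc n X) \<le> e"
  using assms unfolding stab_iff by blast

lemma stab_add:
  assumes X: "X \<in> stab st" and Y: "Y \<in> stab st"
  shows "(\<lambda>i j. X i j + Y i j) \<in> stab st"
  unfolding stab_iff
proof (intro conjI allI impI)
  show "kbdd (\<lambda>i j. X i j + Y i j)" by (intro kbdd_add stab_kbdd assms)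
  fix e :: real assume "0 < e"
  then have "0 < e / 2" by simp
  then obtain M N where MN: "\<And>n. M \<le> n \<Longrightarrow> knrm (X - ktrunc n X) \<le> e / 2"
    "\<And>n. N \<le> n \<Longrightarrow> knrm (Y - ktrunc n Y) \<le> e / 2" using X Y unfolding stab_iff by metis
  have "knrm ((\<lambda>i j. X i j + Y i j) - ktrunc n (\<lambda>i j. X i j + Y i j)) \<le> e" if "M + N \<le> n" for n
  proof -
    have "(\<lambda>i j. X i j + Y i j) - ktrunc n (\<lambda>i j. X i j + Y i j)
      = (\<lambda>i j. (X - ktrunc n X) i j + (Y - ktrunc n Y) i j)"
      by (auto simp: ktrunc_def fun_eq_iff)
    then have "knrm ((\<lambda>i j. X i j + Y i j) - ktrunc n (\<lambda>i j. X i j + Y i j))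
      \<le> knrm (X - ktrunc n X) + knrm (Y - ktrunc n Y)"
      using knorm_add[OF kbdd_diff kbdd_diff] X Y stab_kbdd by simp
    then show ?thesis using MN(1)[of n] MN(2)[of n] that by linarith
  qed
  then show "\<exists>N. \<forall>n\<ge>N. knrm ((\<lambda>i j. X i j + Y i j) - ktrunc n (\<lambda>i j. X i j + Y i j)) \<le> e" by blast
qed

lemma stab_cs:
  assumes X: "X \<in> stab st"
  shows "(\<lambda>i j. cs c (X i j)) \<in> stab st"
proof (rule stab_limitI)
  fix e :: real assume "0 < e"
  define K where "K = cmod c + 1"
  have K: "0 < K" "cmod c \<le> K" by (simp_all add: K_def add_nonneg_pos)
  then have "0 < e / K" using \<open>0 < e\<close> by simp
  then obtain n where n: "knrm (X - ktrunc n X) \<le> e / K" using X stab_trunc_approx by blast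
  let ?Y = "\<lambda>i j. cs c (ktrunc n X i j)"
  have b: "kbdd (X - ktrunc n X)" by (intro kbdd_diff stab_kbdd stab_ktrunc X)
  have "?Y \<in> stab st" by (rule stab_finite_support[of n]) (auto simp: ktrunc_def)
  moreover have eq: "(\<lambda>i j. cs c (X i j)) - ?Y = (\<lambda>i j. cs c ((X - ktrunc n X) i j))"
    by (simp add: fun_eq_iff cs_diff_right)
  moreover have "cmod c * knrm (X - ktrunc n X) \<le> K * (e / K)"
    by (rule mult_mono) (use n knorm_nonneg[OF b] K in simp_all)
  then have "cmod c * knrm (X - ktrunc n X) \<le> e" using K by simp
  ultimately show "\<exists>Y\<in>stab st. kbdd ((\<lambda>i j. cs c (X i j)) - Y) \<and> knrm ((\<lambda>i j. cs c (X i j)) - Y) \<le> e"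
    using kbdd_cs[OF b, of c] knorm_cs[OF b, of c] by (intro bexI[of _ ?Y]) simp_all
qed

lemma stab_minus: "X \<in> stab st \<Longrightarrow> (\<lambda>i j. - X i j) \<in> stab st"
  using stab_cs[of X "-1"] by (simp add: cs_minus_one)

lemma stab_scaleR: "X \<in> stab st \<Longrightarrow> (\<lambda>i j. r *\<^sub>R X i j) \<in> stab st"
  using stab_cs[of X "of_real r"] by (simp add: cs_of_real)

lemma stab_diff: "X \<in> stab st \<Longrightarrow> Y \<in> stab st \<Longrightarrow> X - Y \<in> stab st"
  using stab_add[OF _ stab_minus, of X Y] by (simp add: fun_diff_def)

lemma stab_zero: "(\<lambda>i j. 0) \<in> stab st"
  by (rule stab_finite_support[of 0]) simp

lemma kbdd_stab_diff: "X \<in> stab st \<Longrightarrow> Y \<in> stab st \<Longrightarrow> kbdd (X - Y)"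
  by (intro stab_kbdd stab_diff)

lemma stab_kstar:
  assumes X: "X \<in> stab st"
  shows "kstar st X \<in> stab st"
proof (rule stab_limitI)
  fix e :: real assume "0 < e"
  then obtain n where n: "knrm (X - ktrunc n X) \<le> e" using X stab_trunc_approx by blast
  have b: "kbdd (X - ktrunc n X)" by (intro kbdd_diff stab_kbdd stab_ktrunc X)
  have eq: "kstar st X - kstar st (ktrunc n X) = kstar st (X - ktrunc n X)"
    by (simp add: fun_eq_iff kstar_def st_diff)
  have "kstar st (ktrunc n X) \<in> stab st"
    by (rule stab_finite_support[of n]) (auto simp: ktrunc_def kstar_def)
  then show "\<exists>Y\<in>stab st. kbdd (kstar st X - Y) \<and> knrm (kstar st X - Y) \<le> e"
    using n by (intro bexI[of _ "kstar st (ktrunc n X)"]) (simp_all add: eq kbdd_kstar knorm_kstar b)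
qed

text \<open>For m > i the i-th row of \<open>X - ktrunc m X\<close> is the tail of the i-th row of
  \<open>X\<close>. A piece of the series beyond \<open>m\<close> is thus one entry of a finite
  matrix product and is bounded by its norm.\<close>

lemma kmult_summable:
  assumes X: "X \<in> stab st" and Y: "kbdd Y"
  shows "summable (\<lambda>k. X i k * Y k j)"
  unfolding summable_Cauchy
proof (intro allI impI)
  fix e :: real assume e: "0 < e"
  define K where "K = knrm Y + 1"
  have Y0: "0 < K" using knorm_nonneg[OF Y] by (simp add: K_def)
  then have "0 < e / K / 2" using e by simp
  then obtain N where N: "\<And>n. N \<le> n \<Longrightarrow> knrm (X - ktrunc n X) \<le> e / K / 2"
    using X unfolding stab_iff by blast
  have "norm (\<Sum>k\<in>{m..<n}. X i k * Y k j) < e" if m: "Suc (N + i + j) \<le> m" for m n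
  proof (cases "m \<le> n")
    case True
    let ?Z = "X - ktrunc m X"
    have b: "kbdd ?Z" by (intro kbdd_diff stab_kbdd stab_ktrunc X)
    have "(\<Sum>k\<in>{m..<n}. X i k * Y k j) = mm n ?Z Y i j"
    proof -
      have "mm n ?Z Y i j = (\<Sum>k<n. if m \<le> k then X i k * Y k j else 0)"
        unfolding mm_def using m by (intro sum.cong) (auto simp: ktrunc_def)
      also have "\<dots> = (\<Sum>k\<in>{..<n} \<inter> {k. m \<le> k}. X i k * Y k j)" by (simp add: sum.inter_restrict)
      also have "{..<n} \<inter> {k. m \<le> k} = {m..<n}" by auto
      finally show ?thesis by (rule sym)
    qed
    also have "norm \<dots> \<le> mnrm n (mm n ?Z Y)" using m True by (intro norm_entry_le) auto
    also have "\<dots> \<le> mnrm n ?Z * mnrm n Y" by (rule mnorm_mm)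
    also have "\<dots> \<le> (e / K / 2) * K"
    proof (intro mult_mono mnorm_nonneg)
      show "mnrm n ?Z \<le> e / K / 2"
        using mnorm_le_knorm[OF b, of n] N[of m] m by simp
      show "mnrm n Y \<le> K" using mnorm_le_knorm[OF Y, of n] by (simp add: K_def)
    qed (use e Y0 in simp)
    also have "\<dots> = e / 2" using Y0 by simp
    finally show ?thesis using e by simp
  qed (use e in simp)
  then show "\<exists>N. \<forall>m\<ge>N. \<forall>n. norm (\<Sum>k\<in>{m..<n}. X i k * Y k j) < e" by blast
qed

lemma kmult_tendsto:
  assumes "X \<in> stab st" "kbdd Y"
  shows "(\<lambda>n. mm n X Y i j) \<longlonglongrightarrow> kmult X Y i j"
  unfolding mm_def kmult_def by (rule summable_LIMSEQ[OF kmult_summable[OF assms]])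

lemma
  assumes X: "X \<in> stab st" and Y: "kbdd Y"
  shows kbdd_kmult: "kbdd (kmult X Y)" and knorm_kmult: "knrm (kmult X Y) \<le> knrm X * knrm Y"
proof -
  have "mnrm N (kmult X Y) \<le> knrm X * knrm Y" for N
  proof (rule mnorm_limit[OF kmult_tendsto[OF X Y]])
    show "\<forall>\<^sub>F n in sequentially. mnrm N (mm n X Y) \<le> knrm X * knrm Y"
      using eventually_ge_at_top[of N]
    proof eventually_elim
      case (elim n)
      have "mnrm N (mm n X Y) \<le> mnrm n (mm n X Y)" by (rule mnorm_mono_index[OF elim])
      also have "\<dots> \<le> mnrm n X * mnrm n Y" by (rule mnorm_mm)
      also have "\<dots> \<le> knrm X * knrm Y"
        by (intro mult_mono mnorm_le_knorm mnorm_nonneg knorm_nonneg stab_kbdd X Y)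
      finally show ?case .
    qed
    show "0 \<le> knrm X * knrm Y" by (intro mult_nonneg_nonneg knorm_nonneg stab_kbdd X Y)
  qed
  then show "kbdd (kmult X Y)" "knrm (kmult X Y) \<le> knrm X * knrm Y"
    by (intro kbddI knorm_leI; assumption)+
qed

lemma kmult_add_left:
  assumes "X \<in> stab st" "X' \<in> stab st" "kbdd Y"
  shows "kmult (\<lambda>i j. X i j + X' i j) Y = (\<lambda>i j. kmult X Y i j + kmult X' Y i j)"
  using suminf_add[OF kmult_summable[OF assms(1,3)] kmult_summable[OF assms(2,3)]]
  by (simp add: kmult_def fun_eq_iff distrib_right)

lemma kmult_add_right:
  assumes "X \<in> stab st" "kbdd Y" "kbdd Y'"
  shows "kmult X (\<lambda>i j. Y i j + Y' i j) = (\<lambda>i j. kmult X Y i j + kmult X Y' i j)"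
  using suminf_add[OF kmult_summable[OF assms(1,2)] kmult_summable[OF assms(1,3)]]
  by (simp add: kmult_def fun_eq_iff distrib_left)

lemma kmult_diff_left:
  assumes "X \<in> stab st" "X' \<in> stab st" "kbdd Y"
  shows "kmult (X - X') Y = kmult X Y - kmult X' Y"
  using suminf_diff[OF kmult_summable[OF assms(1,3)] kmult_summable[OF assms(2,3)]]
  by (simp add: kmult_def fun_eq_iff left_diff_distrib)

lemma kmult_diff_right:
  assumes "X \<in> stab st" "kbdd Y" "kbdd Y'"
  shows "kmult X (Y - Y') = kmult X Y - kmult X Y'"
  using suminf_diff[OF kmult_summable[OF assms(1,2)] kmult_summable[OF assms(1,3)]]
  by (simp add: kmult_def fun_eq_iff right_diff_distrib)

lemma kmult_cs:
  assumes "X \<in> stab st" "kbdd Y"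
  shows "kmult (\<lambda>i j. cs c (X i j)) Y = (\<lambda>i j. cs c (kmult X Y i j))"
    "kmult X (\<lambda>i j. cs c (Y i j)) = (\<lambda>i j. cs c (kmult X Y i j))"
proof -
  have bl: "bounded_linear (cs c)"
  proof (rule bounded_linear_intro[where K = "cmod c"])
    show "cs c (r *\<^sub>R x) = r *\<^sub>R cs c x" for r x
      by (simp add: cs_cs mult.commute flip: cs_of_real)
  qed (simp_all add: cs_add_right norm_cs mult.commute)
  show "kmult (\<lambda>i j. cs c (X i j)) Y = (\<lambda>i j. cs c (kmult X Y i j))"
    "kmult X (\<lambda>i j. cs c (Y i j)) = (\<lambda>i j. cs c (kmult X Y i j))"
    using bounded_linear.suminf[OF bl kmult_summable[OF assms]]
    by (simp_all add: kmult_def fun_eq_iff cs_mult_left cs_mult_right)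
qed

lemma kstar_kmult:
  assumes "X \<in> stab st" "Y \<in> stab st"
  shows "kstar st (kmult X Y) = kmult (kstar st Y) (kstar st X)"
  using bounded_linear.suminf[OF bounded_linear_st kmult_summable[OF assms(1) stab_kbdd[OF assms(2)]]]
  by (simp add: kmult_def kstar_def fun_eq_iff st_mult)

lemma kmult_ktrunc: "kmult (ktrunc n X) (ktrunc n Y) = ktrunc n (mm n X Y)"
proof (intro ext)
  fix i j
  have "(\<Sum>k. ktrunc n X i k * ktrunc n Y k j) = (\<Sum>k<n. ktrunc n X i k * ktrunc n Y k j)"
    by (rule suminf_finite) (auto simp: ktrunc_def)
  also have "\<dots> = ktrunc n (mm n X Y) i j"
    by (auto simp: ktrunc_def mm_def intro!: sum.cong)
  finally show "kmult (ktrunc n X) (ktrunc n Y) i j = ktrunc n (mm n X Y) i j" by (simp add: kmult_def)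
qed

definition kconv :: "(nat \<Rightarrow> 'a kmat) \<Rightarrow> 'a kmat \<Rightarrow> bool" where
  "kconv F X \<longleftrightarrow> (\<lambda>n. knrm (F n - X)) \<longlonglongrightarrow> 0"

lemma kconv_ktrunc:
  assumes "X \<in> stab st"
  shows "kconv (\<lambda>n. ktrunc n X) X"
  unfolding kconv_def
proof (rule LIMSEQ_I)
  have b: "kbdd (X - ktrunc n X)" for n by (intro kbdd_diff stab_kbdd stab_ktrunc assms)
  fix e :: real assume "0 < e"
  then have "0 < e / 2" by simp
  then obtain N where N: "\<And>n. N \<le> n \<Longrightarrow> knrm (X - ktrunc n X) \<le> e / 2"
    using assms unfolding stab_iff by blast
  have "norm (knrm (ktrunc n X - X) - 0) < e" if "N \<le> n" for n
    using N[OF that] knorm_nonneg[OF b, of n] \<open>0 < e\<close> by (simp add: knorm_diff_commute[OF b])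
  then show "\<exists>N. \<forall>n\<ge>N. norm (knrm (ktrunc n X - X) - 0) < e" by blast
qed

lemma kmult_diff_bound:
  assumes "X \<in> stab st" "Y \<in> stab st" "X' \<in> stab st" "Y' \<in> stab st"
  shows "knrm (kmult X' Y' - kmult X Y) \<le> knrm (X' - X) * knrm Y' + knrm X * knrm (Y' - Y)"
proof -
  have 1: "knrm (kmult X' Y' - kmult X Y') \<le> knrm (X' - X) * knrm Y'"
    using knorm_kmult[OF stab_diff[OF assms(3,1)] stab_kbdd[OF assms(4)]]
    by (simp add: kmult_diff_left assms stab_kbdd)
  have 2: "knrm (kmult X Y' - kmult X Y) \<le> knrm X * knrm (Y' - Y)"
    using knorm_kmult[OF assms(1) kbdd_stab_diff[OF assms(4,2)]]
    by (simp add: kmult_diff_right assms stab_kbdd)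
  have "knrm (kmult X' Y' - kmult X Y) \<le> knrm (kmult X' Y' - kmult X Y') + knrm (kmult X Y' - kmult X Y)"
    by (rule knorm_diff_triangle(1); intro kbdd_diff kbdd_kmult assms stab_kbdd[OF assms(4)] stab_kbdd[OF assms(2)])
  then show ?thesis using 1 2 by linarith
qed

lemma knorm_le_diff:
  assumes "kbdd X" "kbdd Y"
  shows "knrm Y \<le> knrm (Y - X) + knrm X"
  using knorm_add[OF kbdd_diff[OF assms(2,1)] assms(1)] by simp

lemma kconv_kmult:
  assumes F: "\<And>n. F n \<in> stab st" "X \<in> stab st" "kconv F X"
    and G: "\<And>n. G n \<in> stab st" "Y \<in> stab st" "kconv G Y"
  shows "kconv (\<lambda>n. kmult (F n) (G n)) (kmult X Y)"
  unfolding kconv_def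
proof (rule tendsto_sandwich[OF _ _ tendsto_const])
  let ?a = "\<lambda>n. knrm (F n - X)" and ?b = "\<lambda>n. knrm (G n - Y)"
  show "\<forall>\<^sub>F n in sequentially. 0 \<le> knrm (kmult (F n) (G n) - kmult X Y)"
    by (intro always_eventually allI knorm_nonneg kbdd_diff kbdd_kmult stab_kbdd F G)
  show "\<forall>\<^sub>F n in sequentially. knrm (kmult (F n) (G n) - kmult X Y) \<le> ?a n * (?b n + knrm Y) + knrm X * ?b n"
  proof (intro always_eventually allI order_trans[OF kmult_diff_bound] add_right_mono mult_left_mono)
    show "knrm (G n) \<le> ?b n + knrm Y" for n by (intro knorm_le_diff stab_kbdd G)
    show "0 \<le> ?a n" for n by (intro knorm_nonneg kbdd_stab_diff F)
  qed (use F G in auto)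
  have "(\<lambda>n. ?a n * (?b n + knrm Y) + knrm X * ?b n) \<longlonglongrightarrow> 0 * (0 + knrm Y) + knrm X * 0"
    using F(3) G(3) unfolding kconv_def by (intro tendsto_intros)
  then show "(\<lambda>n. ?a n * (?b n + knrm Y) + knrm X * ?b n) \<longlonglongrightarrow> 0" by simp
qed

lemma stab_kmult:
  assumes X: "X \<in> stab st" and Y: "Y \<in> stab st"
  shows "kmult X Y \<in> stab st"
proof (rule stab_limitI)
  fix e :: real assume "0 < e"
  have "kconv (\<lambda>n. kmult (ktrunc n X) (ktrunc n Y)) (kmult X Y)"
    by (intro kconv_kmult kconv_ktrunc stab_ktrunc X Y)
  then obtain n where n: "norm (knrm (kmult (ktrunc n X) (ktrunc n Y) - kmult X Y) - 0) < e"
    using LIMSEQ_D \<open>0 < e\<close> unfolding kconv_def by blast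
  have b: "kbdd (kmult X Y - kmult (ktrunc n X) (ktrunc n Y))"
    by (intro kbdd_diff kbdd_kmult stab_ktrunc stab_kbdd X Y)
  have "knrm (kmult X Y - kmult (ktrunc n X) (ktrunc n Y)) \<le> e"
    using n by (simp add: knorm_diff_commute[OF b])
  then show "\<exists>Z\<in>stab st. kbdd (kmult X Y - Z) \<and> knrm (kmult X Y - Z) \<le> e"
    using b stab_ktrunc[of n "mm n X Y"] unfolding kmult_ktrunc by blast
qed

lemma kconv_unique:
  assumes F: "\<And>n. F n \<in> stab st" "X \<in> stab st" "Y \<in> stab st" "kconv F X" "kconv F Y"
  shows "X = Y"
proof -
  have "knrm (X - Y) \<le> knrm (F n - X) + knrm (F n - Y)" for n
    using knorm_diff_triangle(1)[OF kbdd_stab_diff kbdd_stab_diff, of X "F n" Y] F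
      knorm_diff_commute[OF kbdd_stab_diff, of "F n" X] by simp
  moreover have "(\<lambda>n. knrm (F n - X) + knrm (F n - Y)) \<longlonglongrightarrow> 0 + 0"
    using F(4,5) unfolding kconv_def by (rule tendsto_add)
  ultimately have "knrm (X - Y) \<le> 0 + 0" by (intro LIMSEQ_le_const) auto
  then have "X - Y = (\<lambda>i j. 0)" using knorm_eq_0[OF kbdd_stab_diff[OF F(2,3)]] by simp
  then show ?thesis by (simp add: fun_eq_iff)
qed

text \<open>For truncations this is an exchange of two finite sums; norm continuity of the product
  extends it, so no infinite sums have to be exchanged.\<close>

lemma kmult_assoc:
  assumes X: "X \<in> stab st" and Y: "Y \<in> stab st" and Z: "Z \<in> stab st"
  shows "kmult (kmult X Y) Z = kmult X (kmult Y Z)"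
proof (rule kconv_unique)
  let ?F = "\<lambda>n. kmult (kmult (ktrunc n X) (ktrunc n Y)) (ktrunc n Z)"
  show "?F n \<in> stab st" for n by (intro stab_kmult stab_ktrunc)
  show "kmult (kmult X Y) Z \<in> stab st" "kmult X (kmult Y Z) \<in> stab st" by (intro stab_kmult X Y Z)+
  show "kconv ?F (kmult (kmult X Y) Z)"
    by (intro kconv_kmult stab_kmult kconv_ktrunc stab_ktrunc X Y Z)
  have "?F n = kmult (ktrunc n X) (kmult (ktrunc n Y) (ktrunc n Z))" for n
  proof -
    have "mm n (mm n X Y) Z = mm n X (mm n Y Z)"
    proof (intro ext)
      fix i j
      have "mm n (mm n X Y) Z i j = (\<Sum>k<n. \<Sum>l<n. X i l * (Y l k * Z k j))"
        by (simp add: mm_def sum_distrib_right mult.assoc)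
      also have "\<dots> = (\<Sum>l<n. \<Sum>k<n. X i l * (Y l k * Z k j))" by (rule sum.swap)
      also have "\<dots> = mm n X (mm n Y Z) i j" by (simp add: mm_def sum_distrib_left)
      finally show "mm n (mm n X Y) Z i j = mm n X (mm n Y Z) i j" .
    qed
    then show ?thesis by (simp add: kmult_ktrunc)
  qed
  moreover have "kconv (\<lambda>n. kmult (ktrunc n X) (kmult (ktrunc n Y) (ktrunc n Z))) (kmult X (kmult Y Z))"
    by (intro kconv_kmult stab_kmult kconv_ktrunc stab_ktrunc X Y Z)
  ultimately show "kconv ?F (kmult X (kmult Y Z))" by simp
qed

text \<open>The lower bound comes from finite corners. A corner of the infinite product is not the
  product of corners, so \<open>mnorm_sq_le\<close> is applied to products of truncations, which
  converge in norm.\<close>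

lemma knorm_kstar_kmult:
  assumes X: "X \<in> stab st"
  shows "knrm (kmult (kstar st X) X) = (knrm X)\<^sup>2"
proof (rule antisym)
  have kX: "kbdd X" and sX: "kstar st X \<in> stab st" using X by (auto intro: stab_kbdd stab_kstar)
  show "knrm (kmult (kstar st X) X) \<le> (knrm X)\<^sup>2"
    using knorm_kmult[OF sX kX] by (simp add: knorm_kstar[OF kX] power2_eq_square)
  let ?Z = "kmult (kstar st X) X"
  let ?F = "\<lambda>n. kmult (ktrunc n (kstar st X)) (ktrunc n X)"
  have conv: "kconv ?F ?Z" by (intro kconv_kmult kconv_ktrunc stab_ktrunc X sX)
  have "(mnrm N X)\<^sup>2 \<le> knrm ?Z" for N
  proof (rule field_le_epsilon)
    fix e :: real assume "0 < e"
    then obtain M where M: "\<And>n. M \<le> n \<Longrightarrow> norm (knrm (?F n - ?Z) - 0) < e"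
      using LIMSEQ_D conv unfolding kconv_def by blast
    define n where "n = max M N"
    have "(mnrm N X)\<^sup>2 \<le> (mnrm n X)\<^sup>2"
      by (intro power_mono mnorm_mono_index mnorm_nonneg) (simp add: n_def)
    also have "\<dots> \<le> mnrm n (mm n (kstar st X) X)" by (rule mnorm_sq_le)
    also have "\<dots> = mnrm n (?F n)"
      unfolding kmult_ktrunc by (rule mnorm_cong) (simp add: ktrunc_def)
    also have "\<dots> \<le> knrm (?F n)" unfolding kmult_ktrunc by (intro mnorm_le_knorm) simp
    also have "\<dots> \<le> knrm (?F n - ?Z) + knrm ?Z"
      by (intro knorm_le_diff kbdd_kmult stab_ktrunc kX sX kbdd_ktrunc)
    also have "\<dots> \<le> e + knrm ?Z" using M[of n] by (simp add: n_def)
    finally show "(mnrm N X)\<^sup>2 \<le> knrm ?Z + e" by simp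
  qed
  then have "mnrm N X \<le> sqrt (knrm ?Z)" for N by (rule real_le_rsqrt)
  then have "knrm X \<le> sqrt (knrm ?Z)" by (rule knorm_leI)
  then have "(knrm X)\<^sup>2 \<le> (sqrt (knrm ?Z))\<^sup>2" by (rule power_mono) (rule knorm_nonneg[OF kX])
  then show "(knrm X)\<^sup>2 \<le> knrm ?Z" by (simp add: knorm_nonneg kbdd_kmult sX kX)
qed

text \<open>The limit inherits the modulus of convergence: the same \<open>N\<close> serves the same
  \<open>e\<close>. This uniformity allows limits to be taken in all factors of the product at
  once.\<close>

lemma stab_complete:
  fixes F :: "nat \<Rightarrow> 'a kmat"
  assumes F: "\<And>n. F n \<in> stab st"
    and cauchy: "\<And>e. 0 < e \<Longrightarrow> \<exists>N. \<forall>m\<ge>N. \<forall>n\<ge>N. knrm (F m - F n) \<le> e"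
  shows "\<exists>X\<in>stab st. \<forall>e>0. \<forall>N. (\<forall>m\<ge>N. \<forall>n\<ge>N. knrm (F m - F n) \<le> e) \<longrightarrow> (\<forall>m\<ge>N. knrm (F m - X) \<le> e)"
proof -
  have "\<exists>x. (\<lambda>n. F n i j) \<longlonglongrightarrow> x" for i j
  proof -
    have "Cauchy (\<lambda>n. F n i j)"
    proof (rule CauchyI)
      fix e :: real assume e: "0 < e"
      then obtain N where N: "\<And>m n. N \<le> m \<Longrightarrow> N \<le> n \<Longrightarrow> knrm (F m - F n) \<le> e / 2"
        using cauchy[of "e / 2"] by auto
      have "norm (F m i j - F n i j) < e" if "N \<le> m" "N \<le> n" for m n
        using norm_entry_le_knorm[OF kbdd_stab_diff[OF F F], of m n i j] N[OF that] e by simp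
      then show "\<exists>M. \<forall>m\<ge>M. \<forall>n\<ge>M. norm (F m i j - F n i j) < e" by blast
    qed
    then show ?thesis using Cauchy_convergent convergent_def by blast
  qed
  then obtain X where X: "\<And>i j. (\<lambda>n. F n i j) \<longlonglongrightarrow> X i j" by metis
  have lim: "mnrm k (F m - X) \<le> e"
    if "\<forall>m\<ge>N. \<forall>n\<ge>N. knrm (F m - F n) \<le> e" "N \<le> m" "0 < e" for e N m k
  proof (rule mnorm_limit)
    show "(\<lambda>n. (F m - F n) i j) \<longlonglongrightarrow> (F m - X) i j" for i j
      unfolding fun_diff_def by (intro tendsto_intros X)
    show "\<forall>\<^sub>F n in sequentially. mnrm k (F m - F n) \<le> e"
      using eventually_ge_at_top[of N]
    proof eventually_elim
      case (elim n)
      then show ?case using that mnorm_le_knorm[OF kbdd_stab_diff[OF F F], of k m n] by fastforce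
    qed
  qed (use that in simp)
  have "X \<in> stab st"
  proof (rule stab_limitI)
    fix e :: real assume "0 < e"
    then obtain N where N: "\<forall>m\<ge>N. \<forall>n\<ge>N. knrm (F m - F n) \<le> e" using cauchy by blast
    have b: "kbdd (F N - X)" by (rule kbddI[OF lim[OF N order.refl \<open>0 < e\<close>]])
    have "knrm (F N - X) \<le> e" by (rule knorm_leI[OF lim[OF N order.refl \<open>0 < e\<close>]])
    then have "knrm (X - F N) \<le> e" by (simp add: knorm_diff_commute[OF b])
    moreover have "kbdd (X - F N)" using kbdd_minus[OF b] by (simp add: fun_diff_def)
    ultimately show "\<exists>Y\<in>stab st. kbdd (X - Y) \<and> knrm (X - Y) \<le> e" using F by blast
  qed
  then show ?thesis using lim knorm_leI by (metis (no_types, lifting))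
qed

end

section \<open>A type containing all stabilizations\<close>

text \<open>Left multiplication by the isometry sending the k-th basis vector to the one with index
  2 k + b. The cases b = 0 and b = 1 reproduce the interleaving in \<open>dsum\<close>.\<close>

definition sh :: "nat \<Rightarrow> 'a::zero kmat \<Rightarrow> 'a kmat" where
  "sh b X = (\<lambda>i j. if i mod 2 = b then X (i div 2) j else 0)"

context cstar
begin

text \<open>Rows of \<open>sh b X\<close> below \<open>N\<close> are zero or copies of distinct rows
  of \<open>X\<close> below \<open>N\<close>, so norms of image vectors do not grow.\<close>

lemma mnorm_sh_le:
  assumes "b < 2"
  shows "mnrm N (sh b X) \<le> mnrm N X"
proof (rule mnorm_leI[OF _ mnorm_nonneg])
  fix \<xi> :: "nat \<Rightarrow> 'a"
  let ?g = "\<lambda>i. st (mvec N X \<xi> i) * mvec N X \<xi> i"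
  let ?K = "{k. 2 * k + b < N}"
  have mv: "mvec N (sh b X) \<xi> i = (if i mod 2 = b then mvec N X \<xi> (i div 2) else 0)" for i
    by (simp add: mvec_def sh_def)
  have K: "?K \<subseteq> {..<N}" by auto
  have "ip N (mvec N (sh b X) \<xi>) (mvec N (sh b X) \<xi>) = (\<Sum>i<N. if i mod 2 = b then ?g (i div 2) else 0)"
    unfolding ip_def mv by (intro sum.cong) auto
  also have "\<dots> = (\<Sum>i\<in>{..<N} \<inter> {i. i mod 2 = b}. ?g (i div 2))" by (simp add: sum.inter_restrict)
  also have "\<dots> = (\<Sum>k\<in>?K. ?g k)"
    by (rule sum.reindex_bij_witness[where i = "\<lambda>k. 2 * k + b" and j = "\<lambda>i. i div 2"])
      (use assms in auto)
  finally have "ip N (mvec N X \<xi>) (mvec N X \<xi>) - ip N (mvec N (sh b X) \<xi>) (mvec N (sh b X) \<xi>)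
    = (\<Sum>k\<in>{..<N} - ?K. ?g k)"
    using K by (simp add: ip_def sum_diff)
  then have "pos (ip N (mvec N X \<xi>) (mvec N X \<xi>) - ip N (mvec N (sh b X) \<xi>) (mvec N (sh b X) \<xi>))"
    by (simp add: pos_sum pos_st_mult)
  then have "vn N (mvec N (sh b X) \<xi>) \<le> vn N (mvec N X \<xi>)"
    unfolding vn_def by (intro real_sqrt_le_mono pos_norm_mono pos_ip)
  then show "vn N (mvec N (sh b X) \<xi>) \<le> mnrm N X * vn N \<xi>"
    using vn_mvec_le[of N X \<xi>] by linarith
qed

lemma
  assumes "b < 2" "kbdd X"
  shows kbdd_sh: "kbdd (sh b X)" and knorm_sh_le: "knrm (sh b X) \<le> knrm X"
proof -
  have "mnrm N (sh b X) \<le> knrm X" for N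
    by (rule order_trans[OF mnorm_sh_le[OF assms(1)] mnorm_le_knorm[OF assms(2)]])
  then show "kbdd (sh b X)" "knrm (sh b X) \<le> knrm X" by (intro kbddI knorm_leI; assumption)+
qed

lemma stab_sh:
  assumes b: "b < 2" and X: "X \<in> stab st"
  shows "sh b X \<in> stab st"
proof (rule stab_limitI)
  fix e :: real assume "0 < e"
  then obtain n where n: "knrm (X - ktrunc n X) \<le> e" using X stab_trunc_approx by blast
  have k: "kbdd (X - ktrunc n X)" by (intro kbdd_diff stab_kbdd stab_ktrunc X)
  have eq: "sh b X - sh b (ktrunc n X) = sh b (X - ktrunc n X)"
    by (auto simp: fun_eq_iff sh_def)
  have "sh b (ktrunc n X) \<in> stab st"
    by (rule stab_finite_support[of "2 * n + 2"]) (auto simp: ktrunc_def sh_def)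
  moreover have "knrm (sh b (X - ktrunc n X)) \<le> e" using knorm_sh_le[OF b k] n by simp
  ultimately show "\<exists>Y\<in>stab st. kbdd (sh b X - Y) \<and> knrm (sh b X - Y) \<le> e"
    using kbdd_sh[OF b k] by (intro bexI[of _ "sh b (ktrunc n X)"]) (simp_all only: eq)
qed

lemma sh_inner:
  assumes "b < 2"
  shows "kmult (kstar st (sh b X)) (sh b Y) = kmult (kstar st X) Y"
proof (intro ext)
  fix i j
  let ?f = "\<lambda>k. st (sh b X k i) * sh b Y k j"
  have "(\<Sum>k. ?f (2 * k + b)) = (\<Sum>k. ?f k)"
  proof (rule suminf_mono_reindex)
    show "strict_mono (\<lambda>k. 2 * k + b)" by (simp add: strict_mono_def)
    show "?f k = 0" if "k \<notin> range (\<lambda>k. 2 * k + b)" for k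
    proof (cases "k mod 2 = b")
      case True
      then have "k = 2 * (k div 2) + b" by presburger
      then show ?thesis using that by blast
    qed (simp add: sh_def)
  qed
  moreover have "?f (2 * k + b) = st (X k i) * Y k j" for k using assms by (simp add: sh_def)
  ultimately show "kmult (kstar st (sh b X)) (sh b Y) i j = kmult (kstar st X) Y i j"
    by (simp add: kmult_def kstar_def)
qed

lemma sh_inner_0:
  assumes "b \<noteq> c"
  shows "kmult (kstar st (sh b X)) (sh c Y) = (\<lambda>i j. 0)"
proof (intro ext)
  fix i j
  have "st (sh b X k i) * sh c Y k j = 0" for k using assms by (simp add: sh_def)
  then show "kmult (kstar st (sh b X)) (sh c Y) i j = 0" by (simp add: kmult_def kstar_def)
qed

lemma sh_kmult: "sh b (kmult X Y) = kmult (sh b X) Y"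
  by (auto simp: sh_def kmult_def fun_eq_iff)

lemma sh_kstar: "kstar st (sh b (kstar st (sh b X))) = sh b (kstar st (sh b (kstar st X)))"
  by (auto simp: sh_def kstar_def fun_eq_iff)

lemma dsum_eq_sh:
  "dsum X Y = (\<lambda>i j. sh 0 (kstar st (sh 0 (kstar st X))) i j + sh (Suc 0) (kstar st (sh (Suc 0) (kstar st Y))) i j)"
  by (auto simp: dsum_def sh_def kstar_def fun_eq_iff)

end

text \<open>The stabilization depends on the involution \<open>st\<close>, so it is not a type. The bounded families
  that pick an element of each stabilization, for all C*-structures \<open>(cs, st)\<close> on \<open>'a\<close> at once, do form
  a type, and this type is a C*-algebra (an \<open>\<ell>\<^sup>\<infinity>\<close>-product) having every stabilization as a direct summand.\<close>

type_synonym 'a cstr = "(complex \<Rightarrow> 'a \<Rightarrow> 'a) \<times> ('a \<Rightarrow> 'a)"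

abbreviation valid :: "'a::{real_normed_algebra,banach} cstr \<Rightarrow> bool" where
  "valid p \<equiv> cstar (fst p) (snd p)"

typedef (overloaded) ('a::"{real_normed_algebra,banach}") cfam =
  "{F :: 'a cstr \<Rightarrow> 'a kmat. (\<forall>p. if valid p then F p \<in> stab (snd p) else F p = (\<lambda>i j. 0)) \<and>
      (\<exists>C. \<forall>p. valid p \<longrightarrow> knorm (snd p) (F p) \<le> C)}"
proof -
  have "\<exists>C. \<forall>p :: 'a cstr. valid p \<longrightarrow> knorm (snd p) (\<lambda>i j. 0) \<le> C"
    using cstar.knorm_zero_le by blast
  then show ?thesis by (intro exI[of _ "\<lambda>p i j. 0"]) (simp add: cstar.stab_zero)
qed

definition mkf :: "('a cstr \<Rightarrow> 'a kmat) \<Rightarrow> 'a::{real_normed_algebra,banach} cfam" where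
  "mkf G = Abs_cfam (\<lambda>p. if valid p then G p else (\<lambda>i j. 0))"

lemma Rep_mkf:
  assumes "\<And>p. valid p \<Longrightarrow> G p \<in> stab (snd p)" "\<And>p. valid p \<Longrightarrow> knorm (snd p) (G p) \<le> C"
  shows "Rep_cfam (mkf G) p = (if valid p then G p else (\<lambda>i j. 0))"
proof -
  have "\<exists>C. \<forall>p. valid p \<longrightarrow> knorm (snd p) (if valid p then G p else (\<lambda>i j. 0)) \<le> C"
    using assms(2) by (intro exI[of _ C]) simp
  then show ?thesis
    unfolding mkf_def using assms(1)
    by (subst Abs_cfam_inverse) (simp_all del: split_paired_All split_paired_Ex)
qed

lemma Rep_cfam_iff: "if valid p then Rep_cfam F p \<in> stab (snd p) else Rep_cfam F p = (\<lambda>i j. 0)"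
  and Rep_cfam_bound: "\<exists>C. \<forall>p. valid p \<longrightarrow> knorm (snd p) (Rep_cfam F p) \<le> C"
  using Rep_cfam[of F] unfolding mem_Collect_eq by blast+

lemma Rep_cfam_stab: "valid p \<Longrightarrow> Rep_cfam F p \<in> stab (snd p)"
  using Rep_cfam_iff[of p F] by simp

lemma Rep_cfam_kbdd: "valid p \<Longrightarrow> cstar.kbdd (snd p) (Rep_cfam F p)"
  using Rep_cfam_stab cstar.stab_kbdd by blast

lemma cfam_eqI:
  assumes "\<And>p. valid p \<Longrightarrow> Rep_cfam F p = Rep_cfam G p"
  shows "F = G"
proof -
  have "Rep_cfam F p = Rep_cfam G p" for p
    using Rep_cfam_iff[of p F] Rep_cfam_iff[of p G] assms[of p] by (cases "valid p") simp_all
  then show ?thesis by (metis Rep_cfam_inject ext)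
qed

section \<open>Algebra structure and norm of the product\<close>

instantiation cfam :: ("{real_normed_algebra,banach}") "{zero,plus,minus,uminus,times,scaleR}"
begin

definition "0 = mkf (\<lambda>p i j. 0)"
definition "F + G = mkf (\<lambda>p i j. Rep_cfam F p i j + Rep_cfam G p i j)"
definition "F - G = mkf (\<lambda>p. Rep_cfam F p - Rep_cfam G p)"
definition "- F = mkf (\<lambda>p i j. - Rep_cfam F p i j)"
definition "F * G = mkf (\<lambda>p. kmult (Rep_cfam F p) (Rep_cfam G p))"
definition "r *\<^sub>R F = mkf (\<lambda>p i j. r *\<^sub>R Rep_cfam F p i j)"
instance ..

end

text \<open>Invalid structures contribute 0, so the supremum is 0 if \<open>'a\<close> carries no
  C*-structure at all.\<close>

definition fnorm :: "'a::{real_normed_algebra,banach} cfam \<Rightarrow> real" where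
  "fnorm F = (SUP p. if valid p then knorm (snd p) (Rep_cfam F p) else 0)"

lemma knorm_Rep_le_fnorm:
  assumes "valid p"
  shows "knorm (snd p) (Rep_cfam F p) \<le> fnorm F"
proof -
  obtain C where C: "\<And>p. valid p \<Longrightarrow> knorm (snd p) (Rep_cfam F p) \<le> C" using Rep_cfam_bound by blast
  have "bdd_above (range (\<lambda>p. if valid p then knorm (snd p) (Rep_cfam F p) else 0))"
    by (rule bdd_aboveI2[where M = "max C 0"]) (auto intro: le_max_iff_disj[THEN iffD2] C)
  from cSUP_upper[OF UNIV_I this, of p] show ?thesis using assms by (simp add: fnorm_def)
qed

lemma fnorm_leI:
  assumes "\<And>p. valid p \<Longrightarrow> knorm (snd p) (Rep_cfam F p) \<le> C" "0 \<le> C"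
  shows "fnorm F \<le> C"
  unfolding fnorm_def by (rule cSUP_least) (use assms in auto)

lemma knorm_Rep_nonneg: "valid p \<Longrightarrow> 0 \<le> knorm (snd p) (Rep_cfam F p)"
  by (rule cstar.knorm_nonneg[OF _ Rep_cfam_kbdd])

lemma Rep_zero: "Rep_cfam 0 p = (\<lambda>i j. 0)"
proof -
  have "Rep_cfam (mkf (\<lambda>p i j. 0)) p = (if valid p then (\<lambda>i j. 0) else (\<lambda>i j. 0))"
  proof (rule Rep_mkf)
    fix p :: "'a cstr" assume v: "valid p"
    show "(\<lambda>i j. 0) \<in> stab (snd p)" by (rule cstar.stab_zero[OF v])
    show "knorm (snd p) (\<lambda>i j. 0) \<le> 0" by (rule cstar.knorm_zero_le[OF v])
  qed
  then show ?thesis by (simp add: zero_cfam_def)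
qed

context
  fixes p :: "'a::{real_normed_algebra,banach} cstr"
  assumes v: "valid p"
begin

lemma Rep_plus: "Rep_cfam (F + G) p = (\<lambda>i j. Rep_cfam F p i j + Rep_cfam G p i j)"
proof -
  have "Rep_cfam (mkf (\<lambda>p i j. Rep_cfam F p i j + Rep_cfam G p i j)) p
    = (if valid p then (\<lambda>i j. Rep_cfam F p i j + Rep_cfam G p i j) else (\<lambda>i j. 0))"
    by (rule Rep_mkf[where C = "fnorm F + fnorm G"])
      (auto intro!: cstar.stab_add Rep_cfam_stab order_trans[OF cstar.knorm_add] add_mono knorm_Rep_le_fnorm Rep_cfam_kbdd)
  then show ?thesis using v by (simp add: plus_cfam_def)
qed

lemma Rep_minus: "Rep_cfam (F - G) p = Rep_cfam F p - Rep_cfam G p"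
proof -
  have "Rep_cfam (mkf (\<lambda>p. Rep_cfam F p - Rep_cfam G p)) p
    = (if valid p then Rep_cfam F p - Rep_cfam G p else (\<lambda>i j. 0))"
    by (rule Rep_mkf[where C = "fnorm F + fnorm G"])
      (auto intro!: cstar.stab_diff Rep_cfam_stab order_trans[OF cstar.knorm_diff] add_mono knorm_Rep_le_fnorm Rep_cfam_kbdd)
  then show ?thesis using v by (simp add: minus_cfam_def)
qed

lemma Rep_uminus: "Rep_cfam (- F) p = (\<lambda>i j. - Rep_cfam F p i j)"
proof -
  have "Rep_cfam (mkf (\<lambda>p i j. - Rep_cfam F p i j)) p
    = (if valid p then (\<lambda>i j. - Rep_cfam F p i j) else (\<lambda>i j. 0))"
    by (rule Rep_mkf[where C = "fnorm F"])
      (auto intro!: cstar.stab_minus Rep_cfam_stab knorm_Rep_le_fnorm simp: cstar.knorm_minus Rep_cfam_kbdd)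
  then show ?thesis using v by (simp add: uminus_cfam_def)
qed

lemma Rep_scaleR: "Rep_cfam (r *\<^sub>R F) p = (\<lambda>i j. r *\<^sub>R Rep_cfam F p i j)"
proof -
  have kn: "knorm (snd q) (\<lambda>i j. r *\<^sub>R Rep_cfam F q i j) = \<bar>r\<bar> * knorm (snd q) (Rep_cfam F q)"
    if q: "valid q" for q
    using cstar.knorm_cs[OF q Rep_cfam_kbdd[OF q], of "of_real r"] by (simp add: cstar.cs_of_real[OF q])
  have "Rep_cfam (mkf (\<lambda>p i j. r *\<^sub>R Rep_cfam F p i j)) p
    = (if valid p then (\<lambda>i j. r *\<^sub>R Rep_cfam F p i j) else (\<lambda>i j. 0))"
    by (rule Rep_mkf[where C = "\<bar>r\<bar> * fnorm F"])
      (auto intro!: cstar.stab_scaleR Rep_cfam_stab mult_left_mono knorm_Rep_le_fnorm simp: kn)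
  then show ?thesis using v by (simp add: scaleR_cfam_def)
qed

lemma knorm_Rep_scaleR: "knorm (snd p) (Rep_cfam (r *\<^sub>R F) p) = \<bar>r\<bar> * knorm (snd p) (Rep_cfam F p)"
  using cstar.knorm_cs[OF v Rep_cfam_kbdd[OF v], of "of_real r"]
  by (simp add: Rep_scaleR cstar.cs_of_real[OF v])

lemma Rep_times: "Rep_cfam (F * G) p = kmult (Rep_cfam F p) (Rep_cfam G p)"
proof -
  have "Rep_cfam (mkf (\<lambda>p. kmult (Rep_cfam F p) (Rep_cfam G p))) p
    = (if valid p then kmult (Rep_cfam F p) (Rep_cfam G p) else (\<lambda>i j. 0))"
    by (rule Rep_mkf[where C = "fnorm F * fnorm G"])
      (auto intro!: cstar.stab_kmult Rep_cfam_stab order_trans[OF cstar.knorm_kmult] mult_mono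
        knorm_Rep_le_fnorm Rep_cfam_kbdd knorm_Rep_nonneg order_trans[OF knorm_Rep_nonneg knorm_Rep_le_fnorm])
  then show ?thesis using v by (simp add: times_cfam_def)
qed

end

lemma fnorm_nonneg: "0 \<le> fnorm (F :: 'a::{real_normed_algebra,banach} cfam)"
proof (cases "\<exists>p :: 'a cstr. valid p")
  case True
  then show ?thesis using knorm_Rep_nonneg knorm_Rep_le_fnorm order_trans by blast
qed (simp add: fnorm_def)

instance cfam :: ("{real_normed_algebra,banach}") real_algebra
proof
  fix F G H :: "'a cfam" and r s :: real
  note [simp] = Rep_plus Rep_minus Rep_uminus Rep_scaleR Rep_times Rep_zero
  show "F + G + H = F + (G + H)" by (rule cfam_eqI) (simp add: add.assoc)
  show "F + G = G + F" by (rule cfam_eqI) (simp add: add.commute)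
  show "0 + F = F" by (rule cfam_eqI) simp
  show "- F + F = 0" by (rule cfam_eqI) simp
  show "F - G = F + - G" by (rule cfam_eqI) (simp add: fun_eq_iff)
  show "r *\<^sub>R (F + G) = r *\<^sub>R F + r *\<^sub>R G" by (rule cfam_eqI) (simp add: scaleR_add_right)
  show "(r + s) *\<^sub>R F = r *\<^sub>R F + s *\<^sub>R F" by (rule cfam_eqI) (simp add: scaleR_add_left)
  show "r *\<^sub>R s *\<^sub>R F = (r * s) *\<^sub>R F" by (rule cfam_eqI) simp
  show "1 *\<^sub>R F = F" by (rule cfam_eqI) simp
  show "F * G * H = F * (G * H)" by (rule cfam_eqI) (simp add: cstar.kmult_assoc Rep_cfam_stab)
  show "(F + G) * H = F * H + G * H"
    by (rule cfam_eqI) (simp add: cstar.kmult_add_left Rep_cfam_stab Rep_cfam_kbdd)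
  show "F * (G + H) = F * G + F * H"
    by (rule cfam_eqI) (simp add: cstar.kmult_add_right Rep_cfam_stab Rep_cfam_kbdd)
  show "r *\<^sub>R F * G = r *\<^sub>R (F * G)"
  proof (rule cfam_eqI)
    fix p :: "'a cstr" assume v: "valid p"
    show "Rep_cfam (r *\<^sub>R F * G) p = Rep_cfam (r *\<^sub>R (F * G)) p"
      using cstar.kmult_cs(1)[OF v Rep_cfam_stab[OF v, of F] Rep_cfam_kbdd[OF v, of G], of "of_real r"] v
      by (simp add: cstar.cs_of_real[OF v])
  qed
  show "F * r *\<^sub>R G = r *\<^sub>R (F * G)"
  proof (rule cfam_eqI)
    fix p :: "'a cstr" assume v: "valid p"
    show "Rep_cfam (F * r *\<^sub>R G) p = Rep_cfam (r *\<^sub>R (F * G)) p"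
      using cstar.kmult_cs(2)[OF v Rep_cfam_stab[OF v, of F] Rep_cfam_kbdd[OF v, of G], of "of_real r"] v
      by (simp add: cstar.cs_of_real[OF v])
  qed
qed

lemma fnorm_eq_0_iff:
  fixes F G :: "'a::{real_normed_algebra,banach} cfam"
  shows "fnorm F = 0 \<longleftrightarrow> F = 0"
proof -
  note [simp] = Rep_plus Rep_minus Rep_uminus Rep_scaleR Rep_times Rep_zero
  show ?thesis
  proof
    assume 0: "fnorm F = 0"
    show "F = 0"
    proof (rule cfam_eqI)
      fix p :: "'a cstr" assume v: "valid p"
      show "Rep_cfam F p = Rep_cfam 0 p"
        using cstar.knorm_eq_0[OF v Rep_cfam_kbdd[OF v]] knorm_Rep_le_fnorm[OF v, of F] 0 by simp
    qed
  next
    assume F: "F = 0"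
    have "fnorm F \<le> 0"
    proof (rule fnorm_leI)
      fix p :: "'a cstr" assume v: "valid p"
      show "knorm (snd p) (Rep_cfam F p) \<le> 0"
        using cstar.knorm_cs[OF v Rep_cfam_kbdd[OF v], of 0 F] knorm_Rep_scaleR[OF v, of 0 0] v by (simp add: F)
    qed simp
    then show "fnorm F = 0" using fnorm_nonneg[of F] by simp
  qed
qed

lemma fnorm_triangle:
  fixes F G :: "'a::{real_normed_algebra,banach} cfam"
  shows "fnorm (F + G) \<le> fnorm F + fnorm G"
proof -
  note [simp] = Rep_plus Rep_minus Rep_uminus Rep_scaleR Rep_times Rep_zero
  show ?thesis
  proof (rule fnorm_leI)
    fix p :: "'a cstr" assume v: "valid p"
    show "knorm (snd p) (Rep_cfam (F + G) p) \<le> fnorm F + fnorm G"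
      using cstar.knorm_add[OF v Rep_cfam_kbdd[OF v] Rep_cfam_kbdd[OF v], of F G]
        knorm_Rep_le_fnorm[OF v, of F] knorm_Rep_le_fnorm[OF v, of G] v by simp
  qed (simp add: fnorm_nonneg)
qed

lemma fnorm_scaleR:
  fixes F G :: "'a::{real_normed_algebra,banach} cfam"
  shows "fnorm (r *\<^sub>R F) = \<bar>r\<bar> * fnorm F"
proof -
  note [simp] = Rep_plus Rep_minus Rep_uminus Rep_scaleR Rep_times Rep_zero
  have scale_le: "fnorm (r *\<^sub>R F) \<le> \<bar>r\<bar> * fnorm F" for r and F :: "'a cfam"
    by (rule fnorm_leI)
      (auto simp del: Rep_scaleR simp: knorm_Rep_scaleR fnorm_nonneg intro!: mult_left_mono knorm_Rep_le_fnorm)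
  show ?thesis
  proof (cases "r = 0")
    case True
    then show ?thesis using scale_le[of r F] fnorm_nonneg[of "r *\<^sub>R F"] by simp
  next
    case False
    have "(1 / r) *\<^sub>R (r *\<^sub>R F) = F" using False by (intro cfam_eqI) simp
    then have "fnorm F \<le> \<bar>1 / r\<bar> * fnorm (r *\<^sub>R F)" using scale_le[of "1 / r" "r *\<^sub>R F"] by simp
    then have "\<bar>r\<bar> * fnorm F \<le> fnorm (r *\<^sub>R F)" using False by (simp add: pos_le_divide_eq mult.commute)
    then show ?thesis using scale_le[of r F] by simp
  qed
qed

lemma fnorm_mult_ineq:
  fixes F G :: "'a::{real_normed_algebra,banach} cfam"
  shows "fnorm (F * G) \<le> fnorm F * fnorm G"
proof -
  note [simp] = Rep_plus Rep_minus Rep_uminus Rep_scaleR Rep_times Rep_zero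
  show ?thesis
  proof (rule fnorm_leI)
    fix p :: "'a cstr" assume v: "valid p"
    have "knorm (snd p) (Rep_cfam F p) * knorm (snd p) (Rep_cfam G p) \<le> fnorm F * fnorm G"
      by (intro mult_mono knorm_Rep_le_fnorm knorm_Rep_nonneg fnorm_nonneg v)
    then show "knorm (snd p) (Rep_cfam (F * G) p) \<le> fnorm F * fnorm G"
      using cstar.knorm_kmult[OF v Rep_cfam_stab[OF v] Rep_cfam_kbdd[OF v], of F G] v by simp
  qed (simp add: fnorm_nonneg)
qed

instantiation cfam :: ("{real_normed_algebra,banach}") real_normed_algebra
begin

definition "norm F = fnorm F"
definition "dist (F :: 'a cfam) G = norm (F - G)"
definition "sgn (F :: 'a cfam) = F /\<^sub>R norm F"
definition "(uniformity :: ('a cfam \<times> 'a cfam) filter) = (INF e\<in>{0 <..}. principal {(F, G). dist F G < e})"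
definition "open (U :: 'a cfam set) \<longleftrightarrow> (\<forall>F\<in>U. eventually (\<lambda>(F', G). F' = F \<longrightarrow> G \<in> U) uniformity)"

instance
  by standard
    (simp_all only: dist_cfam_def sgn_cfam_def uniformity_cfam_def open_cfam_def norm_cfam_def
      fnorm_eq_0_iff fnorm_triangle fnorm_scaleR fnorm_mult_ineq)

end

lemmas knorm_Rep_le_norm = knorm_Rep_le_fnorm[folded norm_cfam_def]
lemmas norm_cfam_leI = fnorm_leI[folded norm_cfam_def]

instance cfam :: ("{real_normed_algebra,banach}") banach
proof
  fix F :: "nat \<Rightarrow> 'a cfam"
  assume F: "Cauchy F"
  have cauchy: "\<exists>N. \<forall>m\<ge>N. \<forall>n\<ge>N. norm (F m - F n) \<le> e" if "0 < e" for e
    using CauchyD[OF F that] less_imp_le by meson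
  have kn: "knorm (snd p) (Rep_cfam (F m) p - Rep_cfam (F n) p) \<le> norm (F m - F n)"
    if v: "valid p" for p m n
    using knorm_Rep_le_norm[OF v, of "F m - F n"] by (simp add: Rep_minus[OF v])
  \<comment> \<open>The limit in each coordinate is chosen with a modulus that depends only on the
    sequence in the product, so that the coordinatewise limits assemble to a bounded family and a
    norm limit.\<close>
  have "\<exists>X. valid p \<longrightarrow> X \<in> stab (snd p) \<and> (\<forall>e>0. \<forall>N. (\<forall>m\<ge>N. \<forall>n\<ge>N. norm (F m - F n) \<le> e) \<longrightarrow>
      (\<forall>m\<ge>N. knorm (snd p) (Rep_cfam (F m) p - X) \<le> e))" for p
  proof (cases "valid p")
    case v: True
    have "\<exists>X\<in>stab (snd p). \<forall>e>0. \<forall>N. (\<forall>m\<ge>N. \<forall>n\<ge>N. knorm (snd p) (Rep_cfam (F m) p - Rep_cfam (F n) p) \<le> e) \<longrightarrow>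
      (\<forall>m\<ge>N. knorm (snd p) (Rep_cfam (F m) p - X) \<le> e)"
    proof (rule cstar.stab_complete[OF v])
      show "Rep_cfam (F n) p \<in> stab (snd p)" for n by (rule Rep_cfam_stab[OF v])
      show "\<exists>N. \<forall>m\<ge>N. \<forall>n\<ge>N. knorm (snd p) (Rep_cfam (F m) p - Rep_cfam (F n) p) \<le> e" if "0 < e" for e
        using cauchy[OF that] kn[OF v] order_trans by meson
    qed
    then show ?thesis using order_trans[OF kn[OF v]] by meson
  qed simp
  then obtain X where X: "\<And>p. valid p \<Longrightarrow> X p \<in> stab (snd p)"
    "\<And>p e N m. valid p \<Longrightarrow> 0 < e \<Longrightarrow> \<forall>m\<ge>N. \<forall>n\<ge>N. norm (F m - F n) \<le> e \<Longrightarrow> N \<le> m \<Longrightarrow>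
      knorm (snd p) (Rep_cfam (F m) p - X p) \<le> e"
    by metis
  obtain N where N: "\<forall>m\<ge>N. \<forall>n\<ge>N. norm (F m - F n) \<le> 1" using cauchy[of 1] by auto
  have RX: "Rep_cfam (mkf X) p = (if valid p then X p else (\<lambda>i j. 0))" for p
  proof (rule Rep_mkf[OF X(1)])
    fix p :: "'a cstr" assume v: "valid p"
    have b: "cstar.kbdd (snd p) (Rep_cfam (F N) p - X p)"
      by (intro cstar.kbdd_stab_diff[OF v] Rep_cfam_stab[OF v] X(1)[OF v])
    have "knorm (snd p) (X p) \<le> knorm (snd p) (X p - Rep_cfam (F N) p) + knorm (snd p) (Rep_cfam (F N) p)"
      by (intro cstar.knorm_le_diff[OF v] cstar.stab_kbdd[OF v] Rep_cfam_stab[OF v] X(1)[OF v])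
    also have "\<dots> \<le> 1 + norm (F N)"
      using X(2)[OF v _ N order.refl] knorm_Rep_le_norm[OF v, of "F N"] cstar.knorm_diff_commute[OF v b] by simp
    finally show "knorm (snd p) (X p) \<le> 1 + norm (F N)" .
  qed
  have "F \<longlonglongrightarrow> mkf X"
  proof (rule LIMSEQ_I)
    fix e :: real assume "0 < e"
    then have e: "0 < e / 2" by simp
    then obtain N where N: "\<forall>m\<ge>N. \<forall>n\<ge>N. norm (F m - F n) \<le> e / 2" using cauchy by blast
    have "norm (F m - mkf X) < e" if "N \<le> m" for m
    proof -
      have "norm (F m - mkf X) \<le> e / 2"
        by (rule norm_cfam_leI) (use X(2)[OF _ e N that] e in \<open>simp_all add: Rep_minus RX\<close>)
      then show ?thesis using \<open>0 < e\<close> by simp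
    qed
    then show "\<exists>N. \<forall>n\<ge>N. norm (F n - mkf X) < e" by blast
  qed
  then show "convergent F" by (auto simp: convergent_def)
qed

section \<open>Involution, complex scalars and isometries on the product\<close>

definition cfst :: "'a::{real_normed_algebra,banach} cfam \<Rightarrow> 'a cfam" where
  "cfst F = mkf (\<lambda>p. kstar (snd p) (Rep_cfam F p))"

definition cfcs :: "complex \<Rightarrow> 'a::{real_normed_algebra,banach} cfam \<Rightarrow> 'a cfam" where
  "cfcs c F = mkf (\<lambda>p i j. fst p c (Rep_cfam F p i j))"

definition cfsh :: "nat \<Rightarrow> 'a::{real_normed_algebra,banach} cfam \<Rightarrow> 'a cfam" where
  "cfsh b F = mkf (\<lambda>p. sh b (Rep_cfam F p))"

context
  fixes p :: "'a::{real_normed_algebra,banach} cstr"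
  assumes v: "valid p"
begin

lemma Rep_cfst: "Rep_cfam (cfst F) p = kstar (snd p) (Rep_cfam F p)"
proof -
  have "Rep_cfam (mkf (\<lambda>p. kstar (snd p) (Rep_cfam F p))) p
    = (if valid p then kstar (snd p) (Rep_cfam F p) else (\<lambda>i j. 0))"
    by (rule Rep_mkf[where C = "norm F"])
      (auto intro!: cstar.stab_kstar Rep_cfam_stab knorm_Rep_le_norm simp: cstar.knorm_kstar Rep_cfam_kbdd)
  then show ?thesis using v by (simp add: cfst_def)
qed

lemma Rep_cfcs: "Rep_cfam (cfcs c F) p = (\<lambda>i j. fst p c (Rep_cfam F p i j))"
proof -
  have "Rep_cfam (mkf (\<lambda>p i j. fst p c (Rep_cfam F p i j))) p
    = (if valid p then (\<lambda>i j. fst p c (Rep_cfam F p i j)) else (\<lambda>i j. 0))"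
  proof (rule Rep_mkf)
    fix q :: "'a cstr" assume q: "valid q"
    show "(\<lambda>i j. fst q c (Rep_cfam F q i j)) \<in> stab (snd q)"
      by (rule cstar.stab_cs[OF q Rep_cfam_stab[OF q]])
    show "knorm (snd q) (\<lambda>i j. fst q c (Rep_cfam F q i j)) \<le> cmod c * norm F"
      unfolding cstar.knorm_cs[OF q Rep_cfam_kbdd[OF q]]
      by (intro mult_left_mono knorm_Rep_le_norm q) simp
  qed
  then show ?thesis using v by (simp add: cfcs_def)
qed

lemma Rep_cfsh: "b < 2 \<Longrightarrow> Rep_cfam (cfsh b F) p = sh b (Rep_cfam F p)"
proof -
  assume b: "b < 2"
  have "Rep_cfam (mkf (\<lambda>p. sh b (Rep_cfam F p))) p
    = (if valid p then sh b (Rep_cfam F p) else (\<lambda>i j. 0))"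
    by (rule Rep_mkf)
      (rule cstar.stab_sh[OF _ b Rep_cfam_stab], assumption, assumption,
       rule order_trans[OF cstar.knorm_sh_le[OF _ b Rep_cfam_kbdd] knorm_Rep_le_norm])
  then show ?thesis using v by (simp add: cfsh_def)
qed

end

lemma cstar_cfam: "cstar (cfcs :: complex \<Rightarrow> 'a::{real_normed_algebra,banach} cfam \<Rightarrow> _) cfst"
proof -
  note R = Rep_plus Rep_minus Rep_uminus Rep_scaleR Rep_times Rep_zero Rep_cfst Rep_cfcs
  have cs_norm_le: "norm (cfcs c F) \<le> cmod c * norm F" for c and F :: "'a cfam"
  proof (rule norm_cfam_leI)
    fix p :: "'a cstr" assume p: "valid p"
    show "knorm (snd p) (Rep_cfam (cfcs c F) p) \<le> cmod c * norm F"
      unfolding Rep_cfcs[OF p] cstar.knorm_cs[OF p Rep_cfam_kbdd[OF p]]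
      by (intro mult_left_mono knorm_Rep_le_norm p) simp
  qed simp
  have cs_cs: "cfcs a (cfcs b F) = cfcs (a * b) F" for a b and F :: "'a cfam"
    by (rule cfam_eqI) (simp add: R cstar.cs_cs)
  have cs_one: "cfcs 1 F = F" for F :: "'a cfam"
    by (rule cfam_eqI) (simp add: R cstar.cs_one)
  have "cstar_algebra (cfcs :: complex \<Rightarrow> 'a cfam \<Rightarrow> _) cfst"
    unfolding cstar_algebra_def
  proof (intro conjI allI)
    fix a b c :: complex and r :: real and F G :: "'a cfam"
    show "cfcs (a + b) F = cfcs a F + cfcs b F" by (rule cfam_eqI) (simp add: R cstar.cs_add_left)
    show "cfcs a (F + G) = cfcs a F + cfcs a G" by (rule cfam_eqI) (simp add: R cstar.cs_add_right)
    show "cfcs (a * b) F = cfcs a (cfcs b F)" by (simp add: cs_cs)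
    show "cfcs 1 F = F" by (rule cs_one)
    show "cfcs (complex_of_real r) F = r *\<^sub>R F" by (rule cfam_eqI) (simp add: R cstar.cs_of_real)
    show "norm (cfcs c F) = cmod c * norm F"
    proof (cases "c = 0")
      case True
      then show ?thesis using cs_norm_le[of c F] by simp
    next
      case False
      then have "norm F \<le> cmod (1 / c) * norm (cfcs c F)"
        using cs_norm_le[of "1 / c" "cfcs c F"] by (simp add: cs_cs cs_one)
      then have "cmod c * norm F \<le> norm (cfcs c F)"
        using False by (simp add: norm_divide pos_le_divide_eq mult.commute)
      then show ?thesis using cs_norm_le[of c F] by simp
    qed
    show "cfcs c (F * G) = cfcs c F * G"
      by (rule cfam_eqI) (simp add: R cstar.kmult_cs Rep_cfam_stab Rep_cfam_kbdd)
    show "cfcs c (F * G) = F * cfcs c G"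
      by (rule cfam_eqI) (simp add: R cstar.kmult_cs Rep_cfam_stab Rep_cfam_kbdd)
    show "cfst (cfst F) = F" by (rule cfam_eqI) (simp add: R cstar.kstar_kstar)
    show "cfst (F + G) = cfst F + cfst G"
      by (rule cfam_eqI) (simp add: R kstar_def cstar.st_add)
    show "cfst (F * G) = cfst G * cfst F"
      by (rule cfam_eqI) (simp add: R cstar.kstar_kmult Rep_cfam_stab)
    show "cfst (cfcs c F) = cfcs (cnj c) (cfst F)"
      by (rule cfam_eqI) (simp add: R kstar_def cstar.st_cs)
    have eq: "knorm (snd p) (Rep_cfam (cfst F * F) p) = (knorm (snd p) (Rep_cfam F p))\<^sup>2" if "valid p" for p
      using that by (simp add: R cstar.knorm_kstar_kmult Rep_cfam_stab)
    show "norm (cfst F * F) = (norm F)\<^sup>2"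
    proof (rule antisym)
      show "norm (cfst F * F) \<le> (norm F)\<^sup>2"
        by (rule norm_cfam_leI) (auto simp: eq intro!: power_mono knorm_Rep_le_norm knorm_Rep_nonneg)
      have "norm F \<le> sqrt (norm (cfst F * F))"
      proof (rule norm_cfam_leI)
        fix p :: "'a cstr" assume p: "valid p"
        show "knorm (snd p) (Rep_cfam F p) \<le> sqrt (norm (cfst F * F))"
          using knorm_Rep_le_norm[OF p, of "cfst F * F"] by (intro real_le_rsqrt) (simp add: eq[OF p])
      qed simp
      then have "(norm F)\<^sup>2 \<le> (sqrt (norm (cfst F * F)))\<^sup>2" by (rule power_mono) simp
      then show "(norm F)\<^sup>2 \<le> norm (cfst F * F)" by simp
    qed
  qed
  then show ?thesis by (rule cstar.intro)
qed

lemma cstar_stable_cfam: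
  "cstar_stable (cfcs :: complex \<Rightarrow> 'a::{real_normed_algebra,banach} cfam \<Rightarrow> _) cfst (cfsh 0) (cfsh (Suc 0))"
proof (rule cstar_stable.intro[OF cstar_cfam])
  note R = Rep_plus Rep_minus Rep_uminus Rep_scaleR Rep_times Rep_zero Rep_cfst Rep_cfsh
  have S: "cfsh b (F + G) = cfsh b F + cfsh b G" "cfsh b (r *\<^sub>R F) = r *\<^sub>R cfsh b F"
    "cfsh b (F * G) = cfsh b F * G" "cfst (cfsh b F) * cfsh b G = cfst F * G"
    "cfst (cfsh b (cfst (cfsh b F))) = cfsh b (cfst (cfsh b (cfst F)))"
    if b: "b < 2" for b r and F G :: "'a cfam"
  proof -
    show "cfsh b (F + G) = cfsh b F + cfsh b G" "cfsh b (r *\<^sub>R F) = r *\<^sub>R cfsh b F"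
      by (rule cfam_eqI; use b in \<open>auto simp: R sh_def fun_eq_iff\<close>)+
    show "cfsh b (F * G) = cfsh b F * G"
      by (rule cfam_eqI) (use b in \<open>simp add: R cstar.sh_kmult\<close>)
    show "cfst (cfsh b F) * cfsh b G = cfst F * G"
      by (rule cfam_eqI) (use b in \<open>simp add: R cstar.sh_inner\<close>)
    show "cfst (cfsh b (cfst (cfsh b F))) = cfsh b (cfst (cfsh b (cfst F)))"
      by (rule cfam_eqI) (use b in \<open>simp add: R cstar.sh_kstar\<close>)
  qed
  show "cstar_stable_axioms cfst (cfsh 0) (cfsh (Suc 0) :: 'a cfam \<Rightarrow> _)"
  proof (rule cstar_stable_axioms.intro)
    show "cfst (cfsh 0 F) * cfsh (Suc 0) G = 0" for F G :: "'a cfam"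
      by (rule cfam_eqI) (simp add: R cstar.sh_inner_0)
  qed (simp_all add: S)
qed

section \<open>Transfer to the Cuntz semigroup\<close>

lemma (in cstar) cle_approx_trans:
  assumes "cle a s" "\<And>e. 0 < e \<Longrightarrow> \<exists>k. \<exists>r. norm (s - r * y k * st r) < e" "0 < e"
  shows "\<exists>k. \<exists>r. norm (a - r * y k * st r) < e"
proof -
  obtain r where r: "norm (a - r * s * st r) < e / 2"
    using assms(1,3) half_gt_zero unfolding cle_def by blast
  define K where "K = (norm r)\<^sup>2 + 1"
  have K: "0 < K" "(norm r)\<^sup>2 \<le> K" by (simp_all add: K_def add_nonneg_pos)
  then have "0 < e / 2 / K" using assms(3) by simp
  then obtain k q where q: "norm (s - q * y k * st q) < e / 2 / K" using assms(2) by blast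
  have "norm (r * s * st r - r * (q * y k * st q) * st r) \<le> (norm r)\<^sup>2 * norm (s - q * y k * st q)"
    by (rule norm_conj_diff_le)
  also have "\<dots> \<le> K * (e / 2 / K)" by (rule mult_mono) (use K q in simp_all)
  also have "\<dots> = e / 2" using K by simp
  finally have "norm (a - r * (q * y k * st q) * st r) < e"
    using r norm_triangle_ineq[of "a - r * s * st r" "r * s * st r - r * (q * y k * st q) * st r"] by simp
  then have "norm (a - (r * q) * y k * st (r * q)) < e" by (simp add: st_mult mult.assoc)
  then show ?thesis by blast
qed

context cstar
begin

definition emb :: "'a kmat \<Rightarrow> 'a cfam" where
  "emb X = mkf (\<lambda>p. if p = (cs, st) then X else (\<lambda>i j. 0))"

definition prj :: "'a cfam \<Rightarrow> 'a kmat" where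
  "prj F = Rep_cfam F (cs, st)"

interpretation F: cstar_stable "cfcs :: complex \<Rightarrow> 'a cfam \<Rightarrow> 'a cfam" cfst "cfsh 0" "cfsh (Suc 0)"
  by (rule cstar_stable_cfam)

lemma valid_self: "valid (cs, st)"
  by (simp add: cstar_axioms)

lemma Rep_emb:
  assumes X: "X \<in> stab st" and p: "valid p"
  shows "Rep_cfam (emb X) p = (if p = (cs, st) then X else (\<lambda>i j. 0))"
proof -
  have "Rep_cfam (emb X) p = (if valid p then (if p = (cs, st) then X else (\<lambda>i j. 0)) else (\<lambda>i j. 0))"
    unfolding emb_def
  proof (rule Rep_mkf[where C = "knrm X"])
    fix q :: "'a cstr" assume q: "valid q"
    show "(if q = (cs, st) then X else (\<lambda>i j. 0)) \<in> stab (snd q)"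
      using X cstar.stab_zero[OF q] by simp
    show "knorm (snd q) (if q = (cs, st) then X else (\<lambda>i j. 0)) \<le> knrm X"
      using cstar.knorm_zero_le[OF q] knorm_nonneg[OF stab_kbdd[OF X]] by simp
  qed
  then show ?thesis using p by simp
qed

lemma prj_stab: "prj G \<in> stab st"
  using Rep_cfam_stab[OF valid_self, of G] by (simp add: prj_def)

lemma prj_emb: "X \<in> stab st \<Longrightarrow> prj (emb X) = X"
  by (simp add: prj_def Rep_emb[OF _ valid_self])

lemma norm_emb_le:
  assumes "X \<in> stab st"
  shows "norm (emb X) \<le> knrm X"
proof (rule norm_cfam_leI)
  have 0: "0 \<le> knrm X" by (rule knorm_nonneg[OF stab_kbdd[OF assms]])
  then show "0 \<le> knrm X" .
  fix p :: "'a cstr" assume p: "valid p"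
  show "knorm (snd p) (Rep_cfam (emb X) p) \<le> knrm X"
    using cstar.knorm_zero_le[OF p] 0 by (simp add: Rep_emb[OF assms p])
qed

lemma knorm_prj_le: "knrm (prj G) \<le> norm G"
  using knorm_Rep_le_norm[OF valid_self, of G] by (simp add: prj_def)

lemma prj_simps:
  "prj (G + H) = (\<lambda>i j. prj G i j + prj H i j)" "prj (G - H) = prj G - prj H"
  "prj (G * H) = kmult (prj G) (prj H)" "prj (r *\<^sub>R G) = (\<lambda>i j. r *\<^sub>R prj G i j)"
  "prj (cfst G) = kstar st (prj G)" "b < 2 \<Longrightarrow> prj (cfsh b G) = sh b (prj G)"
  using valid_self
  by (simp_all add: prj_def Rep_plus Rep_minus Rep_times Rep_scaleR Rep_cfst Rep_cfsh)

lemma emb_eqI: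
  assumes X: "X \<in> stab st" and "prj G = X"
    and 0: "\<And>p. valid p \<Longrightarrow> p \<noteq> (cs, st) \<Longrightarrow> Rep_cfam G p = (\<lambda>i j. 0)"
  shows "emb X = G"
proof (rule cfam_eqI)
  fix p :: "'a cstr" assume p: "valid p"
  show "Rep_cfam (emb X) p = Rep_cfam G p"
    using assms(2) 0[OF p] by (simp add: Rep_emb[OF X p] prj_def)
qed

lemma emb_plus:
  assumes "X \<in> stab st" "Y \<in> stab st"
  shows "emb (\<lambda>i j. X i j + Y i j) = emb X + emb Y"
  by (rule emb_eqI) (simp_all add: assms stab_add prj_simps prj_emb Rep_plus Rep_emb)

lemma emb_diff:
  assumes "X \<in> stab st" "Y \<in> stab st"
  shows "emb (X - Y) = emb X - emb Y"
  by (rule emb_eqI) (simp_all add: assms stab_diff prj_simps prj_emb Rep_minus Rep_emb fun_eq_iff)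

lemma emb_scaleR:
  assumes "X \<in> stab st"
  shows "emb (\<lambda>i j. r *\<^sub>R X i j) = r *\<^sub>R emb X"
  by (rule emb_eqI) (simp_all add: assms stab_scaleR prj_simps prj_emb Rep_scaleR Rep_emb)

lemma emb_kmult:
  assumes "X \<in> stab st" "Y \<in> stab st"
  shows "emb (kmult X Y) = emb X * emb Y"
  by (rule emb_eqI[OF stab_kmult[OF assms]])
    (simp add: prj_simps prj_emb assms, simp add: Rep_times Rep_emb assms kmult_def)

lemma emb_kstar:
  assumes "X \<in> stab st"
  shows "emb (kstar st X) = cfst (emb X)"
  by (rule emb_eqI[OF stab_kstar[OF assms]])
    (simp add: prj_simps prj_emb assms, simp add: Rep_cfst Rep_emb assms kstar_def cstar.st_zero)

lemma emb_sh:
  assumes "X \<in> stab st" "b < 2"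
  shows "emb (sh b X) = cfsh b (emb X)"
  by (rule emb_eqI[OF stab_sh[OF assms(2,1)]])
    (simp add: prj_simps prj_emb assms, simp add: Rep_cfsh Rep_emb assms sh_def)

text \<open>\<open>emb\<close> after \<open>prj\<close> is the homomorphism that erases all
  coordinates but one. Witnesses found somewhere in the product are pushed along it into the summand
  of \<open>(cs, st)\<close>.\<close>

lemma emb_prj_simps:
  "emb (prj (G * H)) = emb (prj G) * emb (prj H)"
  "emb (prj (cfst G)) = cfst (emb (prj G))"
  "emb (prj (G - H)) = emb (prj G) - emb (prj H)"
  by (simp_all only: prj_simps emb_kmult emb_kstar emb_diff prj_stab)

lemma bounded_linear_emb_prj: "bounded_linear (\<lambda>G. emb (prj G))"
proof (rule bounded_linear_intro[where K = 1])
  show "norm (emb (prj G)) \<le> norm G * 1" for G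
    using norm_emb_le[OF prj_stab, of G] knorm_prj_le[of G] by simp
qed (simp_all only: prj_simps emb_plus emb_scaleR prj_stab)

lemma dsum_stab: "X \<in> stab st \<Longrightarrow> Y \<in> stab st \<Longrightarrow> dsum X Y \<in> stab st"
  unfolding dsum_eq_sh by (intro stab_add stab_sh stab_kstar) simp_all

lemma emb_dsum:
  assumes "X \<in> stab st" "Y \<in> stab st"
  shows "emb (dsum X Y) = F.dsm (emb X) (emb Y)"
  using assms
  by (simp add: dsum_eq_sh F.dsm_def emb_plus emb_sh emb_kstar stab_sh stab_kstar)

lemma emb_prj_dsm: "emb (prj (F.dsm G H)) = F.dsm (emb (prj G)) (emb (prj H))"
proof -
  have "prj (F.dsm G H) = dsum (prj G) (prj H)"
    by (simp add: F.dsm_def dsum_eq_sh prj_simps)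
  then show ?thesis by (simp add: emb_dsum prj_stab)
qed

lemma kposD:
  assumes "kpos st X"
  shows "X \<in> stab st" "F.pos (emb X)"
proof -
  show X: "X \<in> stab st" using assms by (simp add: kpos_def)
  obtain y where y: "y \<in> stab st" "X = kmult (kstar st y) y" using assms unfolding kpos_def by blast
  then have "emb X = cfst (emb y) * emb y" by (simp add: emb_kmult emb_kstar stab_kstar)
  then show "F.pos (emb X)" using F.pos_st_mult by simp
qed

lemma kpos_prj:
  assumes "F.pos G"
  shows "kpos st (prj G)"
proof -
  define s where "s = F.psqrt G"
  have "G = cfst s * s" using assms by (simp add: s_def F.st_psqrt F.psqrt_mult)
  then have "prj G = kmult (kstar st (prj s)) (prj s)" by (simp add: prj_simps)
  then show ?thesis unfolding kpos_def using prj_stab by blast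
qed

lemma cuntz_le_iff:
  assumes X: "X \<in> stab st" and Y: "Y \<in> stab st"
  shows "cuntz_le st X Y \<longleftrightarrow> F.cle (emb X) (emb Y)"
proof
  assume "cuntz_le st X Y"
  then obtain r where r: "\<And>n. r n \<in> stab st"
    "(\<lambda>n. knrm (X - kmult (kmult (r n) Y) (kstar st (r n)))) \<longlonglongrightarrow> 0"
    unfolding cuntz_le_def by blast
  show "F.cle (emb X) (emb Y)"
    unfolding F.cle_def
  proof (intro allI impI)
    fix e :: real assume "0 < e"
    then obtain n where n: "norm (knrm (X - kmult (kmult (r n) Y) (kstar st (r n))) - 0) < e"
      using LIMSEQ_D[OF r(2)] by blast
    have s: "kmult (kmult (r n) Y) (kstar st (r n)) \<in> stab st"
      by (intro stab_kmult stab_kstar r Y)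
    have "emb X - emb (r n) * emb Y * cfst (emb (r n)) = emb (X - kmult (kmult (r n) Y) (kstar st (r n)))"
      by (simp only: emb_diff[OF X s] emb_kmult emb_kstar stab_kmult stab_kstar r Y)
    then have "norm (emb X - emb (r n) * emb Y * cfst (emb (r n))) < e"
      using norm_emb_le[OF stab_diff[OF X s]] n by simp
    then show "\<exists>r. norm (emb X - r * emb Y * cfst r) < e" by blast
  qed
next
  assume le: "F.cle (emb X) (emb Y)"
  have "\<exists>r. norm (emb X - r * emb Y * cfst r) < inverse (real (Suc n))" for n
    using le unfolding F.cle_def by simp
  then obtain r where r: "\<And>n. norm (emb X - r n * emb Y * cfst (r n)) < inverse (real (Suc n))" by metis
  let ?D = "\<lambda>n. X - kmult (kmult (prj (r n)) Y) (kstar st (prj (r n)))"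
  have D: "prj (emb X - r n * emb Y * cfst (r n)) = ?D n" for n
    by (simp only: prj_simps prj_emb X Y)
  have "(\<lambda>n. knrm (?D n)) \<longlonglongrightarrow> 0"
  proof (rule tendsto_sandwich[OF _ _ tendsto_const LIMSEQ_inverse_real_of_nat])
    show "\<forall>\<^sub>F n in sequentially. 0 \<le> knrm (?D n)"
      unfolding D[symmetric] by (intro always_eventually allI knorm_nonneg stab_kbdd prj_stab)
    show "\<forall>\<^sub>F n in sequentially. knrm (?D n) \<le> inverse (real (Suc n))"
      unfolding D[symmetric]
      by (intro always_eventually allI order_trans[OF knorm_prj_le less_imp_le[OF r]])
  qed
  then show "cuntz_le st X Y"
    unfolding cuntz_le_def by (intro exI[of _ "\<lambda>n. prj (r n)"]) (simp add: prj_stab)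
qed

lemma cle_emb_prj:
  assumes "F.cle G H"
  shows "F.cle (emb (prj G)) (emb (prj H))"
  unfolding F.cle_def
proof (intro allI impI)
  fix e :: real assume "0 < e"
  then obtain r where r: "norm (G - r * H * cfst r) < e" using assms unfolding F.cle_def by blast
  have "emb (prj G) - emb (prj r) * emb (prj H) * cfst (emb (prj r)) = emb (prj (G - r * H * cfst r))"
    by (simp only: emb_prj_simps)
  then have "norm (emb (prj G) - emb (prj r) * emb (prj H) * cfst (emb (prj r))) < e"
    using order_trans[OF norm_emb_le[OF prj_stab] knorm_prj_le, of "G - r * H * cfst r"] r by simp
  then show "\<exists>r. norm (emb (prj G) - r * emb (prj H) * cfst r) < e" by blast
qed

lemma pos_emb_prj: "F.pos G \<Longrightarrow> F.pos (emb (prj G))"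
  using kposD(2)[OF kpos_prj] .

lemma emb_prj_cut:
  assumes G: "F.pos G" and e: "0 < e"
  shows "emb (prj (F.cut e G)) = F.cut e (emb (prj G))"
proof -
  have c: "continuous_on UNIV (\<lambda>t. max 0 (t - e) / max t e)"
    by (intro continuous_intros ballI) (use e in auto)
  have G': "F.pos (emb (prj G))" using G by (rule pos_emb_prj)
  show ?thesis
    unfolding F.cut_eq_fc[OF G e] F.cut_eq_fc[OF G' e]
    by (rule F.fc_intertwine[OF F.pos_st[OF G] F.pos_st[OF G'] c bounded_linear_emb_prj])
      (rule emb_prj_simps)
qed

text \<open>Way-below is tested on the cut-downs of \<open>Y\<close> at the levels 1/(k+1). They
  increase and converge in norm to \<open>Y\<close>, so every upper bound of them dominates
  \<open>Y\<close>, which is therefore their supremum.\<close>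

lemma cu_ll_imp_cle_cut:
  assumes X: "kpos st X" and Y: "kpos st Y" and ll: "cu_ll st X Y"
  shows "\<exists>f>0. F.cle (emb X) (F.cut f (emb Y))"
proof -
  define ys where "ys k = prj (F.cut (inverse (Suc k)) (emb Y))" for k
  have cutp: "F.pos (F.cut (inverse (Suc k)) (emb Y))" for k
    by (rule F.pos_cut[OF kposD(2)[OF Y]]) simp
  have emb_ys: "emb (ys k) = F.cut (inverse (Suc k)) (emb Y)" for k
    unfolding ys_def by (subst emb_prj_cut) (simp_all add: kposD[OF Y] prj_emb)
  have ys: "kpos st (ys k)" for k unfolding ys_def by (rule kpos_prj[OF cutp])
  have stab_ys: "ys k \<in> stab st" for k using kposD[OF ys] by blast
  have inc: "cuntz_le st (ys k) (ys (Suc k))" for k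
    unfolding cuntz_le_iff[OF stab_ys stab_ys] emb_ys
    by (rule F.cle_cut_mono[OF kposD(2)[OF Y]]) (simp_all add: field_simps)
  have "cu_is_sup st ys Y"
    unfolding cu_is_sup_def
  proof (intro conjI allI impI)
    show "kpos st Y" by (rule Y)
    show "cuntz_le st (ys k) Y" for k
      unfolding cuntz_le_iff[OF stab_ys kposD(1)[OF Y]] emb_ys
      by (rule F.cle_cut_self[OF kposD(2)[OF Y]]) simp
    fix T assume T: "kpos st T \<and> (\<forall>k. cuntz_le st (ys k) T)"
    have sT: "T \<in> stab st" using T kposD by blast
    show "cuntz_le st Y T"
      unfolding cuntz_le_iff[OF kposD(1)[OF Y] sT]
    proof (rule F.cle_closure)
      fix e :: real assume "0 < e"
      then obtain k where k: "inverse (real (Suc k)) < e" using reals_Archimedean by blast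
      have "F.cle (emb (ys k)) (emb T)" using T cuntz_le_iff[OF stab_ys sT] by blast
      moreover have "norm (emb Y - emb (ys k)) \<le> e"
        using F.norm_diff_cut_le[OF kposD(2)[OF Y], of "inverse (Suc k)"] k by (simp add: emb_ys)
      ultimately show "\<exists>c. norm (emb Y - c) \<le> e \<and> F.cle c (emb T)" by blast
    qed
  qed
  moreover have "cuntz_le st Y Y"
    unfolding cuntz_le_iff[OF kposD(1)[OF Y] kposD(1)[OF Y]] by (rule F.cle_refl[OF kposD(2)[OF Y]])
  ultimately obtain k where "cuntz_le st X (ys k)"
    using ll ys inc unfolding cu_ll_def by blast
  then have "F.cle (emb X) (F.cut (inverse (Suc k)) (emb Y))"
    unfolding cuntz_le_iff[OF kposD(1)[OF X] stab_ys] emb_ys .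
  then show ?thesis by (intro exI[of _ "inverse (Suc k)"]) simp
qed

text \<open>An arbitrary supremum \<open>s\<close> is below the explicit bound \<open>S\<close>, and
  \<open>S\<close> is approximated by conjugates of the \<open>ys k\<close>. So \<open>Y\<close> is
  within \<open>f\<close> of a conjugate of some \<open>ys k\<close>, and Roerdam's lemma puts the
  cut-down of \<open>Y\<close> at \<open>f\<close> below that \<open>ys k\<close>.\<close>

lemma cu_ll_if_cle_cut:
  assumes X: "kpos st X" and Y: "kpos st Y" and f: "0 < f" "F.cle (emb X) (F.cut f (emb Y))"
  shows "cu_ll st X Y"
  unfolding cu_ll_def
proof (intro allI impI)
  fix ys s
  assume "(\<forall>k. kpos st (ys k)) \<and> (\<forall>k. cuntz_le st (ys k) (ys (Suc k))) \<and> cu_is_sup st ys s \<and> cuntz_le st Y s"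
  then have ys: "\<And>k. kpos st (ys k)" and inc: "\<And>k. cuntz_le st (ys k) (ys (Suc k))"
    and sup: "cu_is_sup st ys s" and Ys: "cuntz_le st Y s" by blast+
  have stab_ys: "ys k \<in> stab st" for k using kposD[OF ys] by blast
  have stab_s: "s \<in> stab st" using sup kposD unfolding cu_is_sup_def by blast
  have "F.cle (emb (ys n)) (emb (ys (Suc n)))" for n using inc cuntz_le_iff[OF stab_ys stab_ys] by blast
  then obtain S where S: "F.pos S" "\<And>n. F.cle (emb (ys n)) S"
    "\<And>e. 0 < e \<Longrightarrow> \<exists>k. \<exists>r. norm (S - r * emb (ys k) * cfst r) < e"
    using F.cle_upper_bound[of "\<lambda>n. emb (ys n)", OF kposD(2)[OF ys]] by blast
  have "cuntz_le st (ys k) (prj S)" for k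
    unfolding cuntz_le_iff[OF stab_ys prj_stab] using cle_emb_prj[OF S(2)] prj_emb[OF stab_ys] by metis
  then have "cuntz_le st s (prj S)"
    using sup kpos_prj[OF S(1)] unfolding cu_is_sup_def by blast
  then have "F.cle (emb Y) (emb (prj S))"
    using Ys F.cle_trans cuntz_le_iff kposD(1)[OF Y] stab_s prj_stab by metis
  moreover have "\<exists>k. \<exists>r. norm (emb (prj S) - r * emb (ys k) * cfst r) < e" if "0 < e" for e
  proof -
    obtain k r where r: "norm (S - r * emb (ys k) * cfst r) < e" using S(3) \<open>0 < e\<close> by blast
    have "emb (prj S) - emb (prj r) * emb (ys k) * cfst (emb (prj r)) = emb (prj (S - r * emb (ys k) * cfst r))"
      by (simp only: emb_prj_simps prj_emb[OF stab_ys])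
    then have "norm (emb (prj S) - emb (prj r) * emb (ys k) * cfst (emb (prj r))) < e"
      using order_trans[OF norm_emb_le[OF prj_stab] knorm_prj_le, of "S - r * emb (ys k) * cfst r"] r by simp
    then show ?thesis by blast
  qed
  ultimately obtain k r where kr: "norm (emb Y - r * emb (ys k) * cfst r) < f"
    using F.cle_approx_trans[of "emb Y" "emb (prj S)" "\<lambda>k. emb (ys k)" f] f(1) by blast
  then have "F.cle (F.cut f (emb Y)) (r * emb (ys k) * cfst r)"
    by (intro F.cle_cut_of_norm_le' kposD(2)[OF Y] F.pos_conj' kposD(2)[OF ys]) simp
  then have "F.cle (emb X) (emb (ys k))" using f(2) F.cle_trans F.cle_conj by blast
  then show "\<exists>k. cuntz_le st X (ys k)" using cuntz_le_iff[OF kposD(1)[OF X] stab_ys] by blast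
qed

lemma cuntz_semigroup_O8:
  assumes pos: "kpos st x'" "kpos st x" "kpos st y'" "kpos st y" "kpos st z" "kpos st w"
    and ww: "cuntz_eq st (dsum w w) w" and ll: "cu_ll st (dsum x y) (dsum z w)"
    and x': "cu_ll st x' x" and y': "cu_ll st y' y"
  shows "\<exists>z1 z2. kpos st z1 \<and> kpos st z2 \<and> cu_ll st (dsum z1 z2) z \<and>
    cu_ll st x' (dsum z1 w) \<and> cu_ll st y' (dsum z2 w) \<and>
    cu_ll st z1 (dsum x w) \<and> cu_ll st z2 (dsum y w)"
proof -
  note P = kposD(2)[OF pos(1)] kposD(2)[OF pos(2)] kposD(2)[OF pos(3)] kposD(2)[OF pos(4)]
    kposD(2)[OF pos(5)] kposD(2)[OF pos(6)]
  note St = kposD(1)[OF pos(1)] kposD(1)[OF pos(2)] kposD(1)[OF pos(3)] kposD(1)[OF pos(4)]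
    kposD(1)[OF pos(5)] kposD(1)[OF pos(6)]
  have kpos_dsum: "kpos st (dsum a b)" if "kpos st a" "kpos st b" for a b
  proof -
    have "kpos st (prj (F.dsm (emb a) (emb b)))" using that by (intro kpos_prj F.pos_dsm kposD(2))
    then show ?thesis using that by (simp add: prj_emb dsum_stab kposD flip: emb_dsum)
  qed
  have ww': "F.cle (F.dsm (emb w) (emb w)) (emb w)"
    using ww cuntz_le_iff[OF dsum_stab[OF St(6,6)] St(6)] by (simp add: cuntz_eq_def emb_dsum St)
  obtain f where "0 < f" "F.cle (emb (dsum x y)) (F.cut f (emb (dsum z w)))"
    using cu_ll_imp_cle_cut[OF kpos_dsum kpos_dsum ll] pos by blast
  then have le: "F.cle (F.dsm (emb x) (emb y)) (F.dsm (emb z) (emb w))"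
    using F.cle_trans[OF _ F.cle_cut_self[OF F.pos_dsm[OF P(5,6)]], of _ f]
    by (simp add: emb_dsum St)
  obtain e1 where e1: "0 < e1" "F.cle (emb x') (F.cut e1 (emb x))"
    using cu_ll_imp_cle_cut[OF pos(1,2) x'] by blast
  obtain e2 where e2: "0 < e2" "F.cle (emb y') (F.cut e2 (emb y))"
    using cu_ll_imp_cle_cut[OF pos(3,4) y'] by blast
  define e where "e = min e1 e2"
  have e: "0 < e" "e \<le> e1" "e \<le> e2" using e1 e2 by (auto simp: e_def)
  have xe: "F.cle (emb x') (F.cut e (emb x))"
    using F.cle_trans[OF e1(2) F.cle_cut_mono[OF P(2) _ e(2)]] e(1) by simp
  have ye: "F.cle (emb y') (F.cut e (emb y))"
    using F.cle_trans[OF e2(2) F.cle_cut_mono[OF P(4) _ e(3)]] e(1) by simp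
  obtain Z1 Z2 where Z: "F.pos Z1" "F.pos Z2"
    "\<exists>f>0. F.cle (F.dsm Z1 Z2) (F.cut f (emb z))"
    "\<exists>f>0. F.cle (F.cut e (emb x)) (F.cut f (F.dsm Z1 (emb w)))"
    "\<exists>f>0. F.cle (F.cut e (emb y)) (F.cut f (F.dsm Z2 (emb w)))"
    "\<exists>f>0. F.cle Z1 (F.cut f (F.dsm (emb x) (emb w)))"
    "\<exists>f>0. F.cle Z2 (F.cut f (F.dsm (emb y) (emb w)))"
    using F.O8_cle[OF P(6) ww' P(2,4,5) le e(1)] by blast
  define z1 where "z1 = prj Z1"
  define z2 where "z2 = prj Z2"
  have z: "kpos st z1" "kpos st z2" using Z kpos_prj by (auto simp: z1_def z2_def)
  \<comment> \<open>\<open>Z1\<close> and \<open>Z2\<close> are elements of the whole product.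
    Applying \<open>emb\<close> after \<open>prj\<close> to a comparison
    \<open>cle A (cut f B)\<close> moves it into the summand, where it characterizes
    way-below.\<close>
  have ll: "cu_ll st a b"
    if ab: "kpos st a" "kpos st b" and le: "\<exists>f>0. F.cle A (F.cut f B)" and B: "F.pos B"
      and A': "emb (prj A) = emb a" and B': "emb (prj B) = emb b" for a b A B
  proof -
    obtain f where f: "0 < f" "F.cle A (F.cut f B)" using le by blast
    have "F.cle (emb a) (F.cut f (emb b))"
      using cle_emb_prj[OF f(2)] by (simp add: emb_prj_cut[OF B f(1)] A' B')
    then show ?thesis by (rule cu_ll_if_cle_cut[OF ab f(1)])
  qed
  have c4: "\<exists>f>0. F.cle (emb x') (F.cut f (F.dsm Z1 (emb w)))"
    using Z(4) F.cle_trans[OF xe] by blast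
  have c5: "\<exists>f>0. F.cle (emb y') (F.cut f (F.dsm Z2 (emb w)))"
    using Z(5) F.cle_trans[OF ye] by blast
  note simps = emb_prj_dsm prj_emb St emb_dsum z1_def z2_def prj_stab
  have "cu_ll st (dsum z1 z2) z"
    by (rule ll[OF kpos_dsum[OF z] pos(5) Z(3) P(5)]) (simp_all add: simps)
  moreover have "cu_ll st x' (dsum z1 w)"
    by (rule ll[OF pos(1) kpos_dsum[OF z(1) pos(6)] c4 F.pos_dsm[OF Z(1) P(6)]]) (simp_all add: simps)
  moreover have "cu_ll st y' (dsum z2 w)"
    by (rule ll[OF pos(3) kpos_dsum[OF z(2) pos(6)] c5 F.pos_dsm[OF Z(2) P(6)]]) (simp_all add: simps)
  moreover have "cu_ll st z1 (dsum x w)"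
    by (rule ll[OF z(1) kpos_dsum[OF pos(2,6)] Z(6) F.pos_dsm[OF P(2,6)]]) (simp_all add: simps)
  moreover have "cu_ll st z2 (dsum y w)"
    by (rule ll[OF z(2) kpos_dsum[OF pos(4,6)] Z(7) F.pos_dsm[OF P(4,6)]]) (simp_all add: simps)
  ultimately show ?thesis using z by blast
qed

end

theorem mainTheorem14:
  fixes cs :: "complex \<Rightarrow> 'a::{real_normed_algebra,banach} \<Rightarrow> 'a"
    and st :: "'a \<Rightarrow> 'a"
  assumes "cstar_algebra cs st"
  shows "\<forall>x' x y' y z w.
    kpos st x' \<and> kpos st x \<and> kpos st y' \<and> kpos st y \<and> kpos st z \<and> kpos st w \<and>
    cuntz_eq st (dsum w w) w \<and>
    cu_ll st (dsum x y) (dsum z w) \<and> cu_ll st x' x \<and> cu_ll st y' y \<longrightarrow>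
    (\<exists>z1 z2. kpos st z1 \<and> kpos st z2 \<and>
       cu_ll st (dsum z1 z2) z \<and>
       cu_ll st x' (dsum z1 w) \<and> cu_ll st y' (dsum z2 w) \<and>
       cu_ll st z1 (dsum x w) \<and> cu_ll st z2 (dsum y w))"
  by (intro allI impI, elim conjE) (rule cstar.cuntz_semigroup_O8[OF cstar.intro[OF assms]])

end
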